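(* Let $M$ be a finite aperiodic regular monoid. Then the global dimension of $\mathbb ZM$ is finite; in fact, it is bounded above by $3n-2$, where $n$ is the number of $\mathscr J$-classes of $M$. Consequently, $H_q(M,\mathbb Z)=0$ for all $q$ sufficiently large. Moreover, the trivial module $\mathbb Z$ has a finite projective resolution by finitely generated projective $\mathbb ZM$-modules.
   Context: A monoid $M$ is (von Neumann) regular if for every $s\in M$ there is $t\in M$ with $sts=s$. For an idempotent $e\in M$, the maximal subgroup $G_e$ is the group of units of the monoid $eMe$; $M$ is aperiodic if every maximal subgroup is trivial. Two elements of $M$ are $\mathscr J$-equivalent if they generate the same principal two-sided ideal ($MaM=MbM$); $\mathscr J$-classes are the equivalence classes. $\mathbb ZM$ is the integral monoid ring, and global dimension means left global dimension. The trivial (left or right) $\mathbb ZM$-module $\mathbb Z$ is the one on which every element of $M$ acts as the identity, and $H_q(M,\mathbb Z)=\operatorname{Tor}_q^{\mathbb ZM}(\mathbb Z,\mathbb Z)$ with trivial module structures. *)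

theory Defs
  imports "HOL-Algebra.Algebra" "HOL-Library.Extended_Nat"
begin

section \<open>Monoids\<close>

definition regular_monoid :: "('m, 'x) monoid_scheme \<Rightarrow> bool" where
  "regular_monoid M \<longleftrightarrow>
     (\<forall>s \<in> carrier M. \<exists>t \<in> carrier M. s \<otimes>\<^bsub>M\<^esub> t \<otimes>\<^bsub>M\<^esub> s = s)"

definition corner_monoid :: "('m, 'x) monoid_scheme \<Rightarrow> 'm \<Rightarrow> ('m, 'x) monoid_scheme" where
  "corner_monoid M e =
     M \<lparr>carrier := {e \<otimes>\<^bsub>M\<^esub> m \<otimes>\<^bsub>M\<^esub> e | m. m \<in> carrier M}, one := e\<rparr>"

definition maximal_subgroup :: "('m, 'x) monoid_scheme \<Rightarrow> 'm \<Rightarrow> 'm monoid" where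
  "maximal_subgroup M e = units_of (corner_monoid M e)"

definition aperiodic_monoid :: "('m, 'x) monoid_scheme \<Rightarrow> bool" where
  "aperiodic_monoid M \<longleftrightarrow>
     (\<forall>e \<in> carrier M. e \<otimes>\<^bsub>M\<^esub> e = e \<longrightarrow> trivial_group (maximal_subgroup M e))"

definition principal_two_sided_ideal :: "('m, 'x) monoid_scheme \<Rightarrow> 'm \<Rightarrow> 'm set" where
  "principal_two_sided_ideal M a =
     {x \<otimes>\<^bsub>M\<^esub> a \<otimes>\<^bsub>M\<^esub> y | x y. x \<in> carrier M \<and> y \<in> carrier M}"

definition J_rel :: "('m, 'x) monoid_scheme \<Rightarrow> ('m \<times> 'm) set" where
  "J_rel M = {(a, b) \<in> carrier M \<times> carrier M.
     principal_two_sided_ideal M a = principal_two_sided_ideal M b}"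

definition J_classes :: "('m, 'x) monoid_scheme \<Rightarrow> 'm set set" where
  "J_classes M = carrier M // J_rel M"

text \<open>
  Elements of \<open>\<int>M\<close> are finitely supported functions into the integers, written as formal sums of
  elements \<open>frag_of m\<close>.  The product is the biadditive extension of
  \<open>frag_of x \<cdot> frag_of y = frag_of (x \<otimes> y)\<close>.
\<close>

definition int_monoid_ring :: "('m, 'x) monoid_scheme \<Rightarrow> ('m \<Rightarrow>\<^sub>0 int) ring" where
  "int_monoid_ring M =
     \<lparr>carrier = {f. Poly_Mapping.keys f \<subseteq> carrier M},
      monoid.mult = (\<lambda>f g. frag_extend (\<lambda>x. frag_extend (\<lambda>y. frag_of (x \<otimes>\<^bsub>M\<^esub> y)) g) f),
      one = frag_of \<one>\<^bsub>M\<^esub>,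
      ring.zero = 0,
      ring.add = (+)\<rparr>"

section \<open>Modules over noncommutative rings\<close>

text \<open>
  The locale \<open>module\<close> of HOL-Algebra requires a commutative ring of scalars, so only its
  record type is reused here.  The fields \<open>mult\<close> and \<open>one\<close> of that record play no role.
\<close>

locale left_module = R?: ring R + N?: abelian_group N
  for R :: "('r, 'x) ring_scheme" (structure) and N :: "('r, 'b, 'y) module_scheme" (structure) +
  assumes smult_closed:
      "\<lbrakk>a \<in> carrier R; x \<in> carrier N\<rbrakk> \<Longrightarrow> a \<odot>\<^bsub>N\<^esub> x \<in> carrier N"
    and smult_l_distr:
      "\<lbrakk>a \<in> carrier R; b \<in> carrier R; x \<in> carrier N\<rbrakk> \<Longrightarrow>
       (a \<oplus>\<^bsub>R\<^esub> b) \<odot>\<^bsub>N\<^esub> x = a \<odot>\<^bsub>N\<^esub> x \<oplus>\<^bsub>N\<^esub> b \<odot>\<^bsub>N\<^esub> x"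
    and smult_r_distr:
      "\<lbrakk>a \<in> carrier R; x \<in> carrier N; y \<in> carrier N\<rbrakk> \<Longrightarrow>
       a \<odot>\<^bsub>N\<^esub> (x \<oplus>\<^bsub>N\<^esub> y) = a \<odot>\<^bsub>N\<^esub> x \<oplus>\<^bsub>N\<^esub> a \<odot>\<^bsub>N\<^esub> y"
    and smult_assoc:
      "\<lbrakk>a \<in> carrier R; b \<in> carrier R; x \<in> carrier N\<rbrakk> \<Longrightarrow>
       (a \<otimes>\<^bsub>R\<^esub> b) \<odot>\<^bsub>N\<^esub> x = a \<odot>\<^bsub>N\<^esub> (b \<odot>\<^bsub>N\<^esub> x)"
    and smult_one:
      "x \<in> carrier N \<Longrightarrow> \<one>\<^bsub>R\<^esub> \<odot>\<^bsub>N\<^esub> x = x"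

definition lmod_hom ::
  "('r, 'x) ring_scheme \<Rightarrow> ('r, 'a) module \<Rightarrow> ('r, 'b) module \<Rightarrow> ('a \<Rightarrow> 'b) set" where
  "lmod_hom R N L = {h \<in> carrier N \<rightarrow> carrier L.
     (\<forall>x \<in> carrier N. \<forall>y \<in> carrier N. h (x \<oplus>\<^bsub>N\<^esub> y) = h x \<oplus>\<^bsub>L\<^esub> h y) \<and>
     (\<forall>a \<in> carrier R. \<forall>x \<in> carrier N. h (a \<odot>\<^bsub>N\<^esub> x) = a \<odot>\<^bsub>L\<^esub> h x)}"

definition lmod_iso ::
  "('r, 'x) ring_scheme \<Rightarrow> ('r, 'a) module \<Rightarrow> ('r, 'b) module \<Rightarrow> ('a \<Rightarrow> 'b) set" where
  "lmod_iso R N L = {h \<in> lmod_hom R N L. bij_betw h (carrier N) (carrier L)}"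

definition lmod_direct_sum ::
  "('r, 'a) module \<Rightarrow> ('r, 'b) module \<Rightarrow> ('r, 'a \<times> 'b) module" where
  "lmod_direct_sum N L =
     \<lparr>carrier = carrier N \<times> carrier L,
      monoid.mult = undefined,
      one = undefined,
      ring.zero = (\<zero>\<^bsub>N\<^esub>, \<zero>\<^bsub>L\<^esub>),
      ring.add = (\<lambda>(x, y) (x', y'). (x \<oplus>\<^bsub>N\<^esub> x', y \<oplus>\<^bsub>L\<^esub> y')),
      smult = (\<lambda>a (x, y). (a \<odot>\<^bsub>N\<^esub> x, a \<odot>\<^bsub>L\<^esub> y))\<rparr>"

text \<open>The free left module with basis \<open>B\<close>.\<close>

definition free_left_module ::
  "('r, 'x) ring_scheme \<Rightarrow> 'i set \<Rightarrow> ('r, 'i \<Rightarrow> 'r) module" where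
  "free_left_module R B =
     \<lparr>carrier = {f. (\<forall>i. f i \<in> carrier R) \<and> (\<forall>i. i \<notin> B \<longrightarrow> f i = \<zero>\<^bsub>R\<^esub>) \<and>
                    finite {i. f i \<noteq> \<zero>\<^bsub>R\<^esub>}},
      monoid.mult = undefined,
      one = undefined,
      ring.zero = (\<lambda>_. \<zero>\<^bsub>R\<^esub>),
      ring.add = (\<lambda>f g i. f i \<oplus>\<^bsub>R\<^esub> g i),
      smult = (\<lambda>a f i. a \<otimes>\<^bsub>R\<^esub> f i)\<rparr>"

text \<open>
  A module is projective if it is a direct summand of a free module.  The basis \<open>B\<close> and the
  complement \<open>Q\<close> are drawn from fixed types.  This is no restriction: a direct summand \<open>P\<close> of any
  free module is also a direct summand of the free module with basis the set \<open>carrier P\<close>, and the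
  complement can then be taken to be a submodule of that free module.
\<close>

definition projective_module :: "('r, 'x) ring_scheme \<Rightarrow> ('r, 'p) module \<Rightarrow> bool" where
  "projective_module R P \<longleftrightarrow> left_module R P \<and>
     (\<exists>(B :: 'p set) (Q :: ('r, 'p \<Rightarrow> 'r) module). left_module R Q \<and>
        lmod_iso R (lmod_direct_sum P Q) (free_left_module R B) \<noteq> {})"

definition fg_module :: "('r, 'x) ring_scheme \<Rightarrow> ('r, 'p) module \<Rightarrow> bool" where
  "fg_module R P \<longleftrightarrow> left_module R P \<and>
     (\<exists>S. finite S \<and> S \<subseteq> carrier P \<and>
        (\<forall>H. submodule H R P \<and> S \<subseteq> H \<longrightarrow> H = carrier P))"

section \<open>Projective resolutions and global dimension\<close>

text \<open>
  \<open>\<dots> \<rightarrow> P 2 \<rightarrow> P 1 \<rightarrow> P 0 \<rightarrow> N \<rightarrow> 0\<close> with differentials \<open>d n : P (Suc n) \<rightarrow> P n\<close> and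
  augmentation \<open>\<epsilon> : P 0 \<rightarrow> N\<close>.
\<close>

definition projective_resolution ::
  "('r, 'x) ring_scheme \<Rightarrow> ('r, 'b) module \<Rightarrow> (nat \<Rightarrow> ('r, 'p) module) \<Rightarrow>
   (nat \<Rightarrow> 'p \<Rightarrow> 'p) \<Rightarrow> ('p \<Rightarrow> 'b) \<Rightarrow> bool" where
  "projective_resolution R N P d \<epsilon> \<longleftrightarrow>
     left_module R N \<and>
     (\<forall>n. projective_module R (P n)) \<and>
     (\<forall>n. d n \<in> lmod_hom R (P (Suc n)) (P n)) \<and>
     \<epsilon> \<in> lmod_hom R (P 0) N \<and>
     \<epsilon> ` carrier (P 0) = carrier N \<and>
     d 0 ` carrier (P 1) = {x \<in> carrier (P 0). \<epsilon> x = \<zero>\<^bsub>N\<^esub>} \<and>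
     (\<forall>n. d (Suc n) ` carrier (P (Suc (Suc n))) =
            {x \<in> carrier (P (Suc n)). d n x = \<zero>\<^bsub>P n\<^esub>})"

definition length_at_most :: "(nat \<Rightarrow> ('r, 'p) module) \<Rightarrow> nat \<Rightarrow> bool" where
  "length_at_most P l \<longleftrightarrow> (\<forall>n > l. carrier (P n) = {\<zero>\<^bsub>P n\<^esub>})"

text \<open>
  Resolutions of a module with elements of type \<open>'b\<close> over a ring with elements of type \<open>'r\<close> are
  built from modules with elements of the following type.  As an infinite type containing copies
  of \<open>'r\<close> and \<open>'b\<close> it is large enough to hold, up to isomorphism, the free modules on the module and
  on all its iterated syzygies.  Hence every module has a projective resolution in this
  type, and the length of a shortest one does not depend on this choice.
\<close>

type_synonym ('r, 'b) res_carrier = "('r + 'b) list"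

definition proj_dim :: "('r, 'x) ring_scheme \<Rightarrow> ('r, 'b) module \<Rightarrow> enat" where
  "proj_dim R N =
     (INF l \<in> {l. \<exists>(P :: nat \<Rightarrow> ('r, ('r, 'b) res_carrier) module) d \<epsilon>.
                   projective_resolution R N P d \<epsilon> \<and> length_at_most P l}. enat l)"

text \<open>
  HOL cannot quantify over the carrier type inside a term, so the type of the elements of the
  modules is an argument; a bound on the global dimension is a statement for every type \<open>'b\<close>.
\<close>

definition left_global_dim :: "('r, 'x) ring_scheme \<Rightarrow> 'b itself \<Rightarrow> enat" where
  "left_global_dim R (_ :: 'b itself) =
     (SUP N \<in> {N :: ('r, 'b) module. left_module R N}. proj_dim R N)"

section \<open>Tensor products and Tor\<close>

text \<open>
  A right module \<open>A\<close> is represented in the same record type as a left module, \<open>r \<odot>\<^bsub>A\<^esub> a\<close>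
  standing for \<open>a \<cdot> r\<close>.
\<close>

definition tensor_relations ::
  "('r, 'x) ring_scheme \<Rightarrow> ('r, 'a) module \<Rightarrow> ('r, 'b) module \<Rightarrow> ('a \<times> 'b \<Rightarrow>\<^sub>0 int) set" where
  "tensor_relations R A B =
     {frag_of (a \<oplus>\<^bsub>A\<^esub> a', b) - frag_of (a, b) - frag_of (a', b) | a a' b.
        a \<in> carrier A \<and> a' \<in> carrier A \<and> b \<in> carrier B} \<union>
     {frag_of (a, b \<oplus>\<^bsub>B\<^esub> b') - frag_of (a, b) - frag_of (a, b') | a b b'.
        a \<in> carrier A \<and> b \<in> carrier B \<and> b' \<in> carrier B} \<union>
     {frag_of (r \<odot>\<^bsub>A\<^esub> a, b) - frag_of (a, r \<odot>\<^bsub>B\<^esub> b) | a r b.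
        a \<in> carrier A \<and> r \<in> carrier R \<and> b \<in> carrier B}"

definition tensor_kernel ::
  "('r, 'x) ring_scheme \<Rightarrow> ('r, 'a) module \<Rightarrow> ('r, 'b) module \<Rightarrow> ('a \<times> 'b \<Rightarrow>\<^sub>0 int) set" where
  "tensor_kernel R A B =
     generate (free_Abelian_group (carrier A \<times> carrier B)) (tensor_relations R A B)"

definition tensor_product ::
  "('r, 'x) ring_scheme \<Rightarrow> ('r, 'a) module \<Rightarrow> ('r, 'b) module \<Rightarrow>
   ('a \<times> 'b \<Rightarrow>\<^sub>0 int) set monoid" where
  "tensor_product R A B =
     free_Abelian_group (carrier A \<times> carrier B) Mod tensor_kernel R A B"

text \<open>The map \<open>id \<otimes> h : A \<otimes> B \<rightarrow> A \<otimes> B'\<close> on cosets, where \<open>h : B \<rightarrow> B'\<close>.\<close>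

definition tensor_map ::
  "('r, 'x) ring_scheme \<Rightarrow> ('r, 'a) module \<Rightarrow> ('r, 'c) module \<Rightarrow> ('b \<Rightarrow> 'c) \<Rightarrow>
   ('a \<times> 'b \<Rightarrow>\<^sub>0 int) set \<Rightarrow> ('a \<times> 'c \<Rightarrow>\<^sub>0 int) set" where
  "tensor_map R A B' h C =
     (\<Union>c \<in> C. tensor_kernel R A B'
        #>\<^bsub>free_Abelian_group (carrier A \<times> carrier B')\<^esub>
        frag_extend (\<lambda>(a, b). frag_of (a, h b)) c)"

text \<open>Chain complexes of groups in degrees \<open>n \<ge> 0\<close> with \<open>\<delta> n : C (Suc n) \<rightarrow> C n\<close>.\<close>

fun chain_cycles :: "(nat \<Rightarrow> 'g monoid) \<Rightarrow> (nat \<Rightarrow> 'g \<Rightarrow> 'g) \<Rightarrow> nat \<Rightarrow> 'g set" where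
  "chain_cycles C \<delta> 0 = carrier (C 0)"
| "chain_cycles C \<delta> (Suc n) = kernel (C (Suc n)) (C n) (\<delta> n)"

definition chain_homology ::
  "(nat \<Rightarrow> 'g monoid) \<Rightarrow> (nat \<Rightarrow> 'g \<Rightarrow> 'g) \<Rightarrow> nat \<Rightarrow> 'g set monoid" where
  "chain_homology C \<delta> q =
     (C q) \<lparr>carrier := chain_cycles C \<delta> q\<rparr> Mod (\<delta> q ` carrier (C (Suc q)))"

text \<open>
  \<open>Tor\<close> is computed from some projective resolution of the second argument; one always exists in
  the type \<open>res_carrier\<close>, and up to isomorphism the result does not depend on it.
\<close>

definition Tor ::
  "('r, 'x) ring_scheme \<Rightarrow> ('r, 'a) module \<Rightarrow> ('r, 'b) module \<Rightarrow> nat \<Rightarrow>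
   ('a \<times> ('r, 'b) res_carrier \<Rightarrow>\<^sub>0 int) set set monoid" where
  "Tor R A N q =
     (let (P, d) = (SOME (P, d). \<exists>\<epsilon>. projective_resolution R N P d \<epsilon>)
      in chain_homology (\<lambda>n. tensor_product R A (P n)) (\<lambda>n. tensor_map R A (P n) (d n)) q)"

section \<open>Homology of monoids\<close>

text \<open>
  \<open>\<int>\<close> with every element of \<open>M\<close> acting as the identity: a formal sum acts as multiplication by the
  sum of its coefficients.  Read as above, the same record is the trivial right module.
\<close>

definition trivial_module :: "('m, 'x) monoid_scheme \<Rightarrow> ('m \<Rightarrow>\<^sub>0 int, int) module" where
  "trivial_module M =
     \<lparr>carrier = UNIV,
      monoid.mult = undefined,
      one = undefined,
      ring.zero = 0,
      ring.add = (+),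
      smult = (\<lambda>f k. (\<Sum>m \<in> Poly_Mapping.keys f. Poly_Mapping.lookup f m) * k)\<rparr>"

definition monoid_homology ::
  "('m, 'x) monoid_scheme \<Rightarrow> nat \<Rightarrow>
   (int \<times> ('m \<Rightarrow>\<^sub>0 int, int) res_carrier \<Rightarrow>\<^sub>0 int) set set monoid" where
  "monoid_homology M q =
     Tor (int_monoid_ring M) (trivial_module M) (trivial_module M) q"

end

(*
  Order the J-classes of M by inclusion of ideals.  For an L-class L and an abelian group A let A[L]
  be the module of functions L -> A, where products leaving L count as zero.  Every L-class of a
  regular monoid contains an idempotent e, and then A[L] is the quotient of the module A[Me], which
  is projective if A is free abelian, by the module A[T] of a left ideal T consisting of elements
  strictly below e; hence the projective dimension of A[L] is at most the number of J-classes below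
  L, and one more for arbitrary A, because subgroups of free abelian groups are free.

  A module N annihilated by an ideal I is compared with A[L], where L is the L-class of an
  idempotent e in a minimal J-class outside I and A = eN: as the maximal subgroup at e is trivial,
  kernel and cokernel of the multiplication A[L] -> N are annihilated by the larger ideal I \<union> MeM.
  Induction gives projective dimension at most 2n - 1, which is at most 3n - 2.  By Schanuel's
  argument the syzygies of every resolution are projective from that degree on, which makes Tor
  vanish; resolving by free modules on finite sets of generators gives the last claim, since the
  additive group of the monoid ring is finitely generated.
*)

theory Submission
  imports Defs
begin

section \<open>Homomorphisms, submodules and quotients\<close>

text \<open>The obstacle that shapes the proof is typing. A recursive notion of projective dimension
  has to keep all its modules in one type \<open>'u\<close>, so free modules, sums, pullbacks and
  kernels are replaced by isomorphic copies there; an infinite type large enough for the ring has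
  room for them. \<open>pdim_le\<close> carries the results back to modules of any type.

  The computation behind the induction: if f lies in A[L], then e f is concentrated at e, because ey
  in L forces ey = e once the maximal subgroup at e is trivial. An f in the kernel of A[L] -> N
  therefore has e f = 0, and the cokernel is killed because eN lies in the image. Over the integers
  eN need not be free, hence the care for arbitrary coefficients.

  The constants: heights start at 1, so A[L] has dimension at most n - 1 for free A and n for any A.
  Each J-class added to the ideal costs one, since the image of A[L] is a cokernel of the kernel.
  The induction starts at n - 1, the least value for which the bound n for A[L] fits into its first
  step, and takes n steps.\<close>

text \<open>The scalar minus one supplies additive inverses, provided that the zero scalar acts as
  zero; this law takes the place of an axiom on inverses.\<close>

lemma left_moduleI:
  assumes "ring R"
    and add_closed: "\<And>x y. \<lbrakk>x \<in> carrier N; y \<in> carrier N\<rbrakk> \<Longrightarrow> x \<oplus>\<^bsub>N\<^esub> y \<in> carrier N"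
    and zero_closed: "\<zero>\<^bsub>N\<^esub> \<in> carrier N"
    and add_assoc: "\<And>x y z. \<lbrakk>x \<in> carrier N; y \<in> carrier N; z \<in> carrier N\<rbrakk> \<Longrightarrow>
      (x \<oplus>\<^bsub>N\<^esub> y) \<oplus>\<^bsub>N\<^esub> z = x \<oplus>\<^bsub>N\<^esub> (y \<oplus>\<^bsub>N\<^esub> z)"
    and add_comm: "\<And>x y. \<lbrakk>x \<in> carrier N; y \<in> carrier N\<rbrakk> \<Longrightarrow> x \<oplus>\<^bsub>N\<^esub> y = y \<oplus>\<^bsub>N\<^esub> x"
    and l_zero: "\<And>x. x \<in> carrier N \<Longrightarrow> \<zero>\<^bsub>N\<^esub> \<oplus>\<^bsub>N\<^esub> x = x"
    and smult_closed: "\<And>a x. \<lbrakk>a \<in> carrier R; x \<in> carrier N\<rbrakk> \<Longrightarrow> a \<odot>\<^bsub>N\<^esub> x \<in> carrier N"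
    and smult_l_distr: "\<And>a b x. \<lbrakk>a \<in> carrier R; b \<in> carrier R; x \<in> carrier N\<rbrakk> \<Longrightarrow>
       (a \<oplus>\<^bsub>R\<^esub> b) \<odot>\<^bsub>N\<^esub> x = a \<odot>\<^bsub>N\<^esub> x \<oplus>\<^bsub>N\<^esub> b \<odot>\<^bsub>N\<^esub> x"
    and smult_r_distr: "\<And>a x y. \<lbrakk>a \<in> carrier R; x \<in> carrier N; y \<in> carrier N\<rbrakk> \<Longrightarrow>
       a \<odot>\<^bsub>N\<^esub> (x \<oplus>\<^bsub>N\<^esub> y) = a \<odot>\<^bsub>N\<^esub> x \<oplus>\<^bsub>N\<^esub> a \<odot>\<^bsub>N\<^esub> y"
    and smult_assoc: "\<And>a b x. \<lbrakk>a \<in> carrier R; b \<in> carrier R; x \<in> carrier N\<rbrakk> \<Longrightarrow>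
       (a \<otimes>\<^bsub>R\<^esub> b) \<odot>\<^bsub>N\<^esub> x = a \<odot>\<^bsub>N\<^esub> (b \<odot>\<^bsub>N\<^esub> x)"
    and smult_one: "\<And>x. x \<in> carrier N \<Longrightarrow> \<one>\<^bsub>R\<^esub> \<odot>\<^bsub>N\<^esub> x = x"
    and smult_l_zero: "\<And>x. x \<in> carrier N \<Longrightarrow> \<zero>\<^bsub>R\<^esub> \<odot>\<^bsub>N\<^esub> x = \<zero>\<^bsub>N\<^esub>"
  shows "left_module R N"
proof -
  interpret R: ring R by fact
  have "abelian_group N"
  proof (rule abelian_groupI)
    fix x assume x: "x \<in> carrier N"
    have "(\<ominus>\<^bsub>R\<^esub> \<one>\<^bsub>R\<^esub>) \<odot>\<^bsub>N\<^esub> x \<oplus>\<^bsub>N\<^esub> x = (\<ominus>\<^bsub>R\<^esub> \<one>\<^bsub>R\<^esub> \<oplus>\<^bsub>R\<^esub> \<one>\<^bsub>R\<^esub>) \<odot>\<^bsub>N\<^esub> x"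
      using x by (simp add: smult_l_distr smult_one)
    also have "\<dots> = \<zero>\<^bsub>N\<^esub>" using x by (simp add: R.l_neg smult_l_zero)
    finally show "\<exists>y \<in> carrier N. y \<oplus>\<^bsub>N\<^esub> x = \<zero>\<^bsub>N\<^esub>"
      using x by (intro bexI[of _ "(\<ominus>\<^bsub>R\<^esub> \<one>\<^bsub>R\<^esub>) \<odot>\<^bsub>N\<^esub> x"]) (auto intro: smult_closed)
  qed (use assms in auto)
  then show ?thesis
    using assms by (auto simp: left_module_def left_module_axioms_def)
qed

context left_module begin

lemma smult_l_zero: "x \<in> carrier N \<Longrightarrow> \<zero> \<odot>\<^bsub>N\<^esub> x = \<zero>\<^bsub>N\<^esub>"
  using smult_l_distr[of \<zero> \<zero> x] smult_closed[of \<zero> x]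
  by (metis N.add.l_cancel_one' R.add.l_cancel_one' R.zero_closed)

lemma smult_r_zero: "a \<in> carrier R \<Longrightarrow> a \<odot>\<^bsub>N\<^esub> \<zero>\<^bsub>N\<^esub> = \<zero>\<^bsub>N\<^esub>"
  using smult_r_distr[of a "\<zero>\<^bsub>N\<^esub>" "\<zero>\<^bsub>N\<^esub>"] smult_closed[of a "\<zero>\<^bsub>N\<^esub>"]
  by (metis N.add.l_cancel_one' N.zero_closed)

lemma smult_minus_one: "x \<in> carrier N \<Longrightarrow> (\<ominus> \<one>) \<odot>\<^bsub>N\<^esub> x = \<ominus>\<^bsub>N\<^esub> x"
  using smult_l_distr[of "\<ominus> \<one>" \<one> x] smult_closed[of "\<ominus> \<one>" x]
  by (metis N.minus_equality R.l_neg R.add.inv_closed R.one_closed smult_l_zero smult_one)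

lemma smult_r_neg: "\<lbrakk>a \<in> carrier R; x \<in> carrier N\<rbrakk> \<Longrightarrow> a \<odot>\<^bsub>N\<^esub> (\<ominus>\<^bsub>N\<^esub> x) = \<ominus>\<^bsub>N\<^esub> (a \<odot>\<^bsub>N\<^esub> x)"
  using smult_r_distr[of a "\<ominus>\<^bsub>N\<^esub> x" x]
  by (metis N.a_inv_closed N.l_neg N.minus_equality smult_closed smult_r_zero)

lemma smult_r_minus:
  "\<lbrakk>a \<in> carrier R; x \<in> carrier N; y \<in> carrier N\<rbrakk> \<Longrightarrow>
   a \<odot>\<^bsub>N\<^esub> (x \<ominus>\<^bsub>N\<^esub> y) = a \<odot>\<^bsub>N\<^esub> x \<ominus>\<^bsub>N\<^esub> a \<odot>\<^bsub>N\<^esub> y"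
  by (simp add: N.minus_eq smult_r_distr smult_r_neg)

lemma left_module_sub:
  assumes "H \<subseteq> carrier N" "\<zero>\<^bsub>N\<^esub> \<in> H"
    and "\<And>x y. \<lbrakk>x \<in> H; y \<in> H\<rbrakk> \<Longrightarrow> x \<oplus>\<^bsub>N\<^esub> y \<in> H"
    and "\<And>a x. \<lbrakk>a \<in> carrier R; x \<in> H\<rbrakk> \<Longrightarrow> a \<odot>\<^bsub>N\<^esub> x \<in> H"
  shows "left_module R (N\<lparr>carrier := H\<rparr>)"
  using assms
  by (intro left_moduleI)
    (auto simp: subset_iff R.ring_axioms N.a_assoc smult_l_distr smult_r_distr smult_assoc smult_one smult_l_zero
        intro: N.a_comm)

end

lemma lmod_homI:
  assumes "\<And>x. x \<in> carrier N \<Longrightarrow> h x \<in> carrier L"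
    and "\<And>x y. \<lbrakk>x \<in> carrier N; y \<in> carrier N\<rbrakk> \<Longrightarrow> h (x \<oplus>\<^bsub>N\<^esub> y) = h x \<oplus>\<^bsub>L\<^esub> h y"
    and "\<And>a x. \<lbrakk>a \<in> carrier R; x \<in> carrier N\<rbrakk> \<Longrightarrow> h (a \<odot>\<^bsub>N\<^esub> x) = a \<odot>\<^bsub>L\<^esub> h x"
  shows "h \<in> lmod_hom R N L"
  using assms by (auto simp: lmod_hom_def)

lemma lmod_hom_closed: "\<lbrakk>h \<in> lmod_hom R N L; x \<in> carrier N\<rbrakk> \<Longrightarrow> h x \<in> carrier L"
  by (auto simp: lmod_hom_def)

lemma lmod_hom_add:
  "\<lbrakk>h \<in> lmod_hom R N L; x \<in> carrier N; y \<in> carrier N\<rbrakk> \<Longrightarrow> h (x \<oplus>\<^bsub>N\<^esub> y) = h x \<oplus>\<^bsub>L\<^esub> h y"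
  by (auto simp: lmod_hom_def)

lemma lmod_hom_smult:
  "\<lbrakk>h \<in> lmod_hom R N L; a \<in> carrier R; x \<in> carrier N\<rbrakk> \<Longrightarrow> h (a \<odot>\<^bsub>N\<^esub> x) = a \<odot>\<^bsub>L\<^esub> h x"
  by (auto simp: lmod_hom_def)

lemma lmod_hom_comp:
  "\<lbrakk>g \<in> lmod_hom R N L; h \<in> lmod_hom R L K\<rbrakk> \<Longrightarrow> (\<lambda>x. h (g x)) \<in> lmod_hom R N K"
  by (auto simp: lmod_hom_def Pi_iff)

lemma lmod_hom_id: "(\<lambda>x. x) \<in> lmod_hom R N N"
  by (auto simp: lmod_hom_def)

lemma lmod_hom_restrict:
  "\<lbrakk>h \<in> lmod_hom R N L; H \<subseteq> carrier N; h ` H \<subseteq> J\<rbrakk> \<Longrightarrow>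
    h \<in> lmod_hom R (N\<lparr>carrier := H\<rparr>) (L\<lparr>carrier := J\<rparr>)"
  by (auto simp: lmod_hom_def Pi_iff subset_iff)

lemma lmod_hom_restrict_dom:
  "\<lbrakk>h \<in> lmod_hom R N L; H \<subseteq> carrier N\<rbrakk> \<Longrightarrow> h \<in> lmod_hom R (N\<lparr>carrier := H\<rparr>) L"
  by (auto simp: lmod_hom_def Pi_iff subset_iff)

lemma lmod_hom_zero:
  assumes "left_module R N" "left_module R L" "h \<in> lmod_hom R N L"
  shows "h \<zero>\<^bsub>N\<^esub> = \<zero>\<^bsub>L\<^esub>"
proof -
  interpret N: left_module R N by fact
  interpret L: left_module R L by fact
  have "h (\<zero>\<^bsub>R\<^esub> \<odot>\<^bsub>N\<^esub> \<zero>\<^bsub>N\<^esub>) = \<zero>\<^bsub>R\<^esub> \<odot>\<^bsub>L\<^esub> h \<zero>\<^bsub>N\<^esub>"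
    using assms(3) by (intro lmod_hom_smult) auto
  then show ?thesis using lmod_hom_closed[OF assms(3)] by (simp add: N.smult_l_zero L.smult_l_zero)
qed

lemma lmod_hom_a_inv:
  assumes "left_module R N" "left_module R L" "h \<in> lmod_hom R N L" "x \<in> carrier N"
  shows "h (\<ominus>\<^bsub>N\<^esub> x) = \<ominus>\<^bsub>L\<^esub> h x"
proof -
  interpret N: left_module R N by fact
  interpret L: left_module R L by fact
  show ?thesis
    using lmod_hom_smult[OF assms(3), of "\<ominus>\<^bsub>R\<^esub> \<one>\<^bsub>R\<^esub>" x] assms(4) lmod_hom_closed[OF assms(3,4)]
    by (simp add: N.smult_minus_one L.smult_minus_one)
qed

lemma lmod_hom_minus:
  assumes "left_module R N" "left_module R L" "h \<in> lmod_hom R N L" "x \<in> carrier N" "y \<in> carrier N"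
  shows "h (x \<ominus>\<^bsub>N\<^esub> y) = h x \<ominus>\<^bsub>L\<^esub> h y"
proof -
  interpret N: left_module R N by fact
  show ?thesis
    using lmod_hom_add[OF assms(3,4), of "\<ominus>\<^bsub>N\<^esub> y"] lmod_hom_a_inv[OF assms(1-3,5)] assms(5)
    by (simp add: a_minus_def)
qed

abbreviation lmod_kernel :: "('r, 'a) module \<Rightarrow> ('r, 'b) module \<Rightarrow> ('a \<Rightarrow> 'b) \<Rightarrow> ('r, 'a) module" where
  "lmod_kernel N L h \<equiv> N\<lparr>carrier := {x \<in> carrier N. h x = \<zero>\<^bsub>L\<^esub>}\<rparr>"

lemma lmod_kernel:
  assumes "left_module R N" "left_module R L" "h \<in> lmod_hom R N L"
  shows "left_module R (lmod_kernel N L h)"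
proof -
  interpret N: left_module R N by fact
  interpret L: left_module R L by fact
  show ?thesis
    by (rule N.left_module_sub)
      (use assms in \<open>auto simp: lmod_hom_zero lmod_hom_add lmod_hom_smult L.smult_r_zero N.smult_closed\<close>)
qed

lemma lmod_image:
  assumes "left_module R N" "left_module R L" "h \<in> lmod_hom R N L"
  shows "left_module R (L\<lparr>carrier := h ` carrier N\<rparr>)"
proof -
  interpret N: left_module R N by fact
  interpret L: left_module R L by fact
  show ?thesis
  proof (rule L.left_module_sub)
    show "\<zero>\<^bsub>L\<^esub> \<in> h ` carrier N" using lmod_hom_zero[OF assms] by force
    show "x \<oplus>\<^bsub>L\<^esub> y \<in> h ` carrier N" if "x \<in> h ` carrier N" "y \<in> h ` carrier N" for x y
      using that lmod_hom_add[OF assms(3)] by (auto simp flip: lmod_hom_add[OF assms(3)])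
    show "a \<odot>\<^bsub>L\<^esub> x \<in> h ` carrier N" if "a \<in> carrier R" "x \<in> h ` carrier N" for a x
      using that by (auto simp flip: lmod_hom_smult[OF assms(3)] simp: N.smult_closed)
  qed (use lmod_hom_closed[OF assms(3)] in auto)
qed

lemma lmod_hom_inj_iff:
  assumes "left_module R N" "left_module R L" "h \<in> lmod_hom R N L"
  shows "inj_on h (carrier N) \<longleftrightarrow> (\<forall>x \<in> carrier N. h x = \<zero>\<^bsub>L\<^esub> \<longrightarrow> x = \<zero>\<^bsub>N\<^esub>)" 
proof -
  interpret N: left_module R N by fact
  interpret L: left_module R L by fact
  show ?thesis
  proof safe
    fix x assume "inj_on h (carrier N)" "x \<in> carrier N" "h x = \<zero>\<^bsub>L\<^esub>"
    then show "x = \<zero>\<^bsub>N\<^esub>" using lmod_hom_zero[OF assms] by (metis inj_onD N.zero_closed)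
  next
    assume *: "\<forall>x\<in>carrier N. h x = \<zero>\<^bsub>L\<^esub> \<longrightarrow> x = \<zero>\<^bsub>N\<^esub>"
    show "inj_on h (carrier N)"
    proof (rule inj_onI)
      fix x y assume xy: "x \<in> carrier N" "y \<in> carrier N" "h x = h y"
      then have "h (x \<ominus>\<^bsub>N\<^esub> y) = \<zero>\<^bsub>L\<^esub>"
        using lmod_hom_minus[OF assms xy(1,2)] lmod_hom_closed[OF assms(3)] by (simp add: L.r_neg a_minus_def)
      with * xy have "x \<ominus>\<^bsub>N\<^esub> y = \<zero>\<^bsub>N\<^esub>" by simp
      then show "x = y"
        using xy N.N.add.inv_equality[of x "\<ominus>\<^bsub>N\<^esub> y"] by (simp add: a_minus_def)
    qed
  qed
qed

lemma lmod_iso_inv: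
  assumes "left_module R N" "h \<in> lmod_iso R N L"
  shows "inv_into (carrier N) h \<in> lmod_iso R L N"
proof -
  interpret N: left_module R N by fact
  let ?g = "inv_into (carrier N) h"
  have h: "h \<in> lmod_hom R N L" and bij: "bij_betw h (carrier N) (carrier L)"
    using assms(2) by (auto simp: lmod_iso_def)
  have inj: "inj_on h (carrier N)" and im: "h ` carrier N = carrier L"
    using bij by (auto simp: bij_betw_def)
  have gh: "?g (h x) = x" if "x \<in> carrier N" for x using inj that by simp
  have ex: "\<exists>x \<in> carrier N. y = h x" if "y \<in> carrier L" for y using im that by auto
  have "?g \<in> lmod_hom R L N"
    by (rule lmod_homI)
      (use ex gh in \<open>auto dest!: ex simp flip: lmod_hom_add[OF h] lmod_hom_smult[OF h] simp: N.smult_closed\<close>)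
  then show ?thesis using bij bij_betw_inv_into by (auto simp: lmod_iso_def)
qed

section \<open>Transport of structure, copies in other types, quotients\<close>

text \<open>The operations go through arbitrary preimages, so they make sense when the fibres of
  \<open>\<rho>\<close> form a congruence. An injective \<open>\<rho>\<close> gives a copy of
  \<open>N\<close>, a choice of coset representatives gives a quotient.\<close>

definition image_module :: "('a \<Rightarrow> 'b) \<Rightarrow> ('r, 'a) module \<Rightarrow> ('r, 'b) module" where
  "image_module \<rho> N =
     \<lparr>carrier = \<rho> ` carrier N, monoid.mult = undefined, one = undefined, ring.zero = \<rho> \<zero>\<^bsub>N\<^esub>,
      ring.add = (\<lambda>u v. \<rho> (inv_into (carrier N) \<rho> u \<oplus>\<^bsub>N\<^esub> inv_into (carrier N) \<rho> v)),
      smult = (\<lambda>a u. \<rho> (a \<odot>\<^bsub>N\<^esub> inv_into (carrier N) \<rho> u))\<rparr>"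

lemma
  fixes N :: "('r, 'a) module" and \<rho> :: "'a \<Rightarrow> 'b"
  assumes N: "left_module R N"
    and add: "\<And>x x' y y'. \<lbrakk>x \<in> carrier N; x' \<in> carrier N; y \<in> carrier N; y' \<in> carrier N;
      \<rho> x = \<rho> x'; \<rho> y = \<rho> y'\<rbrakk> \<Longrightarrow> \<rho> (x \<oplus>\<^bsub>N\<^esub> y) = \<rho> (x' \<oplus>\<^bsub>N\<^esub> y')"
    and smult: "\<And>a x x'. \<lbrakk>a \<in> carrier R; x \<in> carrier N; x' \<in> carrier N; \<rho> x = \<rho> x'\<rbrakk> \<Longrightarrow>
      \<rho> (a \<odot>\<^bsub>N\<^esub> x) = \<rho> (a \<odot>\<^bsub>N\<^esub> x')"
  shows image_module: "left_module R (image_module \<rho> N)"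
    and image_module_hom: "\<rho> \<in> lmod_hom R N (image_module \<rho> N)"
proof -
  interpret N: left_module R N by fact
  have inv: "inv_into (carrier N) \<rho> (\<rho> x) \<in> carrier N" "\<rho> (inv_into (carrier N) \<rho> (\<rho> x)) = \<rho> x"
    if "x \<in> carrier N" for x using that by (auto intro: inv_into_into f_inv_into_f)
  have pl: "\<rho> x \<oplus>\<^bsub>image_module \<rho> N\<^esub> \<rho> y = \<rho> (x \<oplus>\<^bsub>N\<^esub> y)" if "x \<in> carrier N" "y \<in> carrier N" for x y
    unfolding image_module_def using that inv by (auto intro!: add)
  have sm: "a \<odot>\<^bsub>image_module \<rho> N\<^esub> \<rho> x = \<rho> (a \<odot>\<^bsub>N\<^esub> x)" if "a \<in> carrier R" "x \<in> carrier N" for a x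
    unfolding image_module_def using that inv by (auto intro!: smult)
  have ze: "\<zero>\<^bsub>image_module \<rho> N\<^esub> = \<rho> \<zero>\<^bsub>N\<^esub>" and ca: "carrier (image_module \<rho> N) = \<rho> ` carrier N"
    by (auto simp: image_module_def)
  show "left_module R (image_module \<rho> N)"
    by (rule left_moduleI)
      (auto simp: ca ze pl sm N.R.ring_axioms N.N.a_assoc N.smult_l_distr N.smult_r_distr N.smult_assoc
        N.smult_one N.smult_l_zero N.smult_closed N.N.a_ac)
  show "\<rho> \<in> lmod_hom R N (image_module \<rho> N)"
    by (rule lmod_homI) (auto simp: ca pl sm)
qed

lemma image_module_simps [simp]:
  "carrier (image_module \<rho> N) = \<rho> ` carrier N" "\<zero>\<^bsub>image_module \<rho> N\<^esub> = \<rho> \<zero>\<^bsub>N\<^esub>"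
  by (auto simp: image_module_def)

text \<open>The device for returning to a fixed type: any construction on modules leaves the type,
  and a cardinality bound is enough to come back.\<close>

lemma small_copy:
  fixes N :: "('r, 'a) module"
  assumes "left_module R N" "carrier N \<lesssim> (UNIV :: 'u set)"
  obtains N' :: "('r, 'u) module" and h k where "left_module R N'"
    "h \<in> lmod_iso R N N'" "k \<in> lmod_iso R N' N"
    "\<And>x. x \<in> carrier N \<Longrightarrow> k (h x) = x" "\<And>x. x \<in> carrier N' \<Longrightarrow> h (k x) = x"
proof -
  obtain \<rho> :: "'a \<Rightarrow> 'u" where \<rho>: "inj_on \<rho> (carrier N)" using assms(2) by (auto simp: lepoll_def)
  interpret N: left_module R N by fact
  have mod: "left_module R (image_module \<rho> N)"
    by (rule image_module[OF assms(1)]) (use \<rho> in \<open>auto dest: inj_onD\<close>)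
  have "\<rho> \<in> lmod_hom R N (image_module \<rho> N)"
    by (rule image_module_hom[OF assms(1)]) (use \<rho> in \<open>auto dest: inj_onD\<close>)
  then have iso: "\<rho> \<in> lmod_iso R N (image_module \<rho> N)"
    using \<rho> by (auto simp: lmod_iso_def bij_betw_def)
  show thesis
    by (rule that[OF mod iso lmod_iso_inv[OF assms(1) iso]])
      (use \<rho> in \<open>auto simp: f_inv_into_f\<close>)
qed

text \<open>The carrier of a quotient consists of chosen representatives of the cosets.\<close>

definition coset_rep :: "('r, 'a) module \<Rightarrow> 'a set \<Rightarrow> 'a \<Rightarrow> 'a" where
  "coset_rep N H x = (SOME y. y \<in> carrier N \<and> y \<ominus>\<^bsub>N\<^esub> x \<in> H)"

text \<open>With representatives instead of cosets the quotient stays in the type of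
  \<open>N\<close>, so that an induction over modules of one type can be applied to it.\<close>

lemma quotient_exists:
  fixes N :: "('r, 'a) module"
  assumes N: "left_module R N" and H: "left_module R (N\<lparr>carrier := H\<rparr>)" "H \<subseteq> carrier N"
  obtains Q :: "('r, 'a) module" and q where "left_module R Q" "q \<in> lmod_hom R N Q"
    "q ` carrier N = carrier Q" "{x \<in> carrier N. q x = \<zero>\<^bsub>Q\<^esub>} = H"
proof -
  interpret N: left_module R N by fact
  interpret H: left_module R "N\<lparr>carrier := H\<rparr>" by fact
  have sub: "H \<subseteq> carrier N" by fact
  have zero: "\<zero>\<^bsub>N\<^esub> \<in> H" using H.N.zero_closed by simp
  have add: "x \<oplus>\<^bsub>N\<^esub> y \<in> H" if "x \<in> H" "y \<in> H" for x y using H.N.a_closed that by simp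
  have smult: "a \<odot>\<^bsub>N\<^esub> x \<in> H" if "a \<in> carrier R" "x \<in> H" for a x using H.smult_closed that by simp
  have neg: "\<ominus>\<^bsub>N\<^esub> x \<in> H" if "x \<in> H" for x
    using smult[of "\<ominus>\<^bsub>R\<^esub> \<one>\<^bsub>R\<^esub>" x] that sub N.smult_minus_one[of x] by auto
  let ?\<rho> = "coset_rep N H"
  have rep: "?\<rho> x \<in> carrier N \<and> ?\<rho> x \<ominus>\<^bsub>N\<^esub> x \<in> H" if "x \<in> carrier N" for x
    unfolding coset_rep_def by (rule someI[of _ x]) (use that zero in \<open>simp add: N.N.r_neg a_minus_def\<close>)
  have tr: "x \<ominus>\<^bsub>N\<^esub> z \<in> H" if "x \<ominus>\<^bsub>N\<^esub> y \<in> H" "y \<ominus>\<^bsub>N\<^esub> z \<in> H" "x \<in> carrier N" "y \<in> carrier N" "z \<in> carrier N" for x y z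
  proof -
    have "x \<ominus>\<^bsub>N\<^esub> z = (x \<ominus>\<^bsub>N\<^esub> y) \<oplus>\<^bsub>N\<^esub> (y \<ominus>\<^bsub>N\<^esub> z)"
      using that(3-5) by (simp add: a_minus_def N.N.a_assoc N.N.r_neg1)
    then show ?thesis using add that by simp
  qed
  have sy: "y \<ominus>\<^bsub>N\<^esub> x \<in> H" if "x \<ominus>\<^bsub>N\<^esub> y \<in> H" "x \<in> carrier N" "y \<in> carrier N" for x y
  proof -
    have "y \<ominus>\<^bsub>N\<^esub> x = \<ominus>\<^bsub>N\<^esub> (x \<ominus>\<^bsub>N\<^esub> y)"
      using that(2,3) by (simp add: a_minus_def N.N.minus_add N.N.a_comm)
    then show ?thesis using neg that by simp
  qed
  \<comment> \<open>Congruent elements have the same candidates for a representative, so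
    \<open>SOME\<close> picks the same one for both.\<close>
  have eq: "?\<rho> x = ?\<rho> y \<longleftrightarrow> x \<ominus>\<^bsub>N\<^esub> y \<in> H" if "x \<in> carrier N" "y \<in> carrier N" for x y
  proof
    assume "?\<rho> x = ?\<rho> y"
    then show "x \<ominus>\<^bsub>N\<^esub> y \<in> H" using rep[of x] rep[of y] that tr sy by metis
  next
    assume *: "x \<ominus>\<^bsub>N\<^esub> y \<in> H"
    then have "(z \<in> carrier N \<and> z \<ominus>\<^bsub>N\<^esub> x \<in> H) = (z \<in> carrier N \<and> z \<ominus>\<^bsub>N\<^esub> y \<in> H)" for z
      using that tr sy by metis
    then show "?\<rho> x = ?\<rho> y" unfolding coset_rep_def by simp
  qed
  have cadd: "?\<rho> (x \<oplus>\<^bsub>N\<^esub> y) = ?\<rho> (x' \<oplus>\<^bsub>N\<^esub> y')"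
    if "x \<in> carrier N" "x' \<in> carrier N" "y \<in> carrier N" "y' \<in> carrier N" "?\<rho> x = ?\<rho> x'" "?\<rho> y = ?\<rho> y'" for x x' y y'
  proof -
    have "(x \<oplus>\<^bsub>N\<^esub> y) \<ominus>\<^bsub>N\<^esub> (x' \<oplus>\<^bsub>N\<^esub> y') = (x \<ominus>\<^bsub>N\<^esub> x') \<oplus>\<^bsub>N\<^esub> (y \<ominus>\<^bsub>N\<^esub> y')"
      using that(1-4) by (simp add: a_minus_def N.N.minus_add N.N.a_ac)
    then show ?thesis using that add by (simp add: eq)
  qed
  have csm: "?\<rho> (a \<odot>\<^bsub>N\<^esub> x) = ?\<rho> (a \<odot>\<^bsub>N\<^esub> x')"
    if "a \<in> carrier R" "x \<in> carrier N" "x' \<in> carrier N" "?\<rho> x = ?\<rho> x'" for a x x'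
    using that smult by (simp add: eq N.smult_closed flip: N.smult_r_minus)
  have mz: "x \<ominus>\<^bsub>N\<^esub> \<zero>\<^bsub>N\<^esub> = x" if "x \<in> carrier N" for x
    using N.N.add.inv_equality[of "\<zero>\<^bsub>N\<^esub>" "\<zero>\<^bsub>N\<^esub>"] that unfolding a_minus_def by simp
  have ker: "{x \<in> carrier N. ?\<rho> x = ?\<rho> \<zero>\<^bsub>N\<^esub>} = H"
  proof (intro Set.set_eqI iffI)
    fix x assume "x \<in> {x \<in> carrier N. ?\<rho> x = ?\<rho> \<zero>\<^bsub>N\<^esub>}"
    then show "x \<in> H" using eq[of x "\<zero>\<^bsub>N\<^esub>"] mz[of x] by simp
  next
    fix x assume "x \<in> H"
    then show "x \<in> {x \<in> carrier N. ?\<rho> x = ?\<rho> \<zero>\<^bsub>N\<^esub>}"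
      using eq[of x "\<zero>\<^bsub>N\<^esub>"] mz[of x] sub by auto
  qed
  show thesis
    by (rule that[OF image_module[OF N cadd csm] image_module_hom[OF N cadd csm]]) (simp_all add: ker)
qed

section \<open>Projective modules\<close>

lemma free_left_module_simps [simp]:
  "carrier (free_left_module R B) = {f. (\<forall>i. f i \<in> carrier R) \<and> (\<forall>i. i \<notin> B \<longrightarrow> f i = \<zero>\<^bsub>R\<^esub>) \<and>
                    finite {i. f i \<noteq> \<zero>\<^bsub>R\<^esub>}}"
  "\<zero>\<^bsub>free_left_module R B\<^esub> = (\<lambda>_. \<zero>\<^bsub>R\<^esub>)"
  "f \<oplus>\<^bsub>free_left_module R B\<^esub> g = (\<lambda>i. f i \<oplus>\<^bsub>R\<^esub> g i)"
  "a \<odot>\<^bsub>free_left_module R B\<^esub> f = (\<lambda>i. a \<otimes>\<^bsub>R\<^esub> f i)"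
  by (auto simp: free_left_module_def)

lemma left_module_free:
  assumes "ring R"
  shows "left_module R (free_left_module R B)"
proof -
  interpret R: ring R by fact
  have fin: "finite {i. f i \<oplus>\<^bsub>R\<^esub> g i \<noteq> \<zero>\<^bsub>R\<^esub>}"
    if "finite {i. f i \<noteq> \<zero>\<^bsub>R\<^esub>}" "finite {i. g i \<noteq> \<zero>\<^bsub>R\<^esub>}" for f g :: "'c \<Rightarrow> 'a"
    by (rule finite_subset[OF _ finite_UnI[OF that]]) auto
  have fin': "finite {i. a \<otimes>\<^bsub>R\<^esub> f i \<noteq> \<zero>\<^bsub>R\<^esub>}"
    if "finite {i. f i \<noteq> \<zero>\<^bsub>R\<^esub>}" "a \<in> carrier R" for a and f :: "'c \<Rightarrow> 'a"
    by (rule finite_subset[OF _ that(1)]) (use that in auto)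
  show ?thesis
    by (rule left_moduleI)
      (auto simp: fin fin' R.ring_axioms R.a_assoc R.l_distr R.r_distr R.m_assoc intro!: R.a_comm)
qed

text \<open>The linear extension of \<open>g\<close> to formal combinations. The basis does not
  occur in it: summing over the support makes one term serve for every free module that contains
  \<open>f\<close>.\<close>

definition lin :: "('r, 'x) ring_scheme \<Rightarrow> ('r, 'a) module \<Rightarrow> ('i \<Rightarrow> 'a) \<Rightarrow> ('i \<Rightarrow> 'r) \<Rightarrow> 'a" where
  "lin R N g f = finsum N (\<lambda>i. f i \<odot>\<^bsub>N\<^esub> g i) {i. f i \<noteq> \<zero>\<^bsub>R\<^esub>}"

text \<open>Kept to additive maps because it is also applied to evaluations at a point and to
  changes of coefficients, which are not module homomorphisms.\<close>

lemma additive_finsum: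
  assumes "abelian_group N" "abelian_group L"
    and closed: "\<And>x. x \<in> carrier N \<Longrightarrow> h x \<in> carrier L"
    and add: "\<And>x y. \<lbrakk>x \<in> carrier N; y \<in> carrier N\<rbrakk> \<Longrightarrow> h (x \<oplus>\<^bsub>N\<^esub> y) = h x \<oplus>\<^bsub>L\<^esub> h y"
    and f: "f \<in> S \<rightarrow> carrier N"
  shows "h (finsum N f S) = finsum L (\<lambda>i. h (f i)) S"
proof -
  interpret N: abelian_group N by fact
  interpret L: abelian_group L by fact
  have zero: "h \<zero>\<^bsub>N\<^esub> = \<zero>\<^bsub>L\<^esub>"
    using add[of "\<zero>\<^bsub>N\<^esub>" "\<zero>\<^bsub>N\<^esub>"] closed[of "\<zero>\<^bsub>N\<^esub>"] by (metis L.add.l_cancel_one' N.l_zero N.zero_closed)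
  show ?thesis
    using f by (induct S rule: infinite_finite_induct) (auto simp: zero add closed Pi_iff)
qed

lemma lmod_hom_finsum:
  assumes "left_module R N" "left_module R L" "h \<in> lmod_hom R N L" "f \<in> S \<rightarrow> carrier N"
  shows "h (finsum N f S) = finsum L (\<lambda>i. h (f i)) S"
  using assms
  by (intro additive_finsum) (auto simp: lmod_hom_closed lmod_hom_add left_module_def)

text \<open>The supports of two combinations and of their sum differ; a common finite superset makes
  the three sums comparable.\<close>

lemma lin_superset:
  assumes "left_module R N" "f \<in> carrier (free_left_module R B)" "g \<in> B \<rightarrow> carrier N"
    "finite S" "{i. f i \<noteq> \<zero>\<^bsub>R\<^esub>} \<subseteq> S" "S \<subseteq> B"
  shows "lin R N g f = finsum N (\<lambda>i. f i \<odot>\<^bsub>N\<^esub> g i) S"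
proof -
  interpret N: left_module R N by fact
  show ?thesis unfolding lin_def
    by (rule N.N.add.finprod_mono_neutral_cong_left)
      (use assms in \<open>auto simp: Pi_iff subset_iff N.smult_l_zero intro!: N.smult_closed\<close>)
qed

lemma lin_hom:
  assumes N: "left_module R N" and g: "g \<in> B \<rightarrow> carrier N"
  shows "lin R N g \<in> lmod_hom R (free_left_module R B) N"
proof -
  interpret N: left_module R N by fact
  have cl: "f i \<odot>\<^bsub>N\<^esub> g i \<in> carrier N" if "f \<in> carrier (free_left_module R B)" "i \<in> B" for f i
    using that g by (auto intro!: N.smult_closed)
  have supp: "{i. f i \<noteq> \<zero>\<^bsub>R\<^esub>} \<subseteq> B" if "f \<in> carrier (free_left_module R B)" for f
    using that by auto
  note free = left_module_free[OF N.R.ring_axioms, of B]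
  interpret F: left_module R "free_left_module R B" by fact
  show ?thesis
  proof (rule lmod_homI)
    fix f assume f: "f \<in> carrier (free_left_module R B)"
    show "lin R N g f \<in> carrier N"
      unfolding lin_def using supp[OF f] cl[OF f] by (intro N.N.finsum_closed) auto
  next
    fix f f' assume f: "f \<in> carrier (free_left_module R B)" and f': "f' \<in> carrier (free_left_module R B)"
    let ?S = "{i. f i \<noteq> \<zero>\<^bsub>R\<^esub>} \<union> {i. f' i \<noteq> \<zero>\<^bsub>R\<^esub>}"
    have S: "finite ?S" "?S \<subseteq> B" using f f' by auto
    have "lin R N g (f \<oplus>\<^bsub>free_left_module R B\<^esub> f') =
        finsum N (\<lambda>i. (f \<oplus>\<^bsub>free_left_module R B\<^esub> f') i \<odot>\<^bsub>N\<^esub> g i) ?S"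
      by (rule lin_superset[OF N F.N.a_closed[OF f f'] g S(1) _ S(2)]) auto
    also have "\<dots> = finsum N (\<lambda>i. f i \<odot>\<^bsub>N\<^esub> g i \<oplus>\<^bsub>N\<^esub> f' i \<odot>\<^bsub>N\<^esub> g i) ?S"
      using S cl[OF f] cl[OF f'] f f' g
      by (intro N.N.finsum_cong') (auto simp: N.smult_l_distr Pi_iff intro!: N.N.a_closed)
    also have "\<dots> = finsum N (\<lambda>i. f i \<odot>\<^bsub>N\<^esub> g i) ?S \<oplus>\<^bsub>N\<^esub> finsum N (\<lambda>i. f' i \<odot>\<^bsub>N\<^esub> g i) ?S"
      using S cl[OF f] cl[OF f'] by (intro N.N.finsum_addf) auto
    also have "\<dots> = lin R N g f \<oplus>\<^bsub>N\<^esub> lin R N g f'"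
      using lin_superset[OF N f g S(1) _ S(2)] lin_superset[OF N f' g S(1) _ S(2)] by simp
    finally show "lin R N g (f \<oplus>\<^bsub>free_left_module R B\<^esub> f') = lin R N g f \<oplus>\<^bsub>N\<^esub> lin R N g f'" .
  next
    fix a f assume a: "a \<in> carrier R" and f: "f \<in> carrier (free_left_module R B)"
    let ?S = "{i. f i \<noteq> \<zero>\<^bsub>R\<^esub>}"
    have S: "finite ?S" "?S \<subseteq> B" using f by auto
    have "lin R N g (a \<odot>\<^bsub>free_left_module R B\<^esub> f) =
        finsum N (\<lambda>i. (a \<odot>\<^bsub>free_left_module R B\<^esub> f) i \<odot>\<^bsub>N\<^esub> g i) ?S"
      by (rule lin_superset[OF N F.smult_closed[OF a f] g S(1) _ S(2)]) (use a in auto)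
    also have "\<dots> = finsum N (\<lambda>i. a \<odot>\<^bsub>N\<^esub> (f i \<odot>\<^bsub>N\<^esub> g i)) ?S"
      using S cl[OF f] a f g
      by (intro N.N.finsum_cong') (auto simp: N.smult_assoc Pi_iff subset_iff intro!: N.smult_closed)
    also have "\<dots> = a \<odot>\<^bsub>N\<^esub> finsum N (\<lambda>i. f i \<odot>\<^bsub>N\<^esub> g i) ?S"
      using S cl[OF f] a
      by (intro additive_finsum[symmetric] N.N.abelian_group_axioms N.smult_closed N.smult_r_distr) auto
    finally show "lin R N g (a \<odot>\<^bsub>free_left_module R B\<^esub> f) = a \<odot>\<^bsub>N\<^esub> lin R N g f"
      by (simp add: lin_def)
  qed
qed

lemma lmod_hom_lin:
  assumes N: "left_module R N" and L: "left_module R L" and h: "h \<in> lmod_hom R N L"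
    and g: "g \<in> B \<rightarrow> carrier N" and f: "f \<in> carrier (free_left_module R B)"
  shows "h (lin R N g f) = lin R L (\<lambda>i. h (g i)) f"
proof -
  interpret N: left_module R N by fact
  interpret L: left_module R L by fact
  have supp: "{i. f i \<noteq> \<zero>\<^bsub>R\<^esub>} \<subseteq> B" using f by auto
  have "h (lin R N g f) = finsum L (\<lambda>i. h (f i \<odot>\<^bsub>N\<^esub> g i)) {i. f i \<noteq> \<zero>\<^bsub>R\<^esub>}"
    unfolding lin_def using supp f g
    by (intro lmod_hom_finsum[OF N L h]) (auto intro!: N.smult_closed)
  also have "\<dots> = lin R L (\<lambda>i. h (g i)) f"
    unfolding lin_def using supp f g
    by (intro L.N.finsum_cong') (auto simp: lmod_hom_smult[OF h] Pi_iff subset_iff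
        intro!: L.smult_closed lmod_hom_closed[OF h])
  finally show ?thesis .
qed

lemma lin_cong:
  assumes "left_module R N" "f \<in> carrier (free_left_module R B)" "g \<in> B \<rightarrow> carrier N"
    "\<And>i. i \<in> B \<Longrightarrow> g' i = g i"
  shows "lin R N g' f = lin R N g f"
proof -
  interpret N: left_module R N by fact
  have supp: "{i. f i \<noteq> \<zero>\<^bsub>R\<^esub>} \<subseteq> B" using assms by auto
  show ?thesis unfolding lin_def using supp assms
    by (intro N.N.finsum_cong') (auto simp: Pi_iff subset_iff intro!: N.smult_closed)
qed

definition delta :: "('r, 'x) ring_scheme \<Rightarrow> 'i \<Rightarrow> 'i \<Rightarrow> 'r" where
  "delta R i = (\<lambda>j. if j = i then \<one>\<^bsub>R\<^esub> else \<zero>\<^bsub>R\<^esub>)"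

lemma delta_closed: "\<lbrakk>ring R; i \<in> B\<rbrakk> \<Longrightarrow> delta R i \<in> carrier (free_left_module R B)"
proof -
  assume "ring R" "i \<in> B"
  then interpret R: ring R by simp
  have "finite {j. delta R i j \<noteq> \<zero>\<^bsub>R\<^esub>}" by (rule finite_subset[of _ "{i}"]) (auto simp: delta_def)
  then show ?thesis using \<open>i \<in> B\<close> by (auto simp: delta_def)
qed

lemma lin_delta:
  assumes N: "left_module R N" and g: "g \<in> B \<rightarrow> carrier N" and i: "i \<in> B"
  shows "lin R N g (delta R i) = g i"
proof -
  interpret N: left_module R N by fact
  have "lin R N g (delta R i) = finsum N (\<lambda>j. delta R i j \<odot>\<^bsub>N\<^esub> g j) {i}"
    by (rule lin_superset[OF N delta_closed[OF N.R.ring_axioms i] g]) (use i in \<open>auto simp: delta_def\<close>)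
  also have "\<dots> = delta R i i \<odot>\<^bsub>N\<^esub> g i"
    using i g N.N.finsum_insert[of "{}" i "\<lambda>j. delta R i j \<odot>\<^bsub>N\<^esub> g j"]
    by (auto simp: delta_def Pi_iff N.smult_closed N.smult_one)
  finally show ?thesis using i g by (auto simp: delta_def N.smult_one Pi_iff)
qed

lemma lin_basis:
  assumes R: "ring R" and f: "f \<in> carrier (free_left_module R B)"
  shows "lin R (free_left_module R B) (delta R) f = f"
proof
  fix j
  let ?F = "free_left_module R B"
  let ?S = "{i. f i \<noteq> \<zero>\<^bsub>R\<^esub>}"
  interpret R: ring R by fact
  note F = left_module_free[OF R, of B]
  interpret F: left_module R ?F by fact
  have supp: "?S \<subseteq> B" "finite ?S" using f by auto
  have cl: "f i \<odot>\<^bsub>?F\<^esub> delta R i \<in> carrier ?F" if "i \<in> B" for i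
    using f by (intro F.smult_closed delta_closed[OF R that]) auto
  \<comment> \<open>Evaluation at the coordinate \<open>j\<close> is additive, so it can be pulled
    into the sum.\<close>
  have "lin R ?F (delta R) f j = finsum R (\<lambda>i. (f i \<odot>\<^bsub>?F\<^esub> delta R i) j) ?S"
    unfolding lin_def
  proof (rule additive_finsum[where h="\<lambda>f. f j"])
    show "(\<lambda>i. f i \<odot>\<^bsub>?F\<^esub> delta R i) \<in> ?S \<rightarrow> carrier ?F"
      using cl supp(1) by (intro Pi_I) blast
  qed (auto simp: F.N.abelian_group_axioms R.abelian_group_axioms)
  also have "\<dots> = finsum R (\<lambda>i. if j = i then f i else \<zero>\<^bsub>R\<^esub>) ?S"
    using f by (intro R.finsum_cong') (auto simp: delta_def)
  also have "\<dots> = f j"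
  proof (cases "f j = \<zero>\<^bsub>R\<^esub>")
    case True
    then have "finsum R (\<lambda>i. if j = i then f i else \<zero>\<^bsub>R\<^esub>) ?S = finsum R (\<lambda>i. \<zero>\<^bsub>R\<^esub>) ?S"
      by (intro R.finsum_cong') auto
    then show ?thesis using True by simp
  next
    case False
    then show ?thesis using supp f by (intro R.add.finprod_singleton) auto
  qed
  finally show "lin R ?F (delta R) f j = f j" .
qed

text \<open>A dual basis: the evaluation of formal combinations of elements of \<open>P\<close> has a section.  Unlike
  \<^const>\<open>projective_module\<close> this does not mention a complement.\<close>

definition proj :: "('r, 'x) ring_scheme \<Rightarrow> ('r, 'p) module \<Rightarrow> bool" where
  "proj R P \<longleftrightarrow> left_module R P \<and>
     (\<exists>s \<in> lmod_hom R P (free_left_module R (carrier P)). \<forall>x \<in> carrier P. lin R P (\<lambda>p. p) (s x) = x)"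

lemma proj_left_module: "proj R P \<Longrightarrow> left_module R P"
  by (simp add: proj_def)

text \<open>Choose preimages under \<open>q\<close> of the values of \<open>f\<close> without any
  compatibility, extend them linearly over the free module on \<open>carrier P\<close>, and
  precompose with the section \<open>s\<close>.\<close>

lemma proj_lift:
  assumes P: "proj R P" and U: "left_module R U" and Y: "left_module R Y"
    and q: "q \<in> lmod_hom R U Y" "q ` carrier U = carrier Y" and f: "f \<in> lmod_hom R P Y"
  obtains h where "h \<in> lmod_hom R P U" "\<And>p. p \<in> carrier P \<Longrightarrow> q (h p) = f p"
proof -
  obtain s where s: "s \<in> lmod_hom R P (free_left_module R (carrier P))"
    and sec: "\<And>x. x \<in> carrier P \<Longrightarrow> lin R P (\<lambda>p. p) (s x) = x" and lP: "left_module R P"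
    using P by (auto simp: proj_def)
  define g where "g p = inv_into (carrier U) q (f p)" for p
  have g: "g \<in> carrier P \<rightarrow> carrier U" "\<And>p. p \<in> carrier P \<Longrightarrow> q (g p) = f p"
    using lmod_hom_closed[OF f] q(2) by (auto simp: g_def inv_into_into f_inv_into_f)
  have "(\<lambda>p. lin R U g (s p)) \<in> lmod_hom R P U"
    by (rule lmod_hom_comp[OF s lin_hom[OF U g(1)]])
  moreover have "q (lin R U g (s p)) = f p" if p: "p \<in> carrier P" for p
  proof -
    have sp: "s p \<in> carrier (free_left_module R (carrier P))" using lmod_hom_closed[OF s p] .
    have "q (lin R U g (s p)) = lin R Y (\<lambda>p. q (g p)) (s p)"
      by (rule lmod_hom_lin[OF U Y q(1) g(1) sp])
    also have "\<dots> = lin R Y (\<lambda>p. f p) (s p)"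
      by (rule lin_cong[OF Y sp]) (use g lmod_hom_closed[OF f] in auto)
    also have "\<dots> = f (lin R P (\<lambda>p. p) (s p))"
      by (rule lmod_hom_lin[OF lP Y f _ sp, symmetric]) auto
    finally show ?thesis using sec p by simp
  qed
  ultimately show thesis by (rule that)
qed

text \<open>A dual basis may be indexed by any set \<open>B\<close>: the basis vector of
  \<open>i\<close> is sent to the basis vector of \<open>g i\<close> in the free module on
  \<open>carrier P\<close>.\<close>

lemma projI_frame:
  assumes P: "left_module R P" and g: "g \<in> B \<rightarrow> carrier P"
    and s: "s \<in> lmod_hom R P (free_left_module R B)" and sec: "\<And>x. x \<in> carrier P \<Longrightarrow> lin R P g (s x) = x"
  shows "proj R P"
proof -
  interpret P: left_module R P by fact
  let ?F = "free_left_module R (carrier P)"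
  note F = left_module_free[OF P.R.ring_axioms, of "carrier P"]
  have d: "(\<lambda>i. delta R (g i)) \<in> B \<rightarrow> carrier ?F"
    using g by (intro Pi_I delta_closed[OF P.R.ring_axioms]) auto
  have "lin R P (\<lambda>p. p) (lin R ?F (\<lambda>i. delta R (g i)) (s x)) = x" if x: "x \<in> carrier P" for x
  proof -
    have sx: "s x \<in> carrier (free_left_module R B)" using lmod_hom_closed[OF s x] .
    have "lin R P (\<lambda>p. p) (lin R ?F (\<lambda>i. delta R (g i)) (s x)) =
        lin R P (\<lambda>i. lin R P (\<lambda>p. p) (delta R (g i))) (s x)"
      by (rule lmod_hom_lin[OF F P lin_hom[OF P] d sx]) auto
    also have "\<dots> = lin R P g (s x)"
      by (rule lin_cong[OF P sx g]) (use g in \<open>auto intro!: lin_delta[OF P]\<close>)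
    finally show ?thesis using sec x by simp
  qed
  then show ?thesis
    unfolding proj_def by (intro conjI P bexI[OF _ lmod_hom_comp[OF s lin_hom[OF F d]]]) simp
qed

lemma proj_free: "ring R \<Longrightarrow> proj R (free_left_module R B)"
  by (rule projI_frame[where g="delta R" and B=B and s="\<lambda>x. x"])
    (auto simp: left_module_free lmod_hom_id lin_basis delta_closed simp del: free_left_module_simps)

lemma proj_retract:
  assumes Q: "proj R Q" and P: "left_module R P"
    and i: "i \<in> lmod_hom R P Q" and r: "r \<in> lmod_hom R Q P" and ri: "\<And>x. x \<in> carrier P \<Longrightarrow> r (i x) = x"
  shows "proj R P"
proof -
  obtain s where s: "s \<in> lmod_hom R Q (free_left_module R (carrier Q))"
    and sec: "\<And>x. x \<in> carrier Q \<Longrightarrow> lin R Q (\<lambda>p. p) (s x) = x" and lQ: "left_module R Q"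
    using Q by (auto simp: proj_def)
  show ?thesis
  proof (rule projI_frame[OF P _ lmod_hom_comp[OF i s]])
    show "r \<in> carrier Q \<rightarrow> carrier P" using lmod_hom_closed[OF r] by auto
    show "lin R P r (s (i x)) = x" if x: "x \<in> carrier P" for x
    proof -
      have ix: "i x \<in> carrier Q" using lmod_hom_closed[OF i x] .
      have "lin R P r (s (i x)) = r (lin R Q (\<lambda>p. p) (s (i x)))"
        by (rule lmod_hom_lin[OF lQ P r _ lmod_hom_closed[OF s ix], symmetric]) auto
      then show ?thesis using sec ix ri x by simp
    qed
  qed
qed

lemma lin_id_surj:
  assumes "left_module R N"
  shows "lin R N (\<lambda>x. x) ` carrier (free_left_module R (carrier N)) = carrier N"
proof -
  interpret N: left_module R N by fact
  have "lin R N (\<lambda>x. x) f \<in> carrier N" if "f \<in> carrier (free_left_module R (carrier N))" for f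
    by (rule lmod_hom_closed[OF lin_hom[OF assms] that]) auto
  moreover have "x \<in> lin R N (\<lambda>x. x) ` carrier (free_left_module R (carrier N))" if "x \<in> carrier N" for x
    using lin_delta[OF assms _ that, of "\<lambda>x. x"] delta_closed[OF N.R.ring_axioms that]
    by (intro rev_image_eqI[of "delta R x"]) auto
  ultimately show ?thesis by blast
qed

lemma lmod_direct_sum_simps [simp]:
  "carrier (lmod_direct_sum N L) = carrier N \<times> carrier L"
  "\<zero>\<^bsub>lmod_direct_sum N L\<^esub> = (\<zero>\<^bsub>N\<^esub>, \<zero>\<^bsub>L\<^esub>)"
  "(x, y) \<oplus>\<^bsub>lmod_direct_sum N L\<^esub> (x', y') = (x \<oplus>\<^bsub>N\<^esub> x', y \<oplus>\<^bsub>L\<^esub> y')"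
  "a \<odot>\<^bsub>lmod_direct_sum N L\<^esub> (x, y) = (a \<odot>\<^bsub>N\<^esub> x, a \<odot>\<^bsub>L\<^esub> y)"
  by (auto simp: lmod_direct_sum_def)

lemma left_module_direct_sum:
  assumes "left_module R N" "left_module R L"
  shows "left_module R (lmod_direct_sum N L)"
proof -
  interpret N: left_module R N by fact
  interpret L: left_module R L by fact
  show ?thesis
    by (rule left_moduleI)
      (auto simp: N.R.ring_axioms N.N.a_ac L.N.a_ac N.smult_closed L.smult_closed N.smult_l_distr
        L.smult_l_distr N.smult_r_distr L.smult_r_distr N.smult_assoc L.smult_assoc N.smult_one L.smult_one
        N.smult_l_zero L.smult_l_zero)
qed

lemma lmod_hom_fst: "fst \<in> lmod_hom R (lmod_direct_sum N L) N"
  and lmod_hom_snd: "snd \<in> lmod_hom R (lmod_direct_sum N L) L"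
  by (auto intro!: lmod_homI)

lemma lmod_hom_pair:
  "\<lbrakk>f \<in> lmod_hom R U N; g \<in> lmod_hom R U L\<rbrakk> \<Longrightarrow> (\<lambda>x. (f x, g x)) \<in> lmod_hom R U (lmod_direct_sum N L)"
  by (rule lmod_homI) (auto simp: lmod_hom_closed lmod_hom_add lmod_hom_smult)

lemma lmod_hom_plus:
  assumes U: "left_module R U" and Y: "left_module R Y" and f: "f \<in> lmod_hom R U Y" and g: "g \<in> lmod_hom R U Y"
  shows "(\<lambda>x. f x \<oplus>\<^bsub>Y\<^esub> g x) \<in> lmod_hom R U Y"
proof -
  interpret U: left_module R U by fact
  interpret Y: left_module R Y by fact
  show ?thesis
    by (rule lmod_homI)
      (simp_all add: f g lmod_hom_closed[OF f] lmod_hom_closed[OF g] lmod_hom_add[OF f] lmod_hom_add[OF g]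
        lmod_hom_smult[OF f] lmod_hom_smult[OF g] Y.N.a_ac Y.smult_r_distr)
qed

lemma lmod_hom_diff:
  assumes U: "left_module R U" and Y: "left_module R Y" and f: "f \<in> lmod_hom R U Y" and g: "g \<in> lmod_hom R U Y"
  shows "(\<lambda>x. f x \<ominus>\<^bsub>Y\<^esub> g x) \<in> lmod_hom R U Y"
proof -
  interpret U: left_module R U by fact
  interpret Y: left_module R Y by fact
  show ?thesis
    by (rule lmod_homI)
      (simp_all add: f g lmod_hom_closed[OF f] lmod_hom_closed[OF g] lmod_hom_add[OF f] lmod_hom_add[OF g]
        lmod_hom_smult[OF f] lmod_hom_smult[OF g] Y.N.a_ac Y.smult_r_minus a_minus_def Y.N.minus_add
        Y.smult_r_neg Y.smult_r_distr)
qed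

text \<open>Both inclusions lift to the free module on the carrier of the sum, and the sum of the
  two lifts is a section.\<close>

lemma proj_direct_sum:
  assumes A: "proj R A" and C: "proj R C"
  shows "proj R (lmod_direct_sum A C)"
proof -
  let ?S = "lmod_direct_sum A C"
  let ?F = "free_left_module R (carrier ?S)"
  let ?q = "lin R ?S (\<lambda>x. x)"
  interpret A: left_module R A using A by (rule proj_left_module)
  interpret C: left_module R C using C by (rule proj_left_module)
  note S = left_module_direct_sum[OF A.left_module_axioms C.left_module_axioms]
  note F = left_module_free[OF A.R.ring_axioms, of "carrier ?S"]
  have q: "?q \<in> lmod_hom R ?F ?S" by (rule lin_hom[OF S]) auto
  have a0: "(\<lambda>a. (a, \<zero>\<^bsub>C\<^esub>)) \<in> lmod_hom R A ?S"
    by (rule lmod_homI) (auto simp: C.smult_r_zero)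
  have c0: "(\<lambda>c. (\<zero>\<^bsub>A\<^esub>, c)) \<in> lmod_hom R C ?S"
    by (rule lmod_homI) (auto simp: A.smult_r_zero)
  obtain \<alpha> where \<alpha>: "\<alpha> \<in> lmod_hom R A ?F" "\<And>a. a \<in> carrier A \<Longrightarrow> ?q (\<alpha> a) = (a, \<zero>\<^bsub>C\<^esub>)"
    using proj_lift[OF A F S q lin_id_surj[OF S] a0] by auto
  obtain \<gamma> where \<gamma>: "\<gamma> \<in> lmod_hom R C ?F" "\<And>a. a \<in> carrier C \<Longrightarrow> ?q (\<gamma> a) = (\<zero>\<^bsub>A\<^esub>, a)"
    using proj_lift[OF C F S q lin_id_surj[OF S] c0] by auto
  let ?s = "\<lambda>x. \<alpha> (fst x) \<oplus>\<^bsub>?F\<^esub> \<gamma> (snd x)"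
  have "?s \<in> lmod_hom R ?S ?F"
    by (rule lmod_hom_plus[OF S F lmod_hom_comp[OF lmod_hom_fst \<alpha>(1)] lmod_hom_comp[OF lmod_hom_snd \<gamma>(1)]])
  moreover have "?q (?s x) = x" if "x \<in> carrier ?S" for x
  proof -
    have x: "fst x \<in> carrier A" "snd x \<in> carrier C" using that by auto
    show ?thesis
      unfolding lmod_hom_add[OF q lmod_hom_closed[OF \<alpha>(1) x(1)] lmod_hom_closed[OF \<gamma>(1) x(2)]]
      using x by (simp add: \<alpha>(2) \<gamma>(2))
  qed
  ultimately show ?thesis unfolding proj_def by (intro conjI S bexI[of _ ?s] ballI)
qed

lemma proj_iso:
  assumes P: "proj R P" and Q: "left_module R Q" and h: "h \<in> lmod_iso R Q P"
  shows "proj R Q"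
proof -
  have inj: "inj_on h (carrier Q)" using h by (auto simp: lmod_iso_def bij_betw_def)
  show ?thesis
    using proj_retract[OF P Q, of h "inv_into (carrier Q) h"] h lmod_iso_inv[OF Q h] inj
    by (auto simp: lmod_iso_def)
qed

lemma projective_module_imp_proj:
  assumes "projective_module R P"
  shows "proj R P"
proof -
  obtain B and Q :: "('a, 'c \<Rightarrow> 'a) module" and \<theta> where P: "left_module R P" and Q: "left_module R Q"
    and \<theta>: "\<theta> \<in> lmod_iso R (lmod_direct_sum P Q) (free_left_module R (B :: 'c set))"
    using assms by (auto simp: projective_module_def)
  interpret P: left_module R P by fact
  interpret Q: left_module R Q by fact
  have "proj R (lmod_direct_sum P Q)"
    by (rule proj_iso[OF proj_free[OF P.R.ring_axioms] left_module_direct_sum[OF P Q] \<theta>])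
  then show ?thesis
    by (rule proj_retract[where i="\<lambda>x. (x, \<zero>\<^bsub>Q\<^esub>)", OF _ P _ lmod_hom_fst])
      (simp_all add: lmod_hom_def Q.smult_r_zero)
qed

text \<open>The complement is the kernel of the evaluation map. It consists of functions from
  \<open>carrier P\<close> to the ring, so it has exactly the type that
  \<open>projective_module\<close> prescribes.\<close>

lemma proj_imp_projective_module:
  assumes "proj R P"
  shows "projective_module R P"
proof -
  let ?F = "free_left_module R (carrier P)"
  let ?q = "lin R P (\<lambda>x. x)"
  interpret P: left_module R P using assms by (rule proj_left_module)
  note P = P.left_module_axioms
  note F = left_module_free[OF P.R.ring_axioms, of "carrier P"]
  interpret F: left_module R ?F by fact
  have q: "?q \<in> lmod_hom R ?F P" by (rule lin_hom[OF P]) auto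
  let ?K = "lmod_kernel ?F P ?q"
  note K = lmod_kernel[OF F P q]
  obtain s where s: "s \<in> lmod_hom R P ?F"
    and sec: "\<And>x. x \<in> carrier P \<Longrightarrow> ?q (s x) = x"
    using assms by (auto simp: proj_def)
  let ?\<theta> = "\<lambda>x. s (fst x) \<oplus>\<^bsub>?F\<^esub> snd x"
  note S = left_module_direct_sum[OF P K]
  have sn: "snd \<in> lmod_hom R (lmod_direct_sum P ?K) ?F"
    by (rule lmod_homI) (auto simp del: free_left_module_simps)
  have \<theta>: "?\<theta> \<in> lmod_hom R (lmod_direct_sum P ?K) ?F"
    by (rule lmod_hom_plus[OF S F lmod_hom_comp[OF lmod_hom_fst s] sn])
  have q\<theta>: "?q (?\<theta> x) = fst x" if "x \<in> carrier (lmod_direct_sum P ?K)" for x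
    using that lmod_hom_closed[OF s]
    by (auto simp: lmod_hom_add[OF q] sec simp del: free_left_module_simps)
  have "inj_on ?\<theta> (carrier (lmod_direct_sum P ?K))"
  proof (rule inj_onI)
    fix x y assume x: "x \<in> carrier (lmod_direct_sum P ?K)" and y: "y \<in> carrier (lmod_direct_sum P ?K)"
      and eq: "?\<theta> x = ?\<theta> y"
    then have fst: "fst x = fst y" using q\<theta>[OF x] q\<theta>[OF y] by simp
    have "s (fst x) \<in> carrier ?F" "snd x \<in> carrier ?F" "snd y \<in> carrier ?F"
      using x y lmod_hom_closed[OF s, of "fst x"] by (auto simp del: free_left_module_simps)
    with eq fst have "snd x = snd y" by (simp del: free_left_module_simps)
    with fst show "x = y" by (simp add: prod_eq_iff)
  qed
  moreover have "?\<theta> ` carrier (lmod_direct_sum P ?K) = carrier ?F"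
  proof
    show "?\<theta> ` carrier (lmod_direct_sum P ?K) \<subseteq> carrier ?F"
      using lmod_hom_closed[OF \<theta>] by blast
    show "carrier ?F \<subseteq> ?\<theta> ` carrier (lmod_direct_sum P ?K)"
    proof
      fix f assume f: "f \<in> carrier ?F"
      have qf: "?q f \<in> carrier P" using lmod_hom_closed[OF q f] .
      have sq: "s (?q f) \<in> carrier ?F" using lmod_hom_closed[OF s qf] .
      \<comment> \<open>The decomposition of \<open>f\<close>: the section applied to its value,
        plus a remainder in the kernel.\<close>
      have "?q (f \<ominus>\<^bsub>?F\<^esub> s (?q f)) = \<zero>\<^bsub>P\<^esub>"
        unfolding lmod_hom_minus[OF F P q f sq] using qf by (simp add: sec a_minus_def P.N.r_neg)
      moreover have "f = s (?q f) \<oplus>\<^bsub>?F\<^esub> (f \<ominus>\<^bsub>?F\<^esub> s (?q f))"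
        using f sq by (simp add: a_minus_def F.N.a_lcomm F.N.r_neg del: free_left_module_simps)
      ultimately show "f \<in> ?\<theta> ` carrier (lmod_direct_sum P ?K)"
        using f sq qf by (intro rev_image_eqI[of "(?q f, f \<ominus>\<^bsub>?F\<^esub> s (?q f))"])
            (auto simp del: free_left_module_simps)
    qed
  qed
  ultimately have "?\<theta> \<in> lmod_iso R (lmod_direct_sum P ?K) ?F"
    using \<theta> by (simp add: lmod_iso_def bij_betw_def)
  then show ?thesis using P K unfolding projective_module_def by blast
qed

section \<open>Projective dimension\<close>

lemma lepoll_Times_infinite:
  fixes U :: "'u set"
  assumes "infinite U" "A \<lesssim> U" "B \<lesssim> U"
  shows "A \<times> B \<lesssim> U"
proof -
  obtain f g where f: "inj_on f A" "f ` A \<subseteq> U" and g: "inj_on g B" "g ` B \<subseteq> U"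
    using assms by (auto simp: lepoll_def)
  have "A \<times> B \<lesssim> U \<times> U"
    unfolding lepoll_def using f g
    by (intro exI[of _ "map_prod f g"]) (auto simp: inj_on_def)
  also have "U \<times> U \<approx> U"
    using assms(1) by (simp add: eqpoll_iff_card_of_ordIso card_of_Times_same_infinite)
  finally show ?thesis .
qed

text \<open>A finitely supported function is recorded by a finite set of argument-value pairs, and
  an infinite set has as many finite subsets as elements.\<close>

lemma lepoll_finite_support:
  fixes U :: "'u set"
  assumes U: "infinite U" and A: "A \<lesssim> U" and B: "B \<lesssim> U"
    and F: "\<And>f. f \<in> F \<Longrightarrow> (\<forall>x \<in> A. f x \<in> B) \<and> (\<forall>x. x \<notin> A \<longrightarrow> f x = z) \<and> finite {x. f x \<noteq> z}"
  shows "F \<lesssim> U"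
proof -
  have "F \<subseteq> {f. f ` A \<subseteq> B \<and> {x. f x \<noteq> z} \<subseteq> A \<and> finite {x. f x \<noteq> z}}"
  proof
    fix f assume "f \<in> F"
    then have 1: "\<And>x. x \<in> A \<Longrightarrow> f x \<in> B" and 2: "\<And>x. x \<notin> A \<Longrightarrow> f x = z"
      and 3: "finite {x. f x \<noteq> z}" using F[of f] by blast+
    show "f \<in> {f. f ` A \<subseteq> B \<and> {x. f x \<noteq> z} \<subseteq> A \<and> finite {x. f x \<noteq> z}}"
      using 1 2 3 by auto
  qed
  then have "F \<lesssim> Fpow (A \<times> B)"
    by (rule lepoll_trans[OF subset_imp_lepoll lepoll_restricted_funspace])
  also have "Fpow (A \<times> B) \<lesssim> Fpow U"
  proof -
    obtain f where "inj_on f (A \<times> B)" "f ` (A \<times> B) \<subseteq> U"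
      using lepoll_Times_infinite[OF U A B] by (auto simp: lepoll_def)
    then show ?thesis
      unfolding lepoll_def using inj_on_image_Fpow[of f "A \<times> B"]
      by (intro exI[of _ "image f"]) (auto simp: Fpow_def)
  qed
  also have "Fpow U \<approx> U" by (rule eqpoll_Fpow[OF U])
  finally show ?thesis .
qed

text \<open>The types \<open>'u\<close> are large enough to hold the carriers of all modules occurring in
  projective resolutions of modules with elements in \<open>'u\<close>.\<close>

locale big_type = ring R for R :: "('r, 'x) ring_scheme" (structure) +
  fixes U :: "'u itself"
  assumes infinite_U: "infinite (UNIV :: 'u set)"
    and R_lepoll_U: "(UNIV :: 'r set) \<lesssim> (UNIV :: 'u set)"
begin

lemma lepoll_U: "A \<lesssim> (UNIV :: 'u set)" for A :: "'u set"
  by (rule subset_imp_lepoll) simp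

lemma small_free:
  assumes "B \<lesssim> (UNIV :: 'u set)"
  shows "carrier (free_left_module R B) \<lesssim> (UNIV :: 'u set)"
  by (rule lepoll_finite_support[OF infinite_U assms R_lepoll_U, where z=\<zero>]) auto

text \<open>The free module on \<open>carrier N\<close> has functions as elements; the cover is its
  copy in \<open>'u\<close>.\<close>

lemma enough_proj:
  fixes N :: "('r, 't) module"
  assumes N: "left_module R N" and small: "carrier N \<lesssim> (UNIV :: 'u set)"
  obtains P :: "('r, 'u) module" and f where "proj R P" "f \<in> lmod_hom R P N" "f ` carrier P = carrier N"
proof -
  let ?F = "free_left_module R (carrier N)"
  note F = left_module_free[OF ring_axioms, of "carrier N"]
  obtain P :: "('r, 'u) module" and h k where P: "left_module R P"
    and hk: "h \<in> lmod_iso R ?F P" "k \<in> lmod_iso R P ?F"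
    by (rule small_copy[OF F small_free[OF small]]) blast
  have k: "k \<in> lmod_hom R P ?F" "k ` carrier P = carrier ?F"
    using hk by (auto simp: lmod_iso_def bij_betw_def simp del: free_left_module_simps)
  show thesis
  proof (rule that)
    show "proj R P" by (rule proj_iso[OF proj_free[OF ring_axioms] P hk(2)])
    show "(\<lambda>x. lin R N (\<lambda>x. x) (k x)) \<in> lmod_hom R P N"
      by (rule lmod_hom_comp[OF k(1) lin_hom[OF N]]) auto
    show "(\<lambda>x. lin R N (\<lambda>x. x) (k x)) ` carrier P = carrier N"
      using lin_id_surj[OF N] k(2) by (simp add: image_image[symmetric] del: free_left_module_simps)
  qed
qed

end

section \<open>Short exact sequences and projective dimension within one type\<close>

definition ses :: "('r, 'x) ring_scheme \<Rightarrow> ('r, 'a) module \<Rightarrow> ('a \<Rightarrow> 'b) \<Rightarrow> ('r, 'b) module \<Rightarrow>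
    ('b \<Rightarrow> 'c) \<Rightarrow> ('r, 'c) module \<Rightarrow> bool" where
  "ses R A i B g C \<longleftrightarrow> left_module R A \<and> left_module R B \<and> left_module R C \<and>
     i \<in> lmod_hom R A B \<and> g \<in> lmod_hom R B C \<and> inj_on i (carrier A) \<and>
     i ` carrier A = {x \<in> carrier B. g x = \<zero>\<^bsub>C\<^esub>} \<and> g ` carrier B = carrier C"

lemma ses_kernel:
  "\<lbrakk>left_module R P; left_module R N; f \<in> lmod_hom R P N; f ` carrier P = carrier N\<rbrakk> \<Longrightarrow>
    ses R (lmod_kernel P N f) (\<lambda>x. x) P f N"
  by (auto simp: ses_def lmod_kernel intro!: lmod_homI dest: lmod_hom_closed)

lemma lmod_hom_factor:
  assumes A: "left_module R A" and V: "left_module R V" and i: "i \<in> lmod_hom R A B" "inj_on i (carrier A)"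
    and h: "h \<in> lmod_hom R V B" "h ` carrier V \<subseteq> i ` carrier A"
  shows "(\<lambda>x. inv_into (carrier A) i (h x)) \<in> lmod_hom R V A"
proof -
  interpret A: left_module R A by fact
  have inv: "inv_into (carrier A) i (h x) \<in> carrier A" "i (inv_into (carrier A) i (h x)) = h x"
    if "x \<in> carrier V" for x
    using f_inv_into_f[of "h x" i] inv_into_into[of "h x" i] h(2) that by blast+
  have eq: "inv_into (carrier A) i (h x) = y" if "i y = h x" "y \<in> carrier A" for x y
    using that i(2) by (metis inv_into_f_f)
  show ?thesis
  proof (rule lmod_homI)
    fix x y assume "x \<in> carrier V" "y \<in> carrier V"
    then show "inv_into (carrier A) i (h (x \<oplus>\<^bsub>V\<^esub> y)) =
        inv_into (carrier A) i (h x) \<oplus>\<^bsub>A\<^esub> inv_into (carrier A) i (h y)"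
      by (intro eq) (auto simp: lmod_hom_add[OF i(1)] lmod_hom_add[OF h(1)] inv)
  next
    fix a x assume "a \<in> carrier R" "x \<in> carrier V"
    then show "inv_into (carrier A) i (h (a \<odot>\<^bsub>V\<^esub> x)) = a \<odot>\<^bsub>A\<^esub> inv_into (carrier A) i (h x)"
      by (intro eq) (auto simp: lmod_hom_smult[OF i(1)] lmod_hom_smult[OF h(1)] inv A.smult_closed)
  qed (use inv in auto)
qed

text \<open>Besides the splitting this returns the sequence in the reverse direction, which exhibits
  \<open>A\<close> as a cokernel. \<open>pd_kernel\<close> relies on that.\<close>

lemma ses_split:
  assumes s: "ses R A i B g C" and C: "proj R C"
  obtains \<sigma> r where "ses R C \<sigma> B r A" "\<And>a. a \<in> carrier A \<Longrightarrow> r (i a) = a"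
    "\<And>c. c \<in> carrier C \<Longrightarrow> g (\<sigma> c) = c"
    "\<And>b. b \<in> carrier B \<Longrightarrow> b = i (r b) \<oplus>\<^bsub>B\<^esub> \<sigma> (g b)"
proof -
  have lA: "left_module R A" and lB: "left_module R B" and lC: "left_module R C"
    and i: "i \<in> lmod_hom R A B" "inj_on i (carrier A)" "i ` carrier A = {x \<in> carrier B. g x = \<zero>\<^bsub>C\<^esub>}"
    and g: "g \<in> lmod_hom R B C" "g ` carrier B = carrier C"
    using s by (auto simp: ses_def)
  interpret A: left_module R A by fact
  interpret B: left_module R B by fact
  interpret C: left_module R C by fact
  obtain \<sigma> where \<sigma>: "\<sigma> \<in> lmod_hom R C B" "\<And>c. c \<in> carrier C \<Longrightarrow> g (\<sigma> c) = c"
    using proj_lift[OF C lB lC g lmod_hom_id] by auto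
  \<comment> \<open>Subtracting the part that comes from \<open>C\<close> leaves an element of the
    image of \<open>i\<close>; the retraction reads off its preimage.\<close>
  define r where "r = (\<lambda>x. inv_into (carrier A) i (x \<ominus>\<^bsub>B\<^esub> \<sigma> (g x)))"
  have gc: "g x \<in> carrier C" if "x \<in> carrier B" for x using lmod_hom_closed[OF g(1) that] .
  have sc: "\<sigma> c \<in> carrier B" if "c \<in> carrier C" for c using lmod_hom_closed[OF \<sigma>(1) that] .
  have d: "(\<lambda>x. x \<ominus>\<^bsub>B\<^esub> \<sigma> (g x)) \<in> lmod_hom R B B"
    by (rule lmod_hom_diff[OF lB lB lmod_hom_id lmod_hom_comp[OF g(1) \<sigma>(1)]])
  have dim: "x \<ominus>\<^bsub>B\<^esub> \<sigma> (g x) \<in> i ` carrier A" if "x \<in> carrier B" for x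
    using that gc sc
    by (simp add: i(3) lmod_hom_minus[OF lB lC g(1)] \<sigma>(2)) (simp add: a_minus_def C.N.r_neg)
  have r: "r \<in> lmod_hom R B A"
    unfolding r_def using lmod_hom_factor[OF lA lB i(1,2) d] dim by blast
  have ri: "r (i a) = a" if "a \<in> carrier A" for a
  proof -
    have ia: "i a \<in> carrier B" "g (i a) = \<zero>\<^bsub>C\<^esub>" using i(3) that by auto
    have "i a \<ominus>\<^bsub>B\<^esub> \<sigma> (g (i a)) = i a"
      using ia lmod_hom_zero[OF lC lB \<sigma>(1)] by (simp add: a_minus_def)
    then show ?thesis using i(2) that by (simp add: r_def)
  qed
  have ir: "i (r x) = x \<ominus>\<^bsub>B\<^esub> \<sigma> (g x)" if "x \<in> carrier B" for x
    using dim[OF that] by (simp add: r_def f_inv_into_f)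
  have dec: "b = i (r b) \<oplus>\<^bsub>B\<^esub> \<sigma> (g b)" if "b \<in> carrier B" for b
    using that gc sc by (simp add: ir a_minus_def B.N.a_assoc B.N.l_neg)
  have r0: "r x = \<zero>\<^bsub>A\<^esub> \<longleftrightarrow> x = \<sigma> (g x)" if "x \<in> carrier B" for x
  proof
    assume "r x = \<zero>\<^bsub>A\<^esub>"
    then show "x = \<sigma> (g x)"
      using dec[OF that] lmod_hom_zero[OF lA lB i(1)] gc[OF that] sc by simp
  next
    assume "x = \<sigma> (g x)"
    then have "i (r x) = i \<zero>\<^bsub>A\<^esub>"
      using ir[OF that] lmod_hom_zero[OF lA lB i(1)] that by (simp add: a_minus_def B.N.r_neg)
    then show "r x = \<zero>\<^bsub>A\<^esub>" using i(2) lmod_hom_closed[OF r that] by (auto dest: inj_onD)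
  qed
  have "ses R C \<sigma> B r A"
    unfolding ses_def
  proof (intro conjI lA lB lC \<sigma>(1) r)
    show "inj_on \<sigma> (carrier C)" by (rule inj_on_inverseI[of _ g]) (rule \<sigma>(2))
    show "\<sigma> ` carrier C = {x \<in> carrier B. r x = \<zero>\<^bsub>A\<^esub>}"
    proof (intro equalityI subsetI)
      fix x assume "x \<in> \<sigma> ` carrier C"
      then show "x \<in> {x \<in> carrier B. r x = \<zero>\<^bsub>A\<^esub>}" using sc \<sigma>(2) r0 by auto
    next
      fix x assume "x \<in> {x \<in> carrier B. r x = \<zero>\<^bsub>A\<^esub>}"
      then show "x \<in> \<sigma> ` carrier C" using gc r0 by auto
    qed
    show "r ` carrier B = carrier A"
    proof (intro equalityI subsetI)
      fix x assume "x \<in> carrier A"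
      then show "x \<in> r ` carrier B" using ri lmod_hom_closed[OF i(1)] by (metis image_eqI)
    qed (use lmod_hom_closed[OF r] in auto)
  qed
  then show thesis using ri \<sigma>(2) dec by (rule that)
qed

lemma proj_ses_kernel:
  assumes s: "ses R A i B g C" and "proj R B" "proj R C"
  shows "proj R A"
proof -
  obtain \<sigma> r where r: "ses R C \<sigma> B r A" "\<And>a. a \<in> carrier A \<Longrightarrow> r (i a) = a"
    using ses_split[OF s assms(3)] by metis
  show ?thesis
    by (rule proj_retract[OF assms(2) _ _ _ r(2)]) (use s r(1) in \<open>auto simp: ses_def\<close>)
qed

lemma proj_ses_middle:
  assumes s: "ses R A i B g C" and A: "proj R A" and C: "proj R C"
  shows "proj R B"
proof -
  obtain \<sigma> r where r: "ses R C \<sigma> B r A" "\<And>b. b \<in> carrier B \<Longrightarrow> b = i (r b) \<oplus>\<^bsub>B\<^esub> \<sigma> (g b)"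
    using ses_split[OF s C] by metis
  have lB: "left_module R B" and i: "i \<in> lmod_hom R A B" and g: "g \<in> lmod_hom R B C"
    and rh: "r \<in> lmod_hom R B A" and \<sigma>: "\<sigma> \<in> lmod_hom R C B"
    using s r(1) by (auto simp: ses_def)
  let ?S = "lmod_direct_sum A C"
  have lS: "left_module R ?S"
    by (rule left_module_direct_sum) (use A C proj_left_module in auto)
  show ?thesis
  proof (rule proj_retract[OF proj_direct_sum[OF A C] lB])
    show "(\<lambda>x. (r x, g x)) \<in> lmod_hom R B ?S" by (rule lmod_hom_pair[OF rh g])
    show "(\<lambda>x. i (fst x) \<oplus>\<^bsub>B\<^esub> \<sigma> (snd x)) \<in> lmod_hom R ?S B"
      by (rule lmod_hom_plus[OF lS lB lmod_hom_comp[OF lmod_hom_fst i] lmod_hom_comp[OF lmod_hom_snd \<sigma>]])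
  qed (use r(2) in auto)
qed

text \<open>Projective dimension at most \<open>l\<close>, by recursion on the first syzygy. One
  presentation is asked for; that any other would do is \<open>pd_kernel\<close>. The presenting
  module has the type of \<open>N\<close>, as primitive recursion at a fixed type demands.\<close>

primrec pd :: "('r, 'x) ring_scheme \<Rightarrow> nat \<Rightarrow> ('r, 'u) module \<Rightarrow> bool" where
  "pd R 0 N \<longleftrightarrow> proj R N"
| "pd R (Suc l) N \<longleftrightarrow> left_module R N \<and>
     (\<exists>(P :: ('r, 'u) module) f. proj R P \<and> f \<in> lmod_hom R P N \<and> f ` carrier P = carrier N \<and>
        pd R l (lmod_kernel P N f))"

lemma pd_left_module: "pd R l N \<Longrightarrow> left_module R N"
  by (cases l) (auto dest: proj_left_module)

text \<open>Following a presentation of \<open>N\<close> by \<open>h\<close> presents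
  \<open>N'\<close> with literally the same kernel.\<close>

lemma pd_iso:
  fixes N N' :: "('r, 'u) module"
  assumes N: "pd R l N" and N': "left_module R N'" and h: "h \<in> lmod_iso R N N'"
  shows "pd R l N'"
proof (cases l)
  case 0
  then show ?thesis
    using proj_iso[OF _ N' lmod_iso_inv[OF pd_left_module[OF N] h]] N by simp
next
  case (Suc k)
  then obtain P :: "('r, 'u) module" and f where P: "proj R P"
    and f: "f \<in> lmod_hom R P N" "f ` carrier P = carrier N" and K: "pd R k (lmod_kernel P N f)"
    using N by auto
  have h': "h \<in> lmod_hom R N N'" "inj_on h (carrier N)" "h ` carrier N = carrier N'"
    using h by (auto simp: lmod_iso_def bij_betw_def)
  note lN = pd_left_module[OF N]
  have "(h (f x) = \<zero>\<^bsub>N'\<^esub>) = (f x = \<zero>\<^bsub>N\<^esub>)" if "x \<in> carrier P" for x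
    using h'(2) lmod_hom_inj_iff[OF lN N' h'(1)] lmod_hom_zero[OF lN N' h'(1)] lmod_hom_closed[OF f(1) that]
    by auto
  then have "lmod_kernel P N' (\<lambda>x. h (f x)) = lmod_kernel P N f"
    by (simp cong: conj_cong)
  moreover have "(\<lambda>x. h (f x)) ` carrier P = carrier N'" using f(2) h'(3) by (metis image_image)
  ultimately show ?thesis
    using Suc P K N' lmod_hom_comp[OF f(1) h'(1)] by (auto intro!: exI[of _ P] exI[of _ "\<lambda>x. h (f x)"])
qed

context big_type begin

text \<open>Only the base case has content: the kernel of a projective cover of a projective module
  is projective.\<close>

lemma pd_Suc:
  fixes N :: "('r, 'u) module"
  shows "pd R l N \<Longrightarrow> pd R (Suc l) N"
proof (induction l arbitrary: N)
  case 0
  then have N: "proj R N" by simp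
  note lN = proj_left_module[OF N]
  obtain P :: "('r, 'u) module" and f where P: "proj R P" and f: "f \<in> lmod_hom R P N" "f ` carrier P = carrier N"
    using enough_proj[OF lN lepoll_U] by metis
  have "proj R (lmod_kernel P N f)"
    by (rule proj_ses_kernel[OF ses_kernel[OF proj_left_module[OF P] lN f] P N])
  then show ?case using P f lN by auto
next
  case (Suc l)
  then show ?case unfolding pd.simps(2)[of R l] pd.simps(2)[of R "Suc l"] by blast
qed

lemma pd_mono:
  fixes N :: "('r, 'u) module"
  shows "\<lbrakk>pd R l N; l \<le> k\<rbrakk> \<Longrightarrow> pd R k N"
  by (induction k) (auto simp: le_Suc_eq intro: pd_Suc simp del: pd.simps)

text \<open>The horseshoe lemma: covers of \<open>A\<close> and \<open>C\<close> combine to a cover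
  of \<open>B\<close> by their direct sum, and the kernels again form a short exact sequence, to
  which the induction applies.\<close>

lemma pd_ext:
  fixes A B C :: "('r, 'u) module"
  shows "\<lbrakk>ses R A i B g C; pd R l A; pd R l C\<rbrakk> \<Longrightarrow> pd R l B"
proof (induction l arbitrary: A B C i g)
  case 0
  then show ?case using proj_ses_middle by auto
next
  case (Suc l)
  have lA: "left_module R A" and lB: "left_module R B" and lC: "left_module R C"
    and i: "i \<in> lmod_hom R A B" "inj_on i (carrier A)" "i ` carrier A = {x \<in> carrier B. g x = \<zero>\<^bsub>C\<^esub>}"
    and g: "g \<in> lmod_hom R B C" "g ` carrier B = carrier C"
    using Suc.prems(1) by (auto simp: ses_def)
  interpret A: left_module R A by fact
  interpret B: left_module R B by fact
  interpret C: left_module R C by fact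
  obtain P :: "('r, 'u) module" and f where P: "proj R P" and f: "f \<in> lmod_hom R P A" "f ` carrier P = carrier A"
    and KP: "pd R l (lmod_kernel P A f)" using Suc.prems(2) by auto
  obtain Q :: "('r, 'u) module" and e where Q: "proj R Q" and e: "e \<in> lmod_hom R Q C" "e ` carrier Q = carrier C"
    and KQ: "pd R l (lmod_kernel Q C e)" using Suc.prems(3) by auto
  interpret P: left_module R P using P by (rule proj_left_module)
  interpret Q: left_module R Q using Q by (rule proj_left_module)
  note lP = P.left_module_axioms and lQ = Q.left_module_axioms
  \<comment> \<open>Projectivity of \<open>Q\<close> enters here: the cover of \<open>C\<close>
    lifts to a map into \<open>B\<close>.\<close>
  obtain \<gamma> where \<gamma>: "\<gamma> \<in> lmod_hom R Q B" "\<And>q. q \<in> carrier Q \<Longrightarrow> g (\<gamma> q) = e q"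
    using proj_lift[OF Q lB lC g e(1)] by metis
  let ?S = "lmod_direct_sum P Q"
  note lS = left_module_direct_sum[OF lP lQ]
  have small: "carrier ?S \<lesssim> (UNIV :: 'u set)"
    by (simp add: lepoll_Times_infinite[OF infinite_U] lepoll_U)
  \<comment> \<open>The direct sum has pairs as elements; \<open>T\<close> is its copy in
    \<open>'u\<close>, read through \<open>k\<close> and built through \<open>h\<close>.\<close>
  obtain T :: "('r, 'u) module" and h k where lT: "left_module R T"
    and h: "h \<in> lmod_iso R ?S T" and k: "k \<in> lmod_iso R T ?S"
    and kh: "\<And>x. x \<in> carrier ?S \<Longrightarrow> k (h x) = x" and hk: "\<And>x. x \<in> carrier T \<Longrightarrow> h (k x) = x"
    by (rule small_copy[OF lS small]) blast
  have h': "h \<in> lmod_hom R ?S T" and k': "k \<in> lmod_hom R T ?S"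
    using h k by (auto simp: lmod_iso_def)
  interpret T: left_module R T by fact
  have k1: "fst (k t) \<in> carrier P" and k2: "snd (k t) \<in> carrier Q" if "t \<in> carrier T" for t
    using lmod_hom_closed[OF k' that] by auto
  have hc: "h (p, q) \<in> carrier T" if "p \<in> carrier P" "q \<in> carrier Q" for p q
    using lmod_hom_closed[OF h', of "(p, q)"] that by auto
  let ?u = "\<lambda>t. i (f (fst (k t)))" and ?v = "\<lambda>t. \<gamma> (snd (k t))"
  let ?\<phi> = "\<lambda>t. ?u t \<oplus>\<^bsub>B\<^esub> ?v t"
  have p1: "(\<lambda>t. fst (k t)) \<in> lmod_hom R T P" by (rule lmod_hom_comp[OF k' lmod_hom_fst])
  have p2: "(\<lambda>t. snd (k t)) \<in> lmod_hom R T Q" by (rule lmod_hom_comp[OF k' lmod_hom_snd])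
  have \<phi>: "?\<phi> \<in> lmod_hom R T B"
    by (rule lmod_hom_plus[OF lT lB lmod_hom_comp[OF lmod_hom_comp[OF p1 f(1)] i(1)] lmod_hom_comp[OF p2 \<gamma>(1)]])
  have uc: "?u t \<in> carrier B" "g (?u t) = \<zero>\<^bsub>C\<^esub>" and vc: "?v t \<in> carrier B" if "t \<in> carrier T" for t
    using i(3) lmod_hom_closed[OF f(1) k1[OF that]] lmod_hom_closed[OF \<gamma>(1) k2[OF that]] by auto
  have g\<phi>: "g (?\<phi> t) = e (snd (k t))" if "t \<in> carrier T" for t
    using uc[OF that] vc[OF that] k2[OF that] lmod_hom_closed[OF e(1)]
    by (simp add: lmod_hom_add[OF g(1)] \<gamma>(2))
  have preA: "\<exists>p \<in> carrier P. i (f p) = b" if "b \<in> carrier B" "g b = \<zero>\<^bsub>C\<^esub>" for b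
  proof -
    have "b \<in> i ` f ` carrier P" using that i(3) f(2) by auto
    then show ?thesis by auto
  qed
  have surj: "?\<phi> ` carrier T = carrier B"
  proof (intro equalityI subsetI)
    fix b assume b: "b \<in> carrier B"
    then have "g b \<in> e ` carrier Q" using lmod_hom_closed[OF g(1)] e(2) by auto
    then obtain q where q: "q \<in> carrier Q" "g b = e q" by auto
    have gq: "\<gamma> q \<in> carrier B" using lmod_hom_closed[OF \<gamma>(1) q(1)] .
    have "g (b \<ominus>\<^bsub>B\<^esub> \<gamma> q) = \<zero>\<^bsub>C\<^esub>"
      unfolding lmod_hom_minus[OF lB lC g(1) b gq] \<gamma>(2)[OF q(1)] q(2)
      using lmod_hom_closed[OF e(1) q(1)] by (simp add: a_minus_def C.N.r_neg)
    then obtain p where p: "p \<in> carrier P" "i (f p) = b \<ominus>\<^bsub>B\<^esub> \<gamma> q"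
      using preA[of "b \<ominus>\<^bsub>B\<^esub> \<gamma> q"] b gq by auto
    have "?\<phi> (h (p, q)) = b"
      using p q b gq by (simp add: kh a_minus_def B.N.a_assoc B.N.l_neg)
    from this[symmetric] hc[OF p(1) q(1)] show "b \<in> ?\<phi> ` carrier T" by (rule image_eqI)
  qed (use lmod_hom_closed[OF \<phi>] in auto)
  let ?K = "lmod_kernel T B ?\<phi>"
  let ?\<iota> = "\<lambda>a. h (a, \<zero>\<^bsub>Q\<^esub>)"
  have \<phi>\<iota>: "?\<phi> (?\<iota> a) = i (f a)" if "a \<in> carrier P" for a
    using that lmod_hom_zero[OF lQ lB \<gamma>(1)] lmod_hom_closed[OF i(1) lmod_hom_closed[OF f(1) that]] by (simp add: kh)
  have \<iota>: "?\<iota> \<in> lmod_hom R P T"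
    by (rule lmod_hom_comp[where g="\<lambda>a. (a, \<zero>\<^bsub>Q\<^esub>)", OF _ h']) (auto intro!: lmod_homI simp: Q.smult_r_zero)
  have inj0: "i a = \<zero>\<^bsub>B\<^esub> \<longleftrightarrow> a = \<zero>\<^bsub>A\<^esub>" if "a \<in> carrier A" for a
    using i(2) that lmod_hom_zero[OF lA lB i(1)] A.N.zero_closed by (metis inj_onD)
  \<comment> \<open>The part of the snake lemma that is needed, by hand: the kernels of the two
    covers are the ends and the kernel of the combined cover is the middle.\<close>
  have "ses R (lmod_kernel P A f) ?\<iota> ?K (\<lambda>t. snd (k t)) (lmod_kernel Q C e)"
    unfolding ses_def
  proof (intro conjI lmod_kernel lP lQ lT lA lB lC \<phi> f(1) e(1))
    show "?\<iota> \<in> lmod_hom R (lmod_kernel P A f) ?K"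
      by (rule lmod_hom_restrict[OF \<iota>])
        (use \<phi>\<iota> lmod_hom_closed[OF \<iota>] lmod_hom_zero[OF lA lB i(1)] in \<open>auto \<close>)
    show "(\<lambda>t. snd (k t)) \<in> lmod_hom R ?K (lmod_kernel Q C e)"
    proof (rule lmod_hom_restrict[OF p2])
      show "(\<lambda>t. snd (k t)) ` {x \<in> carrier T. ?\<phi> x = \<zero>\<^bsub>B\<^esub>} \<subseteq> {x \<in> carrier Q. e x = \<zero>\<^bsub>C\<^esub>}"
      proof safe
        fix t assume t: "t \<in> carrier T" "?\<phi> t = \<zero>\<^bsub>B\<^esub>"
        then show "e (snd (k t)) = \<zero>\<^bsub>C\<^esub>" using g\<phi>[OF t(1)] lmod_hom_zero[OF lB lC g(1)] by simp
      qed (rule k2)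
    qed auto
    have "inj_on ?\<iota> (carrier P)" by (rule inj_on_inverseI[of _ "\<lambda>t. fst (k t)"]) (simp add: kh)
    then show "inj_on ?\<iota> (carrier (lmod_kernel P A f))" by (rule inj_on_subset) auto
    show "?\<iota> ` carrier (lmod_kernel P A f) = {x \<in> carrier ?K. snd (k x) = \<zero>\<^bsub>lmod_kernel Q C e\<^esub>}"
    proof (intro equalityI subsetI)
      fix x assume "x \<in> ?\<iota> ` carrier (lmod_kernel P A f)"
      then obtain a where a: "a \<in> carrier P" "f a = \<zero>\<^bsub>A\<^esub>" "x = ?\<iota> a" by auto
      then show "x \<in> {x \<in> carrier ?K. snd (k x) = \<zero>\<^bsub>lmod_kernel Q C e\<^esub>}"
        using \<phi>\<iota>[OF a(1)] lmod_hom_zero[OF lA lB i(1)] lmod_hom_closed[OF \<iota> a(1)] by (simp add: kh)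
    next
      fix x assume "x \<in> {x \<in> carrier ?K. snd (k x) = \<zero>\<^bsub>lmod_kernel Q C e\<^esub>}"
      then have x: "x \<in> carrier T" "?\<phi> x = \<zero>\<^bsub>B\<^esub>" "snd (k x) = \<zero>\<^bsub>Q\<^esub>" by auto
      have kx: "k x = (fst (k x), \<zero>\<^bsub>Q\<^esub>)" using x(3) by (metis prod.collapse)
      have xe: "x = ?\<iota> (fst (k x))" using hk[OF x(1)] kx by metis
      have "i (f (fst (k x))) = \<zero>\<^bsub>B\<^esub>" using \<phi>\<iota>[OF k1[OF x(1)]] x(2) xe by metis
      then have "f (fst (k x)) = \<zero>\<^bsub>A\<^esub>" using inj0 lmod_hom_closed[OF f(1) k1[OF x(1)]] by simp
      then show "x \<in> ?\<iota> ` carrier (lmod_kernel P A f)" using xe k1[OF x(1)] by (intro image_eqI[of _ _ "fst (k x)"]) auto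
    qed
    show "(\<lambda>t. snd (k t)) ` carrier ?K = carrier (lmod_kernel Q C e)"
    proof (intro equalityI subsetI)
      fix q assume "q \<in> carrier (lmod_kernel Q C e)"
      then have q: "q \<in> carrier Q" "e q = \<zero>\<^bsub>C\<^esub>" by auto
      have gq: "\<gamma> q \<in> carrier B" using lmod_hom_closed[OF \<gamma>(1) q(1)] .
      \<comment> \<open>An element of the kernel over \<open>C\<close> is completed to one over
        \<open>B\<close>: its lift already dies in \<open>C\<close>, so a suitable \<open>p\<close>
        cancels it.\<close>
      have "g (\<ominus>\<^bsub>B\<^esub> \<gamma> q) = \<zero>\<^bsub>C\<^esub>"
        unfolding lmod_hom_a_inv[OF lB lC g(1) gq] \<gamma>(2)[OF q(1)] q(2)
        using C.N.add.inv_equality[of "\<zero>\<^bsub>C\<^esub>" "\<zero>\<^bsub>C\<^esub>"] by simp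
      then obtain p where p: "p \<in> carrier P" "i (f p) = \<ominus>\<^bsub>B\<^esub> \<gamma> q" using preA[of "\<ominus>\<^bsub>B\<^esub> \<gamma> q"] gq by auto
      have "?\<phi> (h (p, q)) = \<zero>\<^bsub>B\<^esub>" using p q gq by (simp add: kh B.N.l_neg)
      then show "q \<in> (\<lambda>t. snd (k t)) ` carrier ?K"
        using hc[OF p(1) q(1)] p(1) q(1) by (intro image_eqI[of _ _ "h (p, q)"]) (auto simp: kh)
    next
      fix q assume "q \<in> (\<lambda>t. snd (k t)) ` carrier ?K"
      then obtain t where t: "t \<in> carrier T" "?\<phi> t = \<zero>\<^bsub>B\<^esub>" "q = snd (k t)" by auto
      then show "q \<in> carrier (lmod_kernel Q C e)"
        using g\<phi>[OF t(1)] lmod_hom_zero[OF lB lC g(1)] k2 by simp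
    qed
  qed
  then have "pd R l ?K" by (rule Suc.IH[OF _ KP KQ])
  moreover have "proj R T" by (rule proj_iso[OF proj_direct_sum[OF P Q] lT k])
  ultimately show ?case using \<phi> surj lB by auto
qed

text \<open>Compose a presentation of \<open>B\<close> with \<open>g\<close>. The kernel of the
  composite is an extension of \<open>A\<close> by the syzygy of \<open>B\<close>, so it has
  dimension at most \<open>l\<close> by the horseshoe lemma.\<close>

lemma pd_cokernel:
  fixes A B C :: "('r, 'u) module"
  assumes s: "ses R A i B g C" and A: "pd R l A" and B: "pd R (Suc l) B"
  shows "pd R (Suc l) C"
proof -
  have lA: "left_module R A" and lB: "left_module R B" and lC: "left_module R C"
    and i: "i \<in> lmod_hom R A B" "inj_on i (carrier A)" "i ` carrier A = {x \<in> carrier B. g x = \<zero>\<^bsub>C\<^esub>}"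
    and g: "g \<in> lmod_hom R B C" "g ` carrier B = carrier C"
    using s by (auto simp: ses_def)
  obtain P :: "('r, 'u) module" and f where P: "proj R P" and f: "f \<in> lmod_hom R P B" "f ` carrier P = carrier B"
    and K: "pd R l (lmod_kernel P B f)" using B by auto
  note lP = proj_left_module[OF P]
  let ?h = "\<lambda>x. g (f x)"
  have h: "?h \<in> lmod_hom R P C" by (rule lmod_hom_comp[OF f(1) g(1)])
  have hs: "?h ` carrier P = carrier C" using f(2) g(2) by (metis image_image)
  let ?E = "lmod_kernel P C ?h"
  note lE = lmod_kernel[OF lP lC h]
  have fE: "f \<in> lmod_hom R ?E B" by (rule lmod_hom_restrict_dom[OF f(1)]) auto
  have fi: "f ` carrier ?E = i ` carrier A"
    using i(3) f(2) lmod_hom_closed[OF f(1)] by auto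
  let ?j = "\<lambda>x. inv_into (carrier A) i (f x)"
  have ij: "i (?j x) = f x" "?j x \<in> carrier A" if "x \<in> carrier ?E" for x
    using f_inv_into_f[of "f x" i] inv_into_into[of "f x" i] imageI[OF that, of f] unfolding fi by simp_all
  have j0: "?j x = \<zero>\<^bsub>A\<^esub> \<longleftrightarrow> f x = \<zero>\<^bsub>B\<^esub>" if "x \<in> carrier ?E" for x
    using ij[OF that] lmod_hom_inj_iff[OF lA lB i(1)] lmod_hom_zero[OF lA lB i(1)] i(2) by metis
  \<comment> \<open>Elements of the kernel of the composite are those that \<open>f\<close> sends
    into the image of \<open>A\<close>, and \<open>?j\<close> names the element of \<open>A\<close>
    that is hit.\<close>
  have "ses R (lmod_kernel P B f) (\<lambda>x. x) ?E ?j A"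
    unfolding ses_def
  proof (intro conjI lE lA lmod_kernel lP lB f(1))
    show "(\<lambda>x. x) \<in> lmod_hom R (lmod_kernel P B f) ?E"
      by (rule lmod_hom_restrict[OF lmod_hom_id]) (auto simp: lmod_hom_zero[OF lB lC g(1)])
    show "?j \<in> lmod_hom R ?E A" by (rule lmod_hom_factor[OF lA lE i(1,2) fE]) (simp only: fi order_refl)
    show "(\<lambda>x. x) ` carrier (lmod_kernel P B f) = {x \<in> carrier ?E. ?j x = \<zero>\<^bsub>A\<^esub>}"
    proof (intro equalityI subsetI)
      fix x assume x: "x \<in> (\<lambda>x. x) ` carrier (lmod_kernel P B f)"
      then have "x \<in> carrier ?E" by (auto simp: lmod_hom_zero[OF lB lC g(1)])
      moreover have "f x = \<zero>\<^bsub>B\<^esub>" using x by auto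
      ultimately show "x \<in> {x \<in> carrier ?E. ?j x = \<zero>\<^bsub>A\<^esub>}" using j0[of x] by blast
    next
      fix x assume "x \<in> {x \<in> carrier ?E. ?j x = \<zero>\<^bsub>A\<^esub>}"
      with j0[of x] show "x \<in> (\<lambda>x. x) ` carrier (lmod_kernel P B f)" by auto
    qed
    show "?j ` carrier ?E = carrier A"
    proof (intro equalityI subsetI)
      fix a assume a: "a \<in> carrier A"
      then have "i a \<in> f ` carrier ?E" using fi by auto
      then obtain x where "x \<in> carrier ?E" "f x = i a" by auto
      then show "a \<in> ?j ` carrier ?E" using a i(2) by (intro image_eqI[of _ _ x]) auto
    qed (use ij in auto)
  qed auto
  then have "pd R l ?E" by (rule pd_ext[OF _ K A])
  then show ?thesis using P h hs lC by auto
qed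

text \<open>Schanuel's argument: the pullback of two presentations of \<open>C\<close> is an extension in two ways.\<close>

lemma pd_kernel:
  fixes A B C :: "('r, 'u) module"
  assumes s: "ses R A i B g C" and B: "proj R B" and C: "pd R (Suc l) C"
  shows "pd R l A"
proof -
  have lA: "left_module R A" and lB: "left_module R B" and lC: "left_module R C"
    and i: "i \<in> lmod_hom R A B" "inj_on i (carrier A)" "i ` carrier A = {x \<in> carrier B. g x = \<zero>\<^bsub>C\<^esub>}"
    and g: "g \<in> lmod_hom R B C" "g ` carrier B = carrier C"
    using s by (auto simp: ses_def)
  obtain P :: "('r, 'u) module" and f where P: "proj R P" and f: "f \<in> lmod_hom R P C" "f ` carrier P = carrier C"
    and K: "pd R l (lmod_kernel P C f)" using C by auto
  note lP = proj_left_module[OF P]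
  interpret A: left_module R A by fact
  interpret B: left_module R B by fact
  interpret C: left_module R C by fact
  interpret P: left_module R P by fact
  let ?S = "lmod_direct_sum P B"
  note lS = left_module_direct_sum[OF lP lB]
  interpret S: left_module R ?S by fact
  \<comment> \<open>The pullback of the two presentations of \<open>C\<close>.\<close>
  let ?W = "?S\<lparr>carrier := {x \<in> carrier ?S. f (fst x) = g (snd x)}\<rparr>"
  have lW: "left_module R ?W"
    by (rule S.left_module_sub)
      (auto simp: lmod_hom_zero[OF lP lC f(1)] lmod_hom_zero[OF lB lC g(1)] lmod_hom_add[OF f(1)] lmod_hom_add[OF g(1)]
        lmod_hom_smult[OF f(1)] lmod_hom_smult[OF g(1)] P.smult_closed B.smult_closed)
  have small: "carrier ?W \<lesssim> (UNIV :: 'u set)"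
    by (rule lepoll_trans[OF subset_imp_lepoll lepoll_Times_infinite[OF infinite_U lepoll_U lepoll_U]]) auto
  obtain T :: "('r, 'u) module" and h k where lT: "left_module R T"
    and h: "h \<in> lmod_iso R ?W T" and k: "k \<in> lmod_iso R T ?W"
    and kh: "\<And>x. x \<in> carrier ?W \<Longrightarrow> k (h x) = x" and hk: "\<And>x. x \<in> carrier T \<Longrightarrow> h (k x) = x"
    by (rule small_copy[OF lW small]) blast
  have h': "h \<in> lmod_hom R ?W T" and k': "k \<in> lmod_hom R T ?W"
    using h k by (auto simp: lmod_iso_def)
  have k1: "fst (k t) \<in> carrier P" and k2: "snd (k t) \<in> carrier B" and k3: "f (fst (k t)) = g (snd (k t))"
    if "t \<in> carrier T" for t
    using lmod_hom_closed[OF k' that] by auto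
  have hc: "h (p, q) \<in> carrier T" "k (h (p, q)) = (p, q)"
    if "p \<in> carrier P" "q \<in> carrier B" "f p = g q" for p q
    using lmod_hom_closed[OF h', of "(p, q)"] kh[of "(p, q)"] that by auto
  have f1: "fst \<in> lmod_hom R ?W P" and f2: "snd \<in> lmod_hom R ?W B"
    by (auto intro!: lmod_hom_restrict_dom lmod_hom_fst lmod_hom_snd)
  have p1: "(\<lambda>t. fst (k t)) \<in> lmod_hom R T P" and p2: "(\<lambda>t. snd (k t)) \<in> lmod_hom R T B"
    by (rule lmod_hom_comp[OF k' f1], rule lmod_hom_comp[OF k' f2])
  \<comment> \<open>Projecting to \<open>B\<close> has the kernel of \<open>f\<close> as its kernel,
    whence the pullback has dimension at most \<open>l\<close>.\<close>
  have "ses R (lmod_kernel P C f) (\<lambda>p. h (p, \<zero>\<^bsub>B\<^esub>)) T (\<lambda>t. snd (k t)) B"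
    unfolding ses_def
  proof (intro conjI lmod_kernel lP lC f(1) lT lB p2)
    have "(\<lambda>p. (p, \<zero>\<^bsub>B\<^esub>)) \<in> lmod_hom R (lmod_kernel P C f) ?W"
      by (rule lmod_homI) (auto simp: B.smult_r_zero lmod_hom_zero[OF lB lC g(1)])
    then show "(\<lambda>p. h (p, \<zero>\<^bsub>B\<^esub>)) \<in> lmod_hom R (lmod_kernel P C f) T" by (rule lmod_hom_comp[OF _ h'])
    show "inj_on (\<lambda>p. h (p, \<zero>\<^bsub>B\<^esub>)) (carrier (lmod_kernel P C f))"
      by (rule inj_on_inverseI[of _ "\<lambda>t. fst (k t)"]) (auto simp: hc lmod_hom_zero[OF lB lC g(1)])
    show "(\<lambda>p. h (p, \<zero>\<^bsub>B\<^esub>)) ` carrier (lmod_kernel P C f) = {x \<in> carrier T. snd (k x) = \<zero>\<^bsub>B\<^esub>}"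
    proof (intro equalityI subsetI)
      fix x assume "x \<in> (\<lambda>p. h (p, \<zero>\<^bsub>B\<^esub>)) ` carrier (lmod_kernel P C f)"
      then show "x \<in> {x \<in> carrier T. snd (k x) = \<zero>\<^bsub>B\<^esub>}" by (auto simp: hc lmod_hom_zero[OF lB lC g(1)])
    next
      fix x assume "x \<in> {x \<in> carrier T. snd (k x) = \<zero>\<^bsub>B\<^esub>}"
      then have x: "x \<in> carrier T" "snd (k x) = \<zero>\<^bsub>B\<^esub>" by auto
      then have "x = h (fst (k x), \<zero>\<^bsub>B\<^esub>)" using hk by (metis prod.collapse)
      moreover have "f (fst (k x)) = \<zero>\<^bsub>C\<^esub>" using k3 x lmod_hom_zero[OF lB lC g(1)] by simp
      ultimately show "x \<in> (\<lambda>p. h (p, \<zero>\<^bsub>B\<^esub>)) ` carrier (lmod_kernel P C f)"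
        using k1[OF x(1)] by (intro image_eqI[of _ _ "fst (k x)"]) auto
    qed
    show "(\<lambda>t. snd (k t)) ` carrier T = carrier B"
    proof (intro equalityI subsetI)
      fix b assume b: "b \<in> carrier B"
      then have "g b \<in> f ` carrier P" using lmod_hom_closed[OF g(1)] f(2) by auto
      then obtain p where "p \<in> carrier P" "f p = g b" by auto
      then show "b \<in> (\<lambda>t. snd (k t)) ` carrier T" using hc b by (metis image_eqI snd_conv)
    qed (use k2 in auto)
  qed
  moreover have "pd R l B" by (rule pd_mono[of 0]) (simp_all add: B)
  ultimately have T: "pd R l T" using pd_ext K by blast
  \<comment> \<open>Projecting to \<open>P\<close> has \<open>A\<close> as its kernel, and this
    sequence splits because \<open>P\<close> is projective.\<close>
  have s': "ses R A (\<lambda>a. h (\<zero>\<^bsub>P\<^esub>, i a)) T (\<lambda>t. fst (k t)) P"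
    unfolding ses_def
  proof (intro conjI lP lA lT p1)
    have ia: "i a \<in> carrier B" "g (i a) = \<zero>\<^bsub>C\<^esub>" if "a \<in> carrier A" for a using i(3) that by auto
    have "(\<lambda>a. (\<zero>\<^bsub>P\<^esub>, i a)) \<in> lmod_hom R A ?W"
      by (rule lmod_homI)
        (auto simp: P.smult_r_zero lmod_hom_zero[OF lP lC f(1)] ia lmod_hom_add[OF i(1)] lmod_hom_smult[OF i(1)])
    then show "(\<lambda>a. h (\<zero>\<^bsub>P\<^esub>, i a)) \<in> lmod_hom R A T" by (rule lmod_hom_comp[OF _ h'])
    have inv: "inv_into (carrier A) i (snd (k (h (\<zero>\<^bsub>P\<^esub>, i a)))) = a" if "a \<in> carrier A" for a
      using that ia i(2) by (simp add: hc lmod_hom_zero[OF lP lC f(1)])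
    then show "inj_on (\<lambda>a. h (\<zero>\<^bsub>P\<^esub>, i a)) (carrier A)"
      by (rule inj_on_inverseI[of _ "\<lambda>t. inv_into (carrier A) i (snd (k t))"])
    show "(\<lambda>a. h (\<zero>\<^bsub>P\<^esub>, i a)) ` carrier A = {x \<in> carrier T. fst (k x) = \<zero>\<^bsub>P\<^esub>}"
    proof (intro equalityI subsetI)
      fix x assume "x \<in> (\<lambda>a. h (\<zero>\<^bsub>P\<^esub>, i a)) ` carrier A"
      then show "x \<in> {x \<in> carrier T. fst (k x) = \<zero>\<^bsub>P\<^esub>}" by (auto simp: hc ia lmod_hom_zero[OF lP lC f(1)])
    next
      fix x assume "x \<in> {x \<in> carrier T. fst (k x) = \<zero>\<^bsub>P\<^esub>}"
      then have x: "x \<in> carrier T" "fst (k x) = \<zero>\<^bsub>P\<^esub>" by auto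
      have "g (snd (k x)) = \<zero>\<^bsub>C\<^esub>" using k3[OF x(1)] x(2) lmod_hom_zero[OF lP lC f(1)] by simp
      then have "snd (k x) \<in> i ` carrier A" using i(3) k2[OF x(1)] by auto
      then obtain a where "a \<in> carrier A" "snd (k x) = i a" by auto
      moreover from this have "x = h (\<zero>\<^bsub>P\<^esub>, i a)" using hk x by (metis prod.collapse)
      ultimately show "x \<in> (\<lambda>a. h (\<zero>\<^bsub>P\<^esub>, i a)) ` carrier A" by auto
    qed
    show "(\<lambda>t. fst (k t)) ` carrier T = carrier P"
    proof (intro equalityI subsetI)
      fix p assume p: "p \<in> carrier P"
      then have "f p \<in> g ` carrier B" using lmod_hom_closed[OF f(1)] g(2) by auto
      then obtain b where "b \<in> carrier B" "f p = g b" by auto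
      then show "p \<in> (\<lambda>t. fst (k t)) ` carrier T" using hc p by (metis image_eqI fst_conv)
    qed (use k1 in auto)
  qed
  \<comment> \<open>For \<open>l = 0\<close> all terms are projective. Otherwise the reversed
    splitting makes \<open>A\<close> the cokernel of \<open>P\<close> in the pullback; as
    \<open>P\<close> has dimension at most \<open>m\<close>, this costs nothing.\<close>
  show ?thesis
  proof (cases l)
    case 0
    then show ?thesis using proj_ses_kernel[OF s' _ P] T by simp
  next
    case (Suc m)
    obtain \<sigma> r where "ses R P \<sigma> T r A" using ses_split[OF s' P] by metis
    then have "pd R (Suc m) A"
      by (rule pd_cokernel) (use P T Suc pd_mono[of 0 P m] in auto)
    then show ?thesis using Suc by simp
  qed
qed

end

section \<open>Projective dimension of modules of arbitrary type\<close>

lemma lmod_iso_comp: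
  assumes "g \<in> lmod_iso R N L" "h \<in> lmod_iso R L K"
  shows "(\<lambda>x. h (g x)) \<in> lmod_iso R N K"
  using assms lmod_hom_comp[of g R N L h K] bij_betw_trans[of g "carrier N" "carrier L" h "carrier K"]
  by (auto simp: lmod_iso_def comp_def)

text \<open>Moves an exact sequence to copies in \<open>'u\<close>. The isomorphism \<open>a\<close>
  is precomposed with \<open>i\<close>, and \<open>c\<close> is postcomposed with \<open>g\<close>;
  therefore they point in opposite directions.\<close>

lemma ses_iso:
  assumes s: "ses R A i B g C" and lA': "left_module R A'" and lB': "left_module R B'" and lC': "left_module R C'"
    and a: "a \<in> lmod_iso R A' A" and b: "b \<in> lmod_iso R B B'" and c: "c \<in> lmod_iso R C C'"
  shows "\<exists>i' g'. ses R A' i' B' g' C'"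
proof -
  have lA: "left_module R A" and lB: "left_module R B" and lC: "left_module R C"
    and i: "i \<in> lmod_hom R A B" "inj_on i (carrier A)" "i ` carrier A = {x \<in> carrier B. g x = \<zero>\<^bsub>C\<^esub>}"
    and g: "g \<in> lmod_hom R B C" "g ` carrier B = carrier C"
    using s by (auto simp: ses_def)
  let ?e = "inv_into (carrier B) b"
  have e: "?e \<in> lmod_hom R B' B" "?e ` carrier B' = carrier B"
    using lmod_iso_inv[OF lB b] by (auto simp: lmod_iso_def bij_betw_def)
  have a': "a \<in> lmod_hom R A' A" "inj_on a (carrier A')" "a ` carrier A' = carrier A"
    using a by (auto simp: lmod_iso_def bij_betw_def)
  have b': "b \<in> lmod_hom R B B'" "inj_on b (carrier B)" "b ` carrier B = carrier B'"
    using b by (auto simp: lmod_iso_def bij_betw_def)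
  have c': "c \<in> lmod_hom R C C'" "inj_on c (carrier C)" "c ` carrier C = carrier C'"
    using c by (auto simp: lmod_iso_def bij_betw_def)
  have eb: "?e (b x) = x" if "x \<in> carrier B" for x using b'(2) that by simp
  have be: "b (?e y) = y" if "y \<in> carrier B'" for y using b'(3) that by (simp add: f_inv_into_f)
  have c0: "c x = \<zero>\<^bsub>C'\<^esub> \<longleftrightarrow> x = \<zero>\<^bsub>C\<^esub>" if "x \<in> carrier C" for x
    using c'(2) lmod_hom_inj_iff[OF lC lC' c'(1)] lmod_hom_zero[OF lC lC' c'(1)] that by metis
  have "ses R A' (\<lambda>x. b (i (a x))) B' (\<lambda>y. c (g (?e y))) C'"
    unfolding ses_def
  proof (intro conjI lA' lB' lC')
    show "(\<lambda>x. b (i (a x))) \<in> lmod_hom R A' B'"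
      by (rule lmod_hom_comp[OF lmod_hom_comp[OF a'(1) i(1)] b'(1)])
    show "(\<lambda>y. c (g (?e y))) \<in> lmod_hom R B' C'"
      by (rule lmod_hom_comp[OF lmod_hom_comp[OF e(1) g(1)] c'(1)])
    have "inj_on (b \<circ> (i \<circ> a)) (carrier A')"
      using a'(2,3) i(2) b'(2) lmod_hom_closed[OF i(1)]
      by (intro comp_inj_on) (auto intro: inj_on_subset)
    then show "inj_on (\<lambda>x. b (i (a x))) (carrier A')" by (simp add: comp_def)
    show "(\<lambda>x. b (i (a x))) ` carrier A' = {y \<in> carrier B'. c (g (?e y)) = \<zero>\<^bsub>C'\<^esub>}"
    proof -
      have "(\<lambda>x. b (i (a x))) ` carrier A' = b ` i ` a ` carrier A'" by (simp add: image_image)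
      also have "\<dots> = b ` {x \<in> carrier B. g x = \<zero>\<^bsub>C\<^esub>}" by (simp add: a'(3) i(3))
      also have "\<dots> = {y \<in> carrier B'. c (g (?e y)) = \<zero>\<^bsub>C'\<^esub>}"
      proof (intro equalityI subsetI)
        fix y assume "y \<in> b ` {x \<in> carrier B. g x = \<zero>\<^bsub>C\<^esub>}"
        then show "y \<in> {y \<in> carrier B'. c (g (?e y)) = \<zero>\<^bsub>C'\<^esub>}"
          using lmod_hom_closed[OF b'(1)] by (auto simp: eb c0 lmod_hom_zero[OF lC lC' c'(1)])
      next
        fix y assume "y \<in> {y \<in> carrier B'. c (g (?e y)) = \<zero>\<^bsub>C'\<^esub>}"
        then have y: "y \<in> carrier B'" "c (g (?e y)) = \<zero>\<^bsub>C'\<^esub>" by auto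
        have ey: "?e y \<in> carrier B" using lmod_hom_closed[OF e(1) y(1)] .
        have "g (?e y) = \<zero>\<^bsub>C\<^esub>" using y(2) c0 lmod_hom_closed[OF g(1) ey] by simp
        then show "y \<in> b ` {x \<in> carrier B. g x = \<zero>\<^bsub>C\<^esub>}"
          using ey be[OF y(1)] by (intro image_eqI[of _ _ "?e y"]) auto
      qed
      finally show ?thesis .
    qed
    show "(\<lambda>y. c (g (?e y))) ` carrier B' = carrier C'"
    proof -
      have "(\<lambda>y. c (g (?e y))) ` carrier B' = c ` g ` ?e ` carrier B'" by (simp add: image_image)
      then show ?thesis by (simp add: e(2) g(2) c'(3))
    qed
  qed
  then show ?thesis by blast
qed

text \<open>The elements of \<open>N\<close> come from an arbitrary type, those of the resolving modules from \<open>'u\<close>.\<close>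

definition pdim_le :: "'u itself \<Rightarrow> ('r, 'x) ring_scheme \<Rightarrow> nat \<Rightarrow> ('r, 't) module \<Rightarrow> bool" where
  "pdim_le U R l N \<longleftrightarrow> left_module R N \<and> (\<exists>(N' :: ('r, 'u) module) h. pd R l N' \<and> h \<in> lmod_iso R N' N)"

lemma pdim_le_left_module: "pdim_le U R l N \<Longrightarrow> left_module R N"
  by (simp add: pdim_le_def)

context big_type begin

lemma pdim_le_small: "pdim_le U R l N \<Longrightarrow> carrier N \<lesssim> (UNIV :: 'u set)"
proof -
  assume "pdim_le U R l N"
  then obtain N' :: "('r, 'u) module" and h where "h \<in> lmod_iso R N' N" by (auto simp: pdim_le_def)
  then have "h ` carrier N' = carrier N" by (auto simp: lmod_iso_def bij_betw_def)
  then have "carrier N \<lesssim> carrier N'" using image_lepoll by metis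
  then show ?thesis using lepoll_U lepoll_trans by blast
qed

lemma pdim_le_mono: "\<lbrakk>pdim_le U R l N; l \<le> k\<rbrakk> \<Longrightarrow> pdim_le U R k N"
  unfolding pdim_le_def using pd_mono by blast

text \<open>Passes back to \<open>pd\<close>: the bound holds for every isomorphic copy in
  \<open>'u\<close>, not only for the one whose existence \<open>pdim_le\<close> asserts.\<close>

lemma pdim_le_copy:
  fixes N' :: "('r, 'u) module"
  assumes "pdim_le U R l N" "left_module R N'" "h \<in> lmod_iso R N N'"
  shows "pd R l N'"
proof -
  obtain L :: "('r, 'u) module" and k where L: "pd R l L" "k \<in> lmod_iso R L N"
    using assms(1) by (auto simp: pdim_le_def)
  show ?thesis by (rule pd_iso[OF L(1) assms(2) lmod_iso_comp[OF L(2) assms(3)]])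
qed

lemma pdim_le_of_copy:
  fixes N' :: "('r, 'u) module"
  assumes "pd R l N'" "left_module R N" "h \<in> lmod_iso R N' N"
  shows "pdim_le U R l N"
  using assms by (auto simp: pdim_le_def)

lemma pdim_le_proj:
  assumes "proj R N" "carrier N \<lesssim> (UNIV :: 'u set)"
  shows "pdim_le U R l N"
proof -
  note lN = proj_left_module[OF assms(1)]
  obtain N' :: "('r, 'u) module" and h k where N': "left_module R N'"
    and hk: "h \<in> lmod_iso R N N'" "k \<in> lmod_iso R N' N"
    by (rule small_copy[OF lN assms(2)]) blast
  have "pd R 0 N'" using proj_iso[OF assms(1) N' hk(2)] by simp
  then have "pd R l N'" by (rule pd_mono) simp
  then show ?thesis using lN hk(2) by (auto simp: pdim_le_def)
qed

lemma pdim_le_ext: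
  assumes s: "ses R A i B g C" and A: "pdim_le U R l A" and C: "pdim_le U R l C"
    and B: "carrier B \<lesssim> (UNIV :: 'u set)"
  shows "pdim_le U R l B"
proof -
  have lB: "left_module R B" using s by (auto simp: ses_def)
  obtain A' :: "('r, 'u) module" and a where A': "pd R l A'" "a \<in> lmod_iso R A' A"
    using A by (auto simp: pdim_le_def)
  obtain C' :: "('r, 'u) module" and c where C': "pd R l C'" "c \<in> lmod_iso R C' C"
    using C by (auto simp: pdim_le_def)
  obtain B' :: "('r, 'u) module" and b e where B': "left_module R B'" and b: "b \<in> lmod_iso R B B'" "e \<in> lmod_iso R B' B"
    by (rule small_copy[OF lB B]) blast
  note lA' = pd_left_module[OF A'(1)] and lC' = pd_left_module[OF C'(1)]
  have "\<exists>i' g'. ses R A' i' B' g' C'"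
    by (rule ses_iso[OF s lA' B' lC' A'(2) b(1) lmod_iso_inv[OF lC' C'(2)]])
  then show ?thesis using pd_ext[OF _ A'(1) C'(1)] pdim_le_of_copy[OF _ lB b(2)] by blast
qed

lemma pdim_le_cokernel:
  assumes s: "ses R A i B g C" and A: "pdim_le U R l A" and B: "pdim_le U R (Suc l) B"
  shows "pdim_le U R (Suc l) C"
proof -
  have lC: "left_module R C" and lB: "left_module R B" and gC: "g ` carrier B = carrier C"
    using s by (auto simp: ses_def)
  have "carrier C \<lesssim> (UNIV :: 'u set)"
    using lepoll_trans[OF image_lepoll pdim_le_small[OF B]] gC by metis
  then obtain C' :: "('r, 'u) module" and c e where C': "left_module R C'" and c: "c \<in> lmod_iso R C C'" "e \<in> lmod_iso R C' C"
    by (rule small_copy[OF lC]) blast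
  obtain A' :: "('r, 'u) module" and a where A': "pd R l A'" "a \<in> lmod_iso R A' A"
    using A by (auto simp: pdim_le_def)
  obtain B' :: "('r, 'u) module" and b where B': "pd R (Suc l) B'" "b \<in> lmod_iso R B' B"
    using B by (auto simp: pdim_le_def)
  note lA' = pd_left_module[OF A'(1)] and lB' = pd_left_module[OF B'(1)]
  have "\<exists>i' g'. ses R A' i' B' g' C'"
    by (rule ses_iso[OF s lA' lB' C' A'(2) lmod_iso_inv[OF lB' B'(2)] c(1)])
  then show ?thesis using pd_cokernel[OF _ A'(1) B'(1)] pdim_le_of_copy[OF _ lC c(2)] by blast
qed

lemma pdim_le_kernel:
  assumes s: "ses R A i B g C" and B: "proj R B" "carrier B \<lesssim> (UNIV :: 'u set)" and C: "pdim_le U R (Suc l) C"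
  shows "pdim_le U R l A"
proof -
  have lA: "left_module R A" and lB: "left_module R B" and i: "inj_on i (carrier A)" "i ` carrier A \<subseteq> carrier B"
    using s by (auto simp: ses_def)
  have "carrier A \<lesssim> carrier B" using i by (auto simp: lepoll_def)
  then have "carrier A \<lesssim> (UNIV :: 'u set)" using B(2) lepoll_trans by blast
  then obtain A' :: "('r, 'u) module" and a e where A': "left_module R A'" and a: "a \<in> lmod_iso R A A'" "e \<in> lmod_iso R A' A"
    by (rule small_copy[OF lA]) blast
  obtain C' :: "('r, 'u) module" and c where C': "pd R (Suc l) C'" "c \<in> lmod_iso R C' C"
    using C by (auto simp: pdim_le_def)
  obtain B' :: "('r, 'u) module" and b b' where B': "left_module R B'" and b: "b \<in> lmod_iso R B B'" "b' \<in> lmod_iso R B' B"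
    by (rule small_copy[OF lB B(2)]) blast
  note lC' = pd_left_module[OF C'(1)]
  have "\<exists>i' g'. ses R A' i' B' g' C'"
    by (rule ses_iso[OF s A' B' lC' a(2) b(1) lmod_iso_inv[OF lC' C'(2)]])
  then show ?thesis
    using pd_kernel[OF _ proj_iso[OF B(1) B' b(2)] C'(1)] pdim_le_of_copy[OF _ lA a(2)] by blast
qed

text \<open>For \<open>\<Phi>\<close> and \<open>\<Psi>\<close> see the case of finite generation in \<open>fg_resolution\<close>; otherwise both are trivial.\<close>

lemma pd_resolution:
  fixes N :: "('r, 'u) module"
  assumes cover: "\<And>N :: ('r, 'u) module. \<lbrakk>left_module R N; \<Psi> N\<rbrakk> \<Longrightarrow>
      \<exists>(P :: ('r, 'u) module) f. proj R P \<and> f \<in> lmod_hom R P N \<and> f ` carrier P = carrier N \<and>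
        \<Phi> P \<and> \<Psi> (lmod_kernel P N f)"
    and base: "\<And>N :: ('r, 'u) module. \<lbrakk>proj R N; \<Psi> N\<rbrakk> \<Longrightarrow> \<Phi> N \<and> \<Phi> (N\<lparr>carrier := {\<zero>\<^bsub>N\<^esub>}\<rparr>)"
  shows "\<lbrakk>pd R l N; \<Psi> N\<rbrakk> \<Longrightarrow> \<exists>(P :: nat \<Rightarrow> ('r, 'u) module) d \<epsilon>. projective_resolution R N P d \<epsilon> \<and>
    length_at_most P l \<and> (\<forall>n. \<Phi> (P n))"
proof (induction l arbitrary: N)
  case 0
  then have N: "proj R N" by simp
  interpret N: left_module R N using N by (rule proj_left_module)
  \<comment> \<open>The resolution by \<open>N\<close> itself in degree 0. Above it stands the zero
    submodule of \<open>N\<close>, a zero module of the right type.\<close>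
  let ?Z = "N\<lparr>carrier := {\<zero>\<^bsub>N\<^esub>}\<rparr>"
  let ?P = "\<lambda>n :: nat. if n = 0 then N else ?Z"
  have lZ: "left_module R ?Z" by (rule N.left_module_sub) (auto simp: N.smult_r_zero)
  have hZ: "(\<lambda>_. \<zero>\<^bsub>N\<^esub>) \<in> lmod_hom R ?Z L" if "L = N \<or> L = ?Z" for L
    using that by (auto intro!: lmod_homI simp: N.smult_r_zero)
  have "proj R ?Z"
    by (rule proj_retract[OF N lZ, where i="\<lambda>x. x" and r="\<lambda>_. \<zero>\<^bsub>N\<^esub>"])
      (auto intro!: lmod_homI simp: N.smult_r_zero)
  then have "projective_resolution R N ?P (\<lambda>_ _. \<zero>\<^bsub>N\<^esub>) (\<lambda>x. x)"
    using N hZ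
    by (auto simp: projective_resolution_def proj_imp_projective_module N.left_module_axioms lmod_hom_id)
  moreover have "length_at_most ?P 0" by (auto simp: length_at_most_def)
  moreover have "\<forall>n. \<Phi> (?P n)" using base[OF N] 0 by auto
  ultimately show ?case by blast
next
  case (Suc l)
  have lN: "left_module R N" using Suc.prems(1) by (rule pd_left_module)
  obtain Q :: "('r, 'u) module" and f where Q: "proj R Q" and f: "f \<in> lmod_hom R Q N" "f ` carrier Q = carrier N"
    and \<Phi>: "\<Phi> Q" and \<Psi>: "\<Psi> (lmod_kernel Q N f)"
    using cover[OF lN Suc.prems(2)] by blast
  let ?K = "lmod_kernel Q N f"
  \<comment> \<open>The cover \<open>Q\<close> is the one delivered by \<open>cover\<close>, not the
    one behind the bound on \<open>N\<close>; \<open>pd_kernel\<close> bridges the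
    difference.\<close>
  have "pd R l ?K"
    by (rule pd_kernel[OF ses_kernel[OF proj_left_module[OF Q] lN f] Q Suc.prems(1)])
  from Suc.IH[OF this \<Psi>] obtain P :: "nat \<Rightarrow> ('r, 'u) module" and d \<epsilon>
    where P: "projective_resolution R ?K P d \<epsilon>" "length_at_most P l" "\<forall>n. \<Phi> (P n)" by blast
  \<comment> \<open>The resolution of the kernel moves up by one degree, and its augmentation
    becomes the lowest differential.\<close>
  let ?P = "\<lambda>n. case n of 0 \<Rightarrow> Q | Suc m \<Rightarrow> P m" and ?d = "\<lambda>n. case n of 0 \<Rightarrow> \<epsilon> | Suc m \<Rightarrow> d m"
  have eps: "\<epsilon> \<in> lmod_hom R (P 0) Q" and ker: "f (\<epsilon> x) = \<zero>\<^bsub>N\<^esub>" if "x \<in> carrier (P 0)" for x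
    using P(1) that by (auto simp: projective_resolution_def lmod_hom_def Pi_iff)
  have eps: "\<epsilon> \<in> lmod_hom R (P 0) Q"
    using P(1) by (auto simp: projective_resolution_def lmod_hom_def Pi_iff)
  have "projective_resolution R N ?P ?d f"
    unfolding projective_resolution_def
  proof (intro conjI allI lN f)
    fix n
    show "projective_module R (?P n)"
      using P(1) Q by (cases n) (auto simp: projective_resolution_def proj_imp_projective_module)
    show "?d n \<in> lmod_hom R (?P (Suc n)) (?P n)"
      using P(1) eps by (cases n) (auto simp: projective_resolution_def)
    show "?d (Suc n) ` carrier (?P (Suc (Suc n))) = {x \<in> carrier (?P (Suc n)). ?d n x = \<zero>\<^bsub>?P n\<^esub>}"
      using P(1) by (cases n) (auto simp: projective_resolution_def)
    show "?d 0 ` carrier (?P 1) = {x \<in> carrier (?P 0). f x = \<zero>\<^bsub>N\<^esub>}"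
      using P(1) by (auto simp: projective_resolution_def)
  qed (use f in auto)
  moreover have "length_at_most ?P (Suc l)"
    using P(2) by (auto simp: length_at_most_def split: nat.split)
  moreover have "\<forall>n. \<Phi> (?P n)" using P(3) \<Phi> by (auto split: nat.split)
  ultimately show ?case by blast
qed

lemma projective_resolution_iso:
  assumes P: "projective_resolution R N P d \<epsilon>" and L: "left_module R L" and h: "h \<in> lmod_iso R N L"
  shows "projective_resolution R L P d (\<lambda>x. h (\<epsilon> x))"
proof -
  have N: "left_module R N" and \<epsilon>: "\<epsilon> \<in> lmod_hom R (P 0) N" "\<epsilon> ` carrier (P 0) = carrier N"
    using P by (auto simp: projective_resolution_def)
  have h': "h \<in> lmod_hom R N L" "inj_on h (carrier N)" "h ` carrier N = carrier L"
    using h by (auto simp: lmod_iso_def bij_betw_def)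
  have h0: "h (\<epsilon> x) = \<zero>\<^bsub>L\<^esub> \<longleftrightarrow> \<epsilon> x = \<zero>\<^bsub>N\<^esub>" if "x \<in> carrier (P 0)" for x
    using h'(2) lmod_hom_inj_iff[OF N L h'(1)] lmod_hom_zero[OF N L h'(1)] lmod_hom_closed[OF \<epsilon>(1) that] by metis
  have "(\<lambda>x. h (\<epsilon> x)) ` carrier (P 0) = carrier L" using \<epsilon>(2) h'(3) by (simp add: image_image[symmetric])
  then show ?thesis
    using P L lmod_hom_comp[OF \<epsilon>(1) h'(1)] h0
    by (simp add: projective_resolution_def cong: conj_cong)
qed

lemma pdim_le_resolution:
  fixes N :: "('r, 't) module"
  assumes "pdim_le U R l N"
  shows "\<exists>(P :: nat \<Rightarrow> ('r, 'u) module) d \<epsilon>. projective_resolution R N P d \<epsilon> \<and> length_at_most P l"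
proof -
  obtain L :: "('r, 'u) module" and k where L: "pd R l L" "k \<in> lmod_iso R L N"
    using assms(1) by (auto simp: pdim_le_def)
  have "\<exists>(P :: nat \<Rightarrow> ('r, 'u) module) d \<epsilon>. projective_resolution R L P d \<epsilon> \<and> length_at_most P l \<and> (\<forall>n :: nat. True)"
  proof (rule pd_resolution[where \<Psi>="\<lambda>_. True" and \<Phi>="\<lambda>_. True"])
    fix N :: "('r, 'u) module" assume "left_module R N"
    then show "\<exists>(P :: ('r, 'u) module) f. proj R P \<and> f \<in> lmod_hom R P N \<and> f ` carrier P = carrier N \<and> True \<and> True"
      using enough_proj lepoll_U by metis
  qed (use L in auto)
  then show ?thesis using projective_resolution_iso[OF _ pdim_le_left_module[OF assms] L(2)] by blast
qed

text \<open>Where the syzygies are projective the complex breaks into split pieces, and sections of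
  the differentials assemble to a contracting homotopy. Unlike exactness, such a homotopy survives
  tensoring.\<close>

lemma resolution_contraction:
  fixes P :: "nat \<Rightarrow> ('r, 'u) module"
  assumes P: "projective_resolution R N P d \<epsilon>" and pd: "pdim_le U R l N"
  obtains h where "\<And>q. q > l \<Longrightarrow> h q \<in> lmod_hom R (P q) (P (Suc q))"
    "\<And>q x. \<lbrakk>q > l; x \<in> carrier (P (Suc q))\<rbrakk> \<Longrightarrow> d (Suc q) (h (Suc q) x) \<oplus>\<^bsub>P (Suc q)\<^esub> h q (d q x) = x"
proof -
  have N: "left_module R N" and proj: "\<And>n. proj R (P n)"
    and \<epsilon>: "\<epsilon> \<in> lmod_hom R (P 0) N" "\<epsilon> ` carrier (P 0) = carrier N"
    and d: "\<And>n. d n \<in> lmod_hom R (P (Suc n)) (P n)"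
    and ex0: "d 0 ` carrier (P 1) = {x \<in> carrier (P 0). \<epsilon> x = \<zero>\<^bsub>N\<^esub>}"
    and ex: "\<And>n. d (Suc n) ` carrier (P (Suc (Suc n))) = {x \<in> carrier (P (Suc n)). d n x = \<zero>\<^bsub>P n\<^esub>}"
    using P by (auto simp: projective_resolution_def projective_module_imp_proj)
  note lP = proj_left_module[OF proj]
  \<comment> \<open>The image of \<open>d n\<close> sits in degree \<open>n\<close> and is the
    kernel of the preceding map, that is, the syzygy number \<open>n + 1\<close>.\<close>
  define Z where "Z n = P n\<lparr>carrier := d n ` carrier (P (Suc n))\<rparr>" for n
  have lZ: "left_module R (Z n)" for n unfolding Z_def by (rule lmod_image[OF lP lP d])
  have dZ: "d n \<in> lmod_hom R (P (Suc n)) (Z n)" "d n ` carrier (P (Suc n)) = carrier (Z n)" for n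
    using d[of n] by (auto simp: Z_def lmod_hom_def)
  have kerd: "lmod_kernel (P (Suc n)) (Z n) (d n) = Z (Suc n)" for n
    using ex[of n] by (simp add: Z_def)
  \<comment> \<open>Truncated subtraction lets the same bound express projectivity from degree
    \<open>l\<close> on.\<close>
  have pdZ: "pdim_le U R (l - n) (Z n)" for n
  proof (induction n)
    case 0
    have "lmod_kernel (P 0) N \<epsilon> = Z 0" using ex0 by (simp add: Z_def)
    then have "ses R (Z 0) (\<lambda>x. x) (P 0) \<epsilon> N" using ses_kernel[OF lP N \<epsilon>] by simp
    then show ?case
      using pdim_le_kernel[OF _ proj lepoll_U pdim_le_mono[OF pd, of "Suc l"]] by simp
  next
    case (Suc n)
    have "ses R (Z (Suc n)) (\<lambda>x. x) (P (Suc n)) (d n) (Z n)"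
      using ses_kernel[OF lP lZ dZ, of n] by (simp add: kerd)
    moreover have "l - n \<le> Suc (l - Suc n)" by simp
    ultimately show ?case
      using pdim_le_kernel[OF _ proj lepoll_U pdim_le_mono[OF Suc]] by blast
  qed
  have projZ: "proj R (Z n)" if "n \<ge> l" for n
    using pdim_le_copy[OF pdZ[of n] lZ[of n], where h="\<lambda>x. x"] that by (simp add: lmod_iso_def lmod_hom_id bij_betw_def inj_on_def)
  have "\<exists>s. s \<in> lmod_hom R (Z n) (P (Suc n)) \<and> (\<forall>x \<in> carrier (Z n). d n (s x) = x)" if "n \<ge> l" for n
    using proj_lift[OF projZ[OF that] lP lZ dZ lmod_hom_id] by metis
  then obtain s where s: "\<And>n. n \<ge> l \<Longrightarrow> s n \<in> lmod_hom R (Z n) (P (Suc n))"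
    "\<And>n x. \<lbrakk>n \<ge> l; x \<in> carrier (Z n)\<rbrakk> \<Longrightarrow> d n (s n x) = x" by metis
  \<comment> \<open>Remove from \<open>x\<close> the part seen by the differential, which leaves a
    cycle, and lift the cycle by the next section. The value at degree 0 is a filler: the homotopy
    is claimed above \<open>l\<close> only.\<close>
  define h where "h q = (case q of 0 \<Rightarrow> \<lambda>x. x | Suc p \<Rightarrow> \<lambda>x. s (Suc p) (x \<ominus>\<^bsub>P (Suc p)\<^esub> s p (d p x)))" for q
  have dc: "d p x \<in> carrier (Z p)" if "x \<in> carrier (P (Suc p))" for p x
    using dZ(2) that by auto
  have diff: "(\<lambda>x. x \<ominus>\<^bsub>P (Suc p)\<^esub> s p (d p x)) \<in> lmod_hom R (P (Suc p)) (Z (Suc p))" if p: "p \<ge> l" for p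
  proof -
    interpret P: left_module R "P p" by (rule lP)
    have hom: "(\<lambda>x. x \<ominus>\<^bsub>P (Suc p)\<^esub> s p (d p x)) \<in> lmod_hom R (P (Suc p)) (P (Suc p))"
      by (rule lmod_hom_diff[OF lP lP lmod_hom_id lmod_hom_comp[OF dZ(1) s(1)[OF p]]])
    have "x \<ominus>\<^bsub>P (Suc p)\<^esub> s p (d p x) \<in> carrier (Z (Suc p))" if x: "x \<in> carrier (P (Suc p))" for x
    proof -
      have sx: "s p (d p x) \<in> carrier (P (Suc p))" using lmod_hom_closed[OF s(1)[OF p] dc[OF x]] .
      have "d p (x \<ominus>\<^bsub>P (Suc p)\<^esub> s p (d p x)) = \<zero>\<^bsub>P p\<^esub>"
        unfolding lmod_hom_minus[OF lP lP d x sx] s(2)[OF p dc[OF x]]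
        using lmod_hom_closed[OF d x] by (simp add: a_minus_def P.N.r_neg)
      then show ?thesis using lmod_hom_closed[OF hom x] ex[of p] by (simp add: Z_def)
    qed
    then show ?thesis using hom by (auto simp: lmod_hom_def Z_def)
  qed
  show thesis
  proof (rule that)
    fix q assume "q > l"
    then obtain p where p: "q = Suc p" "p \<ge> l" by (cases q) auto
    show "h q \<in> lmod_hom R (P q) (P (Suc q))"
      using lmod_hom_comp[OF diff[OF p(2)] s(1)] p by (simp add: h_def)
  next
    fix q x assume q: "q > l" and x: "x \<in> carrier (P (Suc q))"
    then obtain p where p: "q = Suc p" "p \<ge> l" by (cases q) auto
    interpret P: left_module R "P (Suc q)" by (rule lP)
    have dx: "d q x \<in> carrier (P q)" using lmod_hom_closed[OF d x] .
    have "d p (d q x) = \<zero>\<^bsub>P p\<^esub>" using ex[of p] x p by auto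
    moreover have "d q x \<ominus>\<^bsub>P q\<^esub> \<zero>\<^bsub>P q\<^esub> = d q x"
      using dx left_module.axioms(2)[OF lP, of q] by (metis abelian_group.minus_eq
          abelian_group.r_neg abelian_group.axioms(1) abelian_monoid.r_zero abelian_group.a_inv_closed
          abelian_monoid.l_zero abelian_monoid.zero_closed)
    \<comment> \<open>On a boundary the correction in \<open>h\<close> vanishes, because two
      consecutive differentials compose to zero.\<close>
    ultimately have 1: "h q (d q x) = s q (d q x)"
      using p lmod_hom_zero[OF lZ lP s(1)[OF p(2)]] by (simp add: h_def Z_def)
    have q': "q \<ge> l" using q by simp
    have sx: "s q (d q x) \<in> carrier (P (Suc q))" using lmod_hom_closed[OF s(1)[OF q'] dc[OF x]] .
    have 2: "d (Suc q) (h (Suc q) x) = x \<ominus>\<^bsub>P (Suc q)\<^esub> s q (d q x)"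
      using s(2)[OF _ lmod_hom_closed[OF diff[OF q'] x]] q' by (simp add: h_def)
    show "d (Suc q) (h (Suc q) x) \<oplus>\<^bsub>P (Suc q)\<^esub> h q (d q x) = x"
      unfolding 1 2 using x sx by (simp add: a_minus_def P.N.a_assoc P.N.l_neg)
  qed
qed

end

lemma left_global_dim_le:
  fixes R :: "('r, 'x) ring_scheme"
  assumes "big_type TYPE(('r, 'b) res_carrier) R"
    and "\<And>N :: ('r, 'b) module. left_module R N \<Longrightarrow> pdim_le TYPE(('r, 'b) res_carrier) R l N"
  shows "left_global_dim R TYPE('b) \<le> enat l"
  unfolding left_global_dim_def proj_dim_def
  using big_type.pdim_le_resolution[OF assms(1) assms(2)]
  by (intro SUP_least INF_lower) blast

section \<open>Vanishing of Tor\<close>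

text \<open>Closure of \<open>A\<close> is what keeps the defining relations inside the free abelian
  group on the pairs.\<close>

locale right_tensor = ring R for R :: "('r, 'x) ring_scheme" (structure) and A :: "('r, 'a) module" +
  assumes A_add: "\<And>x y. \<lbrakk>x \<in> carrier A; y \<in> carrier A\<rbrakk> \<Longrightarrow> x \<oplus>\<^bsub>A\<^esub> y \<in> carrier A"
    and A_smult: "\<And>r x. \<lbrakk>r \<in> carrier R; x \<in> carrier A\<rbrakk> \<Longrightarrow> r \<odot>\<^bsub>A\<^esub> x \<in> carrier A"
begin

abbreviation ambient :: "('r, 'b) module \<Rightarrow> ('a \<times> 'b \<Rightarrow>\<^sub>0 int) monoid" where
  "ambient B \<equiv> free_Abelian_group (carrier A \<times> carrier B)"

text \<open>Tensoring with \<open>h\<close> on formal sums, before passing to cosets.\<close>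

abbreviation lift_map :: "('b \<Rightarrow> 'c) \<Rightarrow> ('a \<times> 'b \<Rightarrow>\<^sub>0 int) \<Rightarrow> ('a \<times> 'c \<Rightarrow>\<^sub>0 int)" where
  "lift_map h \<equiv> frag_extend (\<lambda>(a, b). frag_of (a, h b))"

lemma relations_closed:
  assumes "left_module R B"
  shows "tensor_relations R A B \<subseteq> carrier (ambient B)"
proof -
  interpret B: left_module R B by fact
  have "frag_of (x, y) \<in> carrier (ambient B)" if "x \<in> carrier A" "y \<in> carrier B" for x y
    using that by simp
  moreover have "u - v \<in> carrier (ambient B)" if "u \<in> carrier (ambient B)" "v \<in> carrier (ambient B)" for u v
    using that keys_diff[of u v] by auto
  ultimately show ?thesis
    unfolding tensor_relations_def by (auto simp: A_add A_smult B.smult_closed simp del: carrier_free_Abelian_group_iff)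
qed

lemma kernel_subgroup:
  assumes "left_module R B"
  shows "subgroup (tensor_kernel R A B) (ambient B)"
  unfolding tensor_kernel_def
  by (rule group.generate_is_subgroup[OF group_free_Abelian_group relations_closed[OF assms]])

lemma kernel_normal:
  assumes "left_module R B"
  shows "tensor_kernel R A B \<lhd> ambient B"
  using comm_group.normal_iff_subgroup[OF abelian_free_Abelian_group] kernel_subgroup[OF assms] by metis

lemma kernel_add:
  assumes "left_module R B" "x \<in> tensor_kernel R A B" "y \<in> tensor_kernel R A B"
  shows "x + y \<in> tensor_kernel R A B"
  using subgroup.m_closed[OF kernel_subgroup[OF assms(1)] assms(2,3)] by simp

lemma kernel_carrier:
  assumes "left_module R B" "x \<in> tensor_kernel R A B"
  shows "Poly_Mapping.keys x \<subseteq> carrier A \<times> carrier B"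
  using subgroup.mem_carrier[OF kernel_subgroup[OF assms(1)] assms(2)] by simp

lemma kernel_uminus:
  assumes "left_module R B" "x \<in> tensor_kernel R A B"
  shows "- x \<in> tensor_kernel R A B"
  using subgroup.m_inv_closed[OF kernel_subgroup[OF assms(1)] assms(2)] kernel_carrier[OF assms] by simp

lemma kernel_diff:
  assumes "left_module R B" "x \<in> tensor_kernel R A B" "y \<in> tensor_kernel R A B"
  shows "x - y \<in> tensor_kernel R A B"
  using kernel_add[OF assms(1,2) kernel_uminus[OF assms(1,3)]] by simp

lemma kernel_zero: "left_module R B \<Longrightarrow> 0 \<in> tensor_kernel R A B"
  using subgroup.one_closed[OF kernel_subgroup, of B] by simp

lemma kernel_add_right:
  assumes "a \<in> carrier A" "b \<in> carrier B" "b' \<in> carrier B"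
  shows "frag_of (a, b \<oplus>\<^bsub>B\<^esub> b') - frag_of (a, b) - frag_of (a, b') \<in> tensor_kernel R A B"
  unfolding tensor_kernel_def using assms
  by (intro generate.incl) (auto simp: tensor_relations_def)

lemma kernel_zero_right:
  assumes "left_module R B" "a \<in> carrier A"
  shows "frag_of (a, \<zero>\<^bsub>B\<^esub>) \<in> tensor_kernel R A B"
proof -
  interpret B: left_module R B by fact
  have "- (frag_of (a, \<zero>\<^bsub>B\<^esub>)) \<in> tensor_kernel R A B"
    using kernel_add_right[OF assms(2), of "\<zero>\<^bsub>B\<^esub>" B "\<zero>\<^bsub>B\<^esub>"] by simp
  then show ?thesis using kernel_uminus[OF assms(1)] by fastforce
qed

lemma lift_map_closed:
  assumes "h \<in> lmod_hom R B B'" "Poly_Mapping.keys c \<subseteq> carrier A \<times> carrier B"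
  shows "Poly_Mapping.keys (lift_map h c) \<subseteq> carrier A \<times> carrier B'"
  using assms(2)
proof (induction c rule: frag_induction)
  case (diff a b)
  then show ?case using keys_diff[of "lift_map h a" "lift_map h b"] by (auto simp: frag_extend_diff)
qed (use lmod_hom_closed[OF assms(1)] in auto)

text \<open>Each of the three kinds of defining relations goes to a relation of the same kind, and a
  homomorphism maps the generated subgroup along with its generators.\<close>

lemma lift_map_kernel:
  assumes B: "left_module R B" and B': "left_module R B'" and h: "h \<in> lmod_hom R B B'"
    and c: "c \<in> tensor_kernel R A B"
  shows "lift_map h c \<in> tensor_kernel R A B'"
proof -
  have sub: "group_hom (ambient B) (ambient B') (lift_map h)"
    by (intro group_hom.intro group_hom_axioms.intro homI group_free_Abelian_group)
      (use lift_map_closed[OF h] in \<open>simp_all add: frag_extend_add\<close>)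
  have "lift_map h c \<in> lift_map h ` generate (ambient B) (tensor_relations R A B)"
    using c by (simp add: tensor_kernel_def)
  also have "\<dots> = generate (ambient B') (lift_map h ` tensor_relations R A B)"
    by (rule group_hom.generate_img[OF sub relations_closed[OF B], symmetric])
  also have "\<dots> \<subseteq> tensor_kernel R A B'"
    unfolding tensor_kernel_def
  proof (rule group.mono_generate[OF group_free_Abelian_group])
    show "lift_map h ` tensor_relations R A B \<subseteq> tensor_relations R A B'"
    proof
      fix y assume "y \<in> lift_map h ` tensor_relations R A B"
      then obtain x where x: "x \<in> tensor_relations R A B" "y = lift_map h x" by auto
      from x(1)[unfolded tensor_relations_def] show "y \<in> tensor_relations R A B'"
      proof (elim UnE)
        assume "x \<in> {frag_of (a \<oplus>\<^bsub>A\<^esub> a', b) - frag_of (a, b) - frag_of (a', b) | a a' b.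
          a \<in> carrier A \<and> a' \<in> carrier A \<and> b \<in> carrier B}"
        then obtain a a' b where *: "x = frag_of (a \<oplus>\<^bsub>A\<^esub> a', b) - frag_of (a, b) - frag_of (a', b)"
          "a \<in> carrier A" "a' \<in> carrier A" "b \<in> carrier B" by blast
        show ?thesis unfolding tensor_relations_def
          by (rule UnI1, rule UnI1, rule CollectI, intro exI[of _ a] exI[of _ a'] exI[of _ "h b"])
            (use * x(2) lmod_hom_closed[OF h] in \<open>simp add: frag_extend_diff\<close>)
      next
        assume "x \<in> {frag_of (a, b \<oplus>\<^bsub>B\<^esub> b') - frag_of (a, b) - frag_of (a, b') | a b b'.
          a \<in> carrier A \<and> b \<in> carrier B \<and> b' \<in> carrier B}"
        then obtain a b b' where *: "x = frag_of (a, b \<oplus>\<^bsub>B\<^esub> b') - frag_of (a, b) - frag_of (a, b')"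
          "a \<in> carrier A" "b \<in> carrier B" "b' \<in> carrier B" by blast
        show ?thesis unfolding tensor_relations_def
          by (rule UnI1, rule UnI2, rule CollectI, intro exI[of _ a] exI[of _ "h b"] exI[of _ "h b'"])
            (use * x(2) lmod_hom_closed[OF h] in \<open>simp add: frag_extend_diff lmod_hom_add[OF h]\<close>)
      next
        assume "x \<in> {frag_of (r \<odot>\<^bsub>A\<^esub> a, b) - frag_of (a, r \<odot>\<^bsub>B\<^esub> b) | a r b.
          a \<in> carrier A \<and> r \<in> carrier R \<and> b \<in> carrier B}"
        then obtain a r b where *: "x = frag_of (r \<odot>\<^bsub>A\<^esub> a, b) - frag_of (a, r \<odot>\<^bsub>B\<^esub> b)"
          "a \<in> carrier A" "r \<in> carrier R" "b \<in> carrier B" by blast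
        show ?thesis unfolding tensor_relations_def
          by (rule UnI2, rule CollectI, intro exI[of _ a] exI[of _ r] exI[of _ "h b"])
            (use * x(2) lmod_hom_closed[OF h] in \<open>simp add: frag_extend_diff lmod_hom_smult[OF h]\<close>)
      qed
    qed
  qed
  finally show ?thesis .
qed

lemma coset_eq:
  assumes "left_module R B" "Poly_Mapping.keys x \<subseteq> carrier A \<times> carrier B"
    "Poly_Mapping.keys y \<subseteq> carrier A \<times> carrier B" "x - y \<in> tensor_kernel R A B"
  shows "tensor_kernel R A B #>\<^bsub>ambient B\<^esub> x = tensor_kernel R A B #>\<^bsub>ambient B\<^esub> y"
proof -
  have "x \<in> tensor_kernel R A B #>\<^bsub>ambient B\<^esub> y"
    unfolding r_coset_def using assms(4) by (auto intro!: bexI[of _ "x - y"])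
  from group.repr_independence[OF group_free_Abelian_group this _ kernel_subgroup[OF assms(1)]]
  show ?thesis using assms(3) by simp
qed

lemma coset_one_iff:
  assumes "left_module R B" "Poly_Mapping.keys x \<subseteq> carrier A \<times> carrier B"
  shows "tensor_kernel R A B #>\<^bsub>ambient B\<^esub> x = tensor_kernel R A B \<longleftrightarrow> x \<in> tensor_kernel R A B"
  using group.coset_join1[OF group_free_Abelian_group _ _ kernel_subgroup[OF assms(1)], of x]
    group.coset_join2[OF group_free_Abelian_group _ kernel_subgroup[OF assms(1)], of x] assms(2) by auto

lemma tensor_product_carrier:
  "carrier (tensor_product R A B) =
    (\<lambda>x. tensor_kernel R A B #>\<^bsub>ambient B\<^esub> x) ` {x. Poly_Mapping.keys x \<subseteq> carrier A \<times> carrier B}"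
  by (auto simp: tensor_product_def FactGroup_def RCOSETS_def)

lemma tensor_product_one: "\<one>\<^bsub>tensor_product R A B\<^esub> = tensor_kernel R A B"
  by (simp add: tensor_product_def FactGroup_def)

lemma tensor_product_group: "left_module R B \<Longrightarrow> group (tensor_product R A B)"
  unfolding tensor_product_def by (rule normal.factorgroup_is_group[OF kernel_normal])

text \<open>The union in \<open>tensor_map\<close> ranges over representatives of one coset. They
  all yield the same coset of the target, and there is at least one of them.\<close>

lemma tensor_map_coset:
  assumes B: "left_module R B" and B': "left_module R B'" and h: "h \<in> lmod_hom R B B'"
    and x: "Poly_Mapping.keys x \<subseteq> carrier A \<times> carrier B"
  shows "tensor_map R A B' h (tensor_kernel R A B #>\<^bsub>ambient B\<^esub> x) =
    tensor_kernel R A B' #>\<^bsub>ambient B'\<^esub> lift_map h x"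
proof -
  have eq: "tensor_kernel R A B' #>\<^bsub>ambient B'\<^esub> lift_map h c =
      tensor_kernel R A B' #>\<^bsub>ambient B'\<^esub> lift_map h x"
    if c: "c \<in> tensor_kernel R A B #>\<^bsub>ambient B\<^esub> x" for c
  proof -
    obtain k where k: "k \<in> tensor_kernel R A B" "c = k + x" using c by (auto simp: r_coset_def)
    have "Poly_Mapping.keys c \<subseteq> carrier A \<times> carrier B"
      using k x kernel_carrier[OF B k(1)] keys_add[of k x] by blast
    then show ?thesis
      using k lift_map_kernel[OF B B' h k(1)] x
      by (intro coset_eq[OF B'] lift_map_closed[OF h]) (auto simp: frag_extend_add)
  qed
  have ne: "x \<in> tensor_kernel R A B #>\<^bsub>ambient B\<^esub> x"
    by (rule group.rcos_self[OF group_free_Abelian_group _ kernel_subgroup[OF B]]) (use x in simp)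
  have "tensor_map R A B' h (tensor_kernel R A B #>\<^bsub>ambient B\<^esub> x) =
      (\<Union>c \<in> tensor_kernel R A B #>\<^bsub>ambient B\<^esub> x. tensor_kernel R A B' #>\<^bsub>ambient B'\<^esub> lift_map h x)"
    unfolding tensor_map_def by (rule SUP_cong) (use eq in simp_all)
  then show ?thesis using ne by blast
qed

lemma tensor_map_hom:
  assumes B: "left_module R B" and B': "left_module R B'" and h: "h \<in> lmod_hom R B B'"
  shows "tensor_map R A B' h \<in> hom (tensor_product R A B) (tensor_product R A B')"
proof (rule homI)
  fix u assume "u \<in> carrier (tensor_product R A B)"
  then show "tensor_map R A B' h u \<in> carrier (tensor_product R A B')"
    using lift_map_closed[OF h] by (auto simp: tensor_product_carrier tensor_map_coset[OF B B' h])
next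
  fix u v assume "u \<in> carrier (tensor_product R A B)" "v \<in> carrier (tensor_product R A B)"
  then obtain x y where x: "Poly_Mapping.keys x \<subseteq> carrier A \<times> carrier B" "u = tensor_kernel R A B #>\<^bsub>ambient B\<^esub> x"
    and y: "Poly_Mapping.keys y \<subseteq> carrier A \<times> carrier B" "v = tensor_kernel R A B #>\<^bsub>ambient B\<^esub> y"
    by (auto simp: tensor_product_carrier)
  have xy: "Poly_Mapping.keys (x + y) \<subseteq> carrier A \<times> carrier B" using keys_add[of x y] x y by blast
  have "u \<otimes>\<^bsub>tensor_product R A B\<^esub> v = tensor_kernel R A B #>\<^bsub>ambient B\<^esub> (x + y)"
    using normal.rcos_sum[OF kernel_normal[OF B], of x y] x y
    by (simp add: tensor_product_def FactGroup_def)
  moreover have "tensor_map R A B' h u \<otimes>\<^bsub>tensor_product R A B'\<^esub> tensor_map R A B' h v =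
      tensor_kernel R A B' #>\<^bsub>ambient B'\<^esub> (lift_map h x + lift_map h y)"
    using normal.rcos_sum[OF kernel_normal[OF B'], of "lift_map h x" "lift_map h y"] x y
      lift_map_closed[OF h x(1)] lift_map_closed[OF h y(1)]
    by (simp add: tensor_map_coset[OF B B' h]) (simp add: tensor_product_def FactGroup_def)
  ultimately show "tensor_map R A B' h (u \<otimes>\<^bsub>tensor_product R A B\<^esub> v) =
      tensor_map R A B' h u \<otimes>\<^bsub>tensor_product R A B'\<^esub> tensor_map R A B' h v"
    by (simp add: tensor_map_coset[OF B B' h xy] frag_extend_add)
qed

text \<open>Tensoring does not preserve exactness, but it preserves the identity
  \<open>homotopy\<close>, and this identity turns every cycle into a boundary.\<close>

lemma tensor_exact:
  assumes B: "left_module R B" "left_module R B'" "left_module R B''"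
    and d: "d \<in> lmod_hom R B B'" "d' \<in> lmod_hom R B' B''" and h: "h \<in> lmod_hom R B' B" "h' \<in> lmod_hom R B'' B'"
    and dd: "\<And>x. x \<in> carrier B \<Longrightarrow> d' (d x) = \<zero>\<^bsub>B''\<^esub>"
    and homotopy: "\<And>x. x \<in> carrier B' \<Longrightarrow> d (h x) \<oplus>\<^bsub>B'\<^esub> h' (d' x) = x"
  shows "tensor_map R A B' d ` carrier (tensor_product R A B) =
    kernel (tensor_product R A B') (tensor_product R A B'') (tensor_map R A B'' d')"
proof (intro equalityI subsetI)
  fix u assume "u \<in> tensor_map R A B' d ` carrier (tensor_product R A B)"
  then obtain x where x: "Poly_Mapping.keys x \<subseteq> carrier A \<times> carrier B"
    and u: "u = tensor_kernel R A B' #>\<^bsub>ambient B'\<^esub> lift_map d x"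
    by (auto simp: tensor_product_carrier tensor_map_coset[OF B(1,2) d(1)])
  have Tx: "Poly_Mapping.keys (lift_map d x) \<subseteq> carrier A \<times> carrier B'" by (rule lift_map_closed[OF d(1) x])
  have "lift_map d' (lift_map d x) \<in> tensor_kernel R A B''"
    using x
  proof (induction x rule: frag_induction)
    case (one x)
    then show ?case using dd kernel_zero_right[OF B(3)] by auto
  qed (auto simp: frag_extend_diff kernel_zero[OF B(3)] kernel_diff[OF B(3)])
  then show "u \<in> kernel (tensor_product R A B') (tensor_product R A B'') (tensor_map R A B'' d')"
    using Tx by (auto simp: kernel_def tensor_product_carrier tensor_product_one u
        tensor_map_coset[OF B(2,3) d(2)] coset_one_iff[OF B(3) lift_map_closed[OF d(2)]])
next
  fix u assume "u \<in> kernel (tensor_product R A B') (tensor_product R A B'') (tensor_map R A B'' d')"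
  then obtain x where x: "Poly_Mapping.keys x \<subseteq> carrier A \<times> carrier B'"
    and u: "u = tensor_kernel R A B' #>\<^bsub>ambient B'\<^esub> x"
    and "tensor_kernel R A B'' #>\<^bsub>ambient B''\<^esub> lift_map d' x = tensor_kernel R A B''"
    by (auto simp: kernel_def tensor_product_carrier tensor_product_one tensor_map_coset[OF B(2,3) d(2)])
  then have ker: "lift_map d' x \<in> tensor_kernel R A B''"
    using coset_one_iff[OF B(3) lift_map_closed[OF d(2) x]] by simp
  have hx: "Poly_Mapping.keys (lift_map h x) \<subseteq> carrier A \<times> carrier B" by (rule lift_map_closed[OF h(1) x])
  \<comment> \<open>On a pair this is the additivity relation in the second argument; formal sums
    follow because the kernel is closed under differences.\<close>
  have "lift_map d (lift_map h x) + lift_map h' (lift_map d' x) - x \<in> tensor_kernel R A B'"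
    using x
  proof (induction x rule: frag_induction)
    case (one y)
    obtain a b where y: "y = (a, b)" "a \<in> carrier A" "b \<in> carrier B'" using one by auto
    have "d (h b) \<in> carrier B'" "h' (d' b) \<in> carrier B'"
      using y d h by (auto intro!: lmod_hom_closed[of d R B B'] lmod_hom_closed[of h R B' B]
          lmod_hom_closed[of h' R B'' B'] lmod_hom_closed[of d' R B' B''])
    from kernel_uminus[OF B(2) kernel_add_right[OF y(2) this]]
    show ?case by (simp add: y(1) homotopy[OF y(3)] algebra_simps)
  next
    case (diff a b)
    from kernel_diff[OF B(2) diff] show ?case by (simp add: frag_extend_diff algebra_simps)
  qed (simp add: kernel_zero[OF B(2)])
  \<comment> \<open>For a cycle the second homotopy term is a relation, so \<open>x\<close> agrees
    with a boundary modulo relations.\<close>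
  from kernel_diff[OF B(2) this lift_map_kernel[OF B(3,2) h(2) ker]]
  have "lift_map d (lift_map h x) - x \<in> tensor_kernel R A B'" by simp
  then have "tensor_map R A B' d (tensor_kernel R A B #>\<^bsub>ambient B\<^esub> lift_map h x) = u"
    unfolding u tensor_map_coset[OF B(1,2) d(1) hx]
    by (intro coset_eq[OF B(2) lift_map_closed[OF d(1) hx] x])
  moreover have "tensor_kernel R A B #>\<^bsub>ambient B\<^esub> lift_map h x \<in> carrier (tensor_product R A B)"
    using hx by (auto simp: tensor_product_carrier)
  ultimately show "u \<in> tensor_map R A B' d ` carrier (tensor_product R A B)" by blast
qed

end

lemma (in group) trivial_group_Mod_self: "trivial_group (G Mod carrier G)"
proof -
  have "normal (carrier G) G" by (rule normal_self)
  then have "group (G Mod carrier G)" by (rule normal.factorgroup_is_group)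
  moreover have "carrier (G Mod carrier G) = {carrier G}"
    using coset_join2[OF _ subgroup_self] by (auto simp: FactGroup_def RCOSETS_def)
  ultimately show ?thesis by (auto simp: trivial_group_def FactGroup_def)
qed

text \<open>\<open>Tor\<close> computes with one resolution fixed by choice. A bounded resolution
  shows that a choice is possible, and the contraction works for whichever resolution was
  chosen.\<close>

lemma Tor_trivial:
  fixes R :: "('r, 'x) ring_scheme" and N :: "('r, 'b) module"
  assumes big: "big_type TYPE(('r, 'b) res_carrier) R" and A: "right_tensor R A"
    and pd: "pdim_le TYPE(('r, 'b) res_carrier) R l N" and q: "q > Suc l"
  shows "trivial_group (Tor R A N q)"
proof -
  interpret big_type R "TYPE(('r, 'b) res_carrier)" by (rule big)
  interpret right_tensor R A by (rule A)
  define Pd where "Pd = (SOME (P :: nat \<Rightarrow> ('r, ('r, 'b) res_carrier) module, d). \<exists>\<epsilon>. projective_resolution R N P d \<epsilon>)"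
  obtain P d where Pd': "Pd = (P, d)" by (cases Pd)
  have "case Pd of (P, d) \<Rightarrow> \<exists>\<epsilon>. projective_resolution R N P d \<epsilon>"
    unfolding Pd_def
  proof (rule someI_ex)
    show "\<exists>x. case x of (P :: nat \<Rightarrow> ('r, ('r, 'b) res_carrier) module, d) \<Rightarrow> \<exists>\<epsilon>. projective_resolution R N P d \<epsilon>"
      using pdim_le_resolution[OF pd] by auto
  qed
  then obtain \<epsilon> where P: "projective_resolution R N P d \<epsilon>" using Pd' by auto
  \<comment> \<open>Exactness in degree \<open>q = Suc p\<close> uses the homotopies in degrees
    \<open>p\<close> and \<open>Suc p\<close>; both have to lie above \<open>l\<close>.\<close>
  obtain p where p: "q = Suc p" "p > l" using q by (cases q) auto
  obtain h where h: "\<And>q. q > l \<Longrightarrow> h q \<in> lmod_hom R (P q) (P (Suc q))"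
    "\<And>q x. \<lbrakk>q > l; x \<in> carrier (P (Suc q))\<rbrakk> \<Longrightarrow> d (Suc q) (h (Suc q) x) \<oplus>\<^bsub>P (Suc q)\<^esub> h q (d q x) = x"
    using resolution_contraction[OF P pd] by metis
  have lP: "left_module R (P n)" and d: "d n \<in> lmod_hom R (P (Suc n)) (P n)" for n
    using P by (auto simp: projective_resolution_def projective_module_def)
  have dd: "d n (d (Suc n) x) = \<zero>\<^bsub>P n\<^esub>" if "x \<in> carrier (P (Suc (Suc n)))" for n x
    using P imageI[OF that, of "d (Suc n)"] by (auto simp: projective_resolution_def)
  let ?C = "\<lambda>n. tensor_product R A (P n)" and ?\<delta> = "\<lambda>n. tensor_map R A (P n) (d n)"
  have "?\<delta> (Suc p) ` carrier (?C (Suc (Suc p))) = kernel (?C (Suc p)) (?C p) (?\<delta> p)"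
    by (rule tensor_exact[OF lP lP lP d d h(1) h(1)]) (use p dd h(2) in auto)
  then have img: "?\<delta> q ` carrier (?C (Suc q)) = chain_cycles ?C ?\<delta> q" using p by simp
  have hom: "group_hom (?C (Suc p)) (?C p) (?\<delta> p)"
    by (intro group_hom.intro group_hom_axioms.intro tensor_product_group lP tensor_map_hom d)
  have "subgroup (chain_cycles ?C ?\<delta> q) (?C q)"
    using group_hom.subgroup_kernel[OF hom] p by simp
  then have "group ((?C q)\<lparr>carrier := chain_cycles ?C ?\<delta> q\<rparr>)"
    by (rule subgroup.subgroup_is_group[OF _ tensor_product_group[OF lP]])
  from group.trivial_group_Mod_self[OF this]
  have "trivial_group (chain_homology ?C ?\<delta> q)" by (simp add: chain_homology_def img)
  then show ?thesis
    unfolding Tor_def Let_def using Pd' by (simp add: Pd_def)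
qed

section \<open>The monoid ring\<close>

text \<open>Unlike \<open>frag_induction\<close>, this rule hands over the supports of both parts of
  a difference, which the facts about \<open>flift\<close> ask for.\<close>

lemmas frag_support_induct [consumes 1, case_names zero diff of] = free_Abelian_group_induct

text \<open>The universal property of the free abelian group as a function. It is the counterpart of
  \<open>frag_extend\<close> for an arbitrary additive target; nothing is fixed for sums that are
  not supported in \<open>S\<close>.\<close>

definition flift :: "'s set \<Rightarrow> ('a, 'z) ring_scheme \<Rightarrow> ('s \<Rightarrow> 'a) \<Rightarrow> ('s \<Rightarrow>\<^sub>0 int) \<Rightarrow> 'a" where
  "flift S N u = (SOME k. k \<in> hom (free_Abelian_group S) (add_monoid N) \<and> (\<forall>s \<in> S. k (frag_of s) = u s))"

locale free_lift = abelian_group N for N :: "('a, 'z) ring_scheme" (structure) +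
  fixes S :: "'s set" and u :: "'s \<Rightarrow> 'a"
  assumes u_closed: "s \<in> S \<Longrightarrow> u s \<in> carrier N"
begin

lemma hom: "flift S N u \<in> hom (free_Abelian_group S) (add_monoid N)"
  and of: "s \<in> S \<Longrightarrow> flift S N u (frag_of s) = u s"
proof -
  obtain k where "k \<in> hom (free_Abelian_group S) (add_monoid N)" "\<And>s. s \<in> S \<Longrightarrow> k (frag_of s) = u s"
    by (rule comm_group.free_Abelian_group_universal[OF a_comm_group, of u S]) (use u_closed in auto)
  then have "\<exists>k. k \<in> hom (free_Abelian_group S) (add_monoid N) \<and> (\<forall>s \<in> S. k (frag_of s) = u s)" by auto
  then have "flift S N u \<in> hom (free_Abelian_group S) (add_monoid N) \<and> (\<forall>s \<in> S. flift S N u (frag_of s) = u s)"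
    unfolding flift_def by (rule someI_ex)
  then show "flift S N u \<in> hom (free_Abelian_group S) (add_monoid N)"
    and "s \<in> S \<Longrightarrow> flift S N u (frag_of s) = u s" by blast+
qed

lemma closed: "Poly_Mapping.keys a \<subseteq> S \<Longrightarrow> flift S N u a \<in> carrier N"
  using hom by (auto simp: hom_def Pi_iff)

lemma add:
  "\<lbrakk>Poly_Mapping.keys a \<subseteq> S; Poly_Mapping.keys b \<subseteq> S\<rbrakk> \<Longrightarrow>
    flift S N u (a + b) = flift S N u a \<oplus> flift S N u b"
  using hom by (auto simp: hom_def)

lemma zero: "flift S N u 0 = \<zero>"
  using add[of 0 0] closed[of 0] by (simp add: add.l_cancel_one')

lemma diff:
  assumes "Poly_Mapping.keys a \<subseteq> S" "Poly_Mapping.keys b \<subseteq> S"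
  shows "flift S N u (a - b) = flift S N u a \<ominus> flift S N u b"
proof -
  have ab: "Poly_Mapping.keys (a - b) \<subseteq> S" using assms keys_diff[of a b] by blast
  have "flift S N u a = flift S N u (a - b) \<oplus> flift S N u b"
    using add[OF ab assms(2)] by simp
  then show ?thesis
    using closed[OF ab] closed[OF assms(2)] by (simp add: a_minus_def a_assoc r_neg)
qed

end

lemma (in abelian_group) additive_minus:
  assumes "abelian_group L" and closed: "\<And>x. x \<in> carrier G \<Longrightarrow> h x \<in> carrier L"
    and add: "\<And>x y. \<lbrakk>x \<in> carrier G; y \<in> carrier G\<rbrakk> \<Longrightarrow> h (x \<oplus> y) = h x \<oplus>\<^bsub>L\<^esub> h y"
    and "x \<in> carrier G" "y \<in> carrier G"
  shows "h (x \<ominus> y) = h x \<ominus>\<^bsub>L\<^esub> h y"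
proof -
  interpret L: abelian_group L by fact
  have "h x = h (x \<ominus> y) \<oplus>\<^bsub>L\<^esub> h y"
    using assms(4,5) by (simp add: a_minus_def a_assoc l_neg flip: add)
  then show ?thesis
    using assms(4,5) closed by (simp add: a_minus_def L.a_assoc L.r_neg)
qed

lemma (in abelian_group) additive_zero:
  assumes "abelian_group L" and closed: "\<And>x. x \<in> carrier G \<Longrightarrow> h x \<in> carrier L"
    and add: "\<And>x y. \<lbrakk>x \<in> carrier G; y \<in> carrier G\<rbrakk> \<Longrightarrow> h (x \<oplus> y) = h x \<oplus>\<^bsub>L\<^esub> h y"
  shows "h \<zero> = \<zero>\<^bsub>L\<^esub>"
proof -
  interpret L: abelian_group L by fact
  show ?thesis using add[of \<zero> \<zero>] closed[of \<zero>] by (simp add: L.add.l_cancel_one')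
qed

lemma (in abelian_group) minus_add_minus:
  "\<lbrakk>a \<in> carrier G; b \<in> carrier G; c \<in> carrier G; d \<in> carrier G\<rbrakk> \<Longrightarrow>
    (a \<oplus> b) \<ominus> (c \<oplus> d) = (a \<ominus> c) \<oplus> (b \<ominus> d)"
  by (simp add: a_minus_def minus_add a_ac)

locale monoid_ring = monoid M for M :: "'m monoid" (structure)
begin

abbreviation ZM :: "('m \<Rightarrow>\<^sub>0 int) ring" where "ZM \<equiv> int_monoid_ring M"

lemma ZM_simps [simp]:
  "carrier ZM = {f. Poly_Mapping.keys f \<subseteq> carrier M}" "\<zero>\<^bsub>ZM\<^esub> = 0" "\<one>\<^bsub>ZM\<^esub> = frag_of \<one>" "f \<oplus>\<^bsub>ZM\<^esub> g = f + g"
  by (auto simp: int_monoid_ring_def)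

lemma ZM_mult: "f \<otimes>\<^bsub>ZM\<^esub> g = frag_extend (\<lambda>x. frag_extend (\<lambda>y. frag_of (x \<otimes> y)) g) f"
  by (simp add: int_monoid_ring_def)

lemma ZM_mult_of [simp]: "frag_of x \<otimes>\<^bsub>ZM\<^esub> frag_of y = frag_of (x \<otimes> y)"
  by (simp add: ZM_mult)

lemma ZM_mult_diff_left: "(f - f') \<otimes>\<^bsub>ZM\<^esub> g = f \<otimes>\<^bsub>ZM\<^esub> g - f' \<otimes>\<^bsub>ZM\<^esub> g"
  and ZM_mult_add_left: "(f + f') \<otimes>\<^bsub>ZM\<^esub> g = f \<otimes>\<^bsub>ZM\<^esub> g + f' \<otimes>\<^bsub>ZM\<^esub> g"
  and ZM_mult_zero_left: "0 \<otimes>\<^bsub>ZM\<^esub> g = 0"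
  by (simp_all add: ZM_mult frag_extend_diff frag_extend_add)

lemma ZM_mult_add_right: "f \<otimes>\<^bsub>ZM\<^esub> (g + g') = f \<otimes>\<^bsub>ZM\<^esub> g + f \<otimes>\<^bsub>ZM\<^esub> g'"
proof -
  have "Poly_Mapping.keys f \<subseteq> UNIV" by simp
  then show ?thesis
  proof (induction f rule: frag_induction)
    case (one x)
    then show ?case by (simp add: ZM_mult frag_extend_add)
  qed (simp_all add: ZM_mult_diff_left ZM_mult_zero_left)
qed

lemma ZM_mult_diff_right: "f \<otimes>\<^bsub>ZM\<^esub> (g - g') = f \<otimes>\<^bsub>ZM\<^esub> g - f \<otimes>\<^bsub>ZM\<^esub> g'"
  using ZM_mult_add_right[of f "g - g'" g'] by (simp add: algebra_simps)

lemma ZM_mult_zero_right: "f \<otimes>\<^bsub>ZM\<^esub> 0 = 0"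
  using ZM_mult_diff_right[of f 0 0] by simp

lemma ZM_diff_closed: "\<lbrakk>a \<in> carrier ZM; b \<in> carrier ZM\<rbrakk> \<Longrightarrow> a - b \<in> carrier ZM"
  using keys_diff[of a b] by auto

lemma ZM_of_closed: "m \<in> carrier M \<Longrightarrow> frag_of m \<in> carrier ZM"
  by simp

lemma ZM_mult_closed:
  assumes "f \<in> carrier ZM" "g \<in> carrier ZM"
  shows "f \<otimes>\<^bsub>ZM\<^esub> g \<in> carrier ZM"
proof -
  have 1: "frag_of x \<otimes>\<^bsub>ZM\<^esub> g \<in> carrier ZM" if "x \<in> carrier M" for x
  proof -
    have "Poly_Mapping.keys g \<subseteq> carrier M" using assms by simp
    then show ?thesis
    proof (induction g rule: frag_induction)
      case (diff a b)
      then show ?case using ZM_diff_closed by (simp only: ZM_mult_diff_right)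
    qed (use that in \<open>simp_all add: ZM_mult_zero_right\<close>)
  qed
  have "Poly_Mapping.keys f \<subseteq> carrier M" using assms by simp
  then show ?thesis
  proof (induction f rule: frag_induction)
    case (diff a b)
    then show ?case using ZM_diff_closed by (simp only: ZM_mult_diff_left)
  next
    case (one x)
    then show ?case by (rule 1)
  qed (simp_all add: ZM_mult_zero_left)
qed

lemma ZM_mult_assoc:
  assumes "f \<in> carrier ZM" "g \<in> carrier ZM" "h \<in> carrier ZM"
  shows "(f \<otimes>\<^bsub>ZM\<^esub> g) \<otimes>\<^bsub>ZM\<^esub> h = f \<otimes>\<^bsub>ZM\<^esub> (g \<otimes>\<^bsub>ZM\<^esub> h)"
proof -
  have 1: "frag_of (x \<otimes> y) \<otimes>\<^bsub>ZM\<^esub> h = frag_of x \<otimes>\<^bsub>ZM\<^esub> (frag_of y \<otimes>\<^bsub>ZM\<^esub> h)"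
    if "x \<in> carrier M" "y \<in> carrier M" for x y
  proof -
    have "Poly_Mapping.keys h \<subseteq> carrier M" using assms by simp
    then show ?thesis
      by (induction h rule: frag_induction) (use that in \<open>simp_all add: ZM_mult_zero_right ZM_mult_diff_right m_assoc\<close>)
  qed
  have 2: "(frag_of x \<otimes>\<^bsub>ZM\<^esub> g) \<otimes>\<^bsub>ZM\<^esub> h = frag_of x \<otimes>\<^bsub>ZM\<^esub> (g \<otimes>\<^bsub>ZM\<^esub> h)" if "x \<in> carrier M" for x
  proof -
    have "Poly_Mapping.keys g \<subseteq> carrier M" using assms by simp
    then show ?thesis
      by (induction g rule: frag_induction)
        (use that in \<open>simp_all add: ZM_mult_zero_right ZM_mult_zero_left ZM_mult_diff_right ZM_mult_diff_left 1\<close>)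
  qed
  have "Poly_Mapping.keys f \<subseteq> carrier M" using assms by simp
  then show ?thesis
    by (induction f rule: frag_induction) (simp_all add: ZM_mult_zero_left ZM_mult_diff_left 2)
qed

lemma ring_ZM: "ring ZM"
proof (rule ringI)
  show "abelian_group ZM"
  proof (rule abelian_groupI)
    fix x assume "x \<in> carrier ZM"
    then show "\<exists>y \<in> carrier ZM. y \<oplus>\<^bsub>ZM\<^esub> x = \<zero>\<^bsub>ZM\<^esub>" by (intro bexI[of _ "- x"]) auto
  qed (auto dest!: keys_add[THEN subsetD] simp: add.assoc add.commute)
  have one: "frag_of \<one> \<otimes>\<^bsub>ZM\<^esub> f = f" "f \<otimes>\<^bsub>ZM\<^esub> frag_of \<one> = f" if "Poly_Mapping.keys f \<subseteq> carrier M" for f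
    using that by (induction f rule: frag_induction)
      (simp_all add: ZM_mult_zero_left ZM_mult_zero_right ZM_mult_diff_left ZM_mult_diff_right)
  show "monoid ZM"
    by (rule monoidI) (use ZM_mult_closed ZM_mult_assoc one in auto)
qed (simp_all add: ZM_mult_add_left ZM_mult_add_right)

lemma big_type_ZM: "big_type TYPE(('m \<Rightarrow>\<^sub>0 int, 'b) res_carrier) ZM"
proof (intro big_type.intro big_type_axioms.intro ring_ZM)
  show "infinite (UNIV :: ('m \<Rightarrow>\<^sub>0 int, 'b) res_carrier set)" by (rule infinite_UNIV_listI)
  have "inj (\<lambda>r :: 'm \<Rightarrow>\<^sub>0 int. [Inl r :: ('m \<Rightarrow>\<^sub>0 int) + 'b])" by (rule injI) simp
  then show "(UNIV :: ('m \<Rightarrow>\<^sub>0 int) set) \<lesssim> (UNIV :: ('m \<Rightarrow>\<^sub>0 int, 'b) res_carrier set)"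
    unfolding lepoll_def by blast
qed

end

section \<open>Modules over the monoid ring as abelian groups with an action\<close>

locale ZM_module = monoid_ring M + left_module "int_monoid_ring M" N
  for M :: "'m monoid" (structure) and N :: "('m \<Rightarrow>\<^sub>0 int, 'a) module"
begin

definition act :: "'m \<Rightarrow> 'a \<Rightarrow> 'a" where "act m x = frag_of m \<odot>\<^bsub>N\<^esub> x"

lemma act_closed: "\<lbrakk>m \<in> carrier M; x \<in> carrier N\<rbrakk> \<Longrightarrow> act m x \<in> carrier N"
  unfolding act_def by (rule smult_closed) auto

lemma act_add: "\<lbrakk>m \<in> carrier M; x \<in> carrier N; y \<in> carrier N\<rbrakk> \<Longrightarrow> act m (x \<oplus>\<^bsub>N\<^esub> y) = act m x \<oplus>\<^bsub>N\<^esub> act m y"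
  unfolding act_def by (rule smult_r_distr) auto

lemma act_minus: "\<lbrakk>m \<in> carrier M; x \<in> carrier N; y \<in> carrier N\<rbrakk> \<Longrightarrow> act m (x \<ominus>\<^bsub>N\<^esub> y) = act m x \<ominus>\<^bsub>N\<^esub> act m y"
  unfolding act_def by (rule smult_r_minus) auto

lemma act_zero: "m \<in> carrier M \<Longrightarrow> act m \<zero>\<^bsub>N\<^esub> = \<zero>\<^bsub>N\<^esub>"
  unfolding act_def by (rule smult_r_zero) auto

lemma act_mult: "\<lbrakk>m \<in> carrier M; n \<in> carrier M; x \<in> carrier N\<rbrakk> \<Longrightarrow> act (m \<otimes> n) x = act m (act n x)"
  unfolding act_def using smult_assoc[of "frag_of m" "frag_of n" x] by simp

lemma act_one: "x \<in> carrier N \<Longrightarrow> act \<one> x = x"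
  unfolding act_def using smult_one by simp

lemma smult_l_diff:
  assumes "a \<in> carrier ZM" "b \<in> carrier ZM" "x \<in> carrier N"
  shows "(a - b) \<odot>\<^bsub>N\<^esub> x = a \<odot>\<^bsub>N\<^esub> x \<ominus>\<^bsub>N\<^esub> b \<odot>\<^bsub>N\<^esub> x"
proof -
  have "a \<odot>\<^bsub>N\<^esub> x = (a - b) \<odot>\<^bsub>N\<^esub> x \<oplus>\<^bsub>N\<^esub> b \<odot>\<^bsub>N\<^esub> x"
    using smult_l_distr[OF ZM_diff_closed[OF assms(1,2)] assms(2,3)] by simp
  then show ?thesis
    using smult_closed[OF ZM_diff_closed[OF assms(1,2)] assms(3)] smult_closed[OF assms(2,3)]
    by (simp add: a_minus_def N.a_assoc N.r_neg)
qed

end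

lemma ZM_moduleI: "\<lbrakk>monoid M; left_module (int_monoid_ring M) N\<rbrakk> \<Longrightarrow> ZM_module M N"
  by (simp add: ZM_module_def monoid_ring_def)

context monoid_ring begin

text \<open>Scalars are differences built from single monoid elements, so an additive map needs to
  be checked on the latter only.\<close>

lemma lmod_homI_act:
  assumes N: "left_module ZM N" and L: "left_module ZM L"
    and closed: "\<And>x. x \<in> carrier N \<Longrightarrow> h x \<in> carrier L"
    and add: "\<And>x y. \<lbrakk>x \<in> carrier N; y \<in> carrier N\<rbrakk> \<Longrightarrow> h (x \<oplus>\<^bsub>N\<^esub> y) = h x \<oplus>\<^bsub>L\<^esub> h y"
    and act: "\<And>m x. \<lbrakk>m \<in> carrier M; x \<in> carrier N\<rbrakk> \<Longrightarrow> h (frag_of m \<odot>\<^bsub>N\<^esub> x) = frag_of m \<odot>\<^bsub>L\<^esub> h x"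
  shows "h \<in> lmod_hom ZM N L"
proof (rule lmod_homI[OF closed add])
  fix a x assume a: "a \<in> carrier ZM" and x: "x \<in> carrier N"
  interpret N: ZM_module M N by (rule ZM_moduleI[OF monoid_axioms N])
  interpret L: ZM_module M L by (rule ZM_moduleI[OF monoid_axioms L])
  have "Poly_Mapping.keys a \<subseteq> carrier M" using a by simp
  then show "h (a \<odot>\<^bsub>N\<^esub> x) = a \<odot>\<^bsub>L\<^esub> h x"
  proof (induction a rule: frag_support_induct)
    case zero
    then show ?case
      using N.smult_l_zero[OF x] L.smult_l_zero[OF closed[OF x]]
        N.N.additive_zero[OF L.N.abelian_group_axioms closed add] by simp
  next
    case (diff a b)
    have ax: "a \<odot>\<^bsub>N\<^esub> x \<in> carrier N" "b \<odot>\<^bsub>N\<^esub> x \<in> carrier N" using diff x by (auto intro!: N.smult_closed)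
    have "h ((a - b) \<odot>\<^bsub>N\<^esub> x) = h (a \<odot>\<^bsub>N\<^esub> x \<ominus>\<^bsub>N\<^esub> b \<odot>\<^bsub>N\<^esub> x)" using N.smult_l_diff[of a b x] diff x by simp
    also have "\<dots> = h (a \<odot>\<^bsub>N\<^esub> x) \<ominus>\<^bsub>L\<^esub> h (b \<odot>\<^bsub>N\<^esub> x)"
      by (rule N.N.additive_minus[OF L.N.abelian_group_axioms closed add ax])
    also have "\<dots> = (a - b) \<odot>\<^bsub>L\<^esub> h x" using L.smult_l_diff[of a b "h x"] diff closed[OF x] by simp
    finally show ?case .
  next
    case (of m)
    then show ?case using act x by simp
  qed
qed

text \<open>An additive action of the monoid is extended to formal sums by letting \<open>r\<close>
  act on \<open>x\<close> through the lift of the orbit map of \<open>x\<close>.\<close>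

definition act_module :: "('a, 'z) ring_scheme \<Rightarrow> ('m \<Rightarrow> 'a \<Rightarrow> 'a) \<Rightarrow> ('m \<Rightarrow>\<^sub>0 int, 'a) module" where
  "act_module A \<alpha> =
     \<lparr>carrier = carrier A, monoid.mult = undefined, one = undefined, ring.zero = \<zero>\<^bsub>A\<^esub>, ring.add = (\<oplus>\<^bsub>A\<^esub>),
      smult = (\<lambda>r x. flift (carrier M) A (\<lambda>m. \<alpha> m x) r)\<rparr>"

lemma act_module_simps [simp]:
  "carrier (act_module A \<alpha>) = carrier A" "\<zero>\<^bsub>act_module A \<alpha>\<^esub> = \<zero>\<^bsub>A\<^esub>" "x \<oplus>\<^bsub>act_module A \<alpha>\<^esub> y = x \<oplus>\<^bsub>A\<^esub> y"
  by (simp_all add: act_module_def)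

lemma
  assumes A: "abelian_group A"
    and closed: "\<And>m x. \<lbrakk>m \<in> carrier M; x \<in> carrier A\<rbrakk> \<Longrightarrow> \<alpha> m x \<in> carrier A"
    and add: "\<And>m x y. \<lbrakk>m \<in> carrier M; x \<in> carrier A; y \<in> carrier A\<rbrakk> \<Longrightarrow> \<alpha> m (x \<oplus>\<^bsub>A\<^esub> y) = \<alpha> m x \<oplus>\<^bsub>A\<^esub> \<alpha> m y"
    and mult: "\<And>m n x. \<lbrakk>m \<in> carrier M; n \<in> carrier M; x \<in> carrier A\<rbrakk> \<Longrightarrow> \<alpha> (m \<otimes> n) x = \<alpha> m (\<alpha> n x)"
    and one: "\<And>x. x \<in> carrier A \<Longrightarrow> \<alpha> \<one> x = x"
  shows left_module_act_module: "left_module ZM (act_module A \<alpha>)"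
    and act_module_of: "\<lbrakk>m \<in> carrier M; x \<in> carrier A\<rbrakk> \<Longrightarrow> frag_of m \<odot>\<^bsub>act_module A \<alpha>\<^esub> x = \<alpha> m x"
proof -
  interpret A: abelian_group A by fact
  let ?k = "\<lambda>x. flift (carrier M) A (\<lambda>m. \<alpha> m x)"
  have fl: "free_lift A (carrier M) (\<lambda>m. \<alpha> m x)" if "x \<in> carrier A" for x
    by (intro free_lift.intro A free_lift_axioms.intro closed that)
  note fl' = free_lift.closed[OF fl] free_lift.of[OF fl] free_lift.diff[OF fl] free_lift.zero[OF fl] free_lift.add[OF fl]
  have am: "\<alpha> m (x \<ominus>\<^bsub>A\<^esub> y) = \<alpha> m x \<ominus>\<^bsub>A\<^esub> \<alpha> m y" if "m \<in> carrier M" "x \<in> carrier A" "y \<in> carrier A" for m x y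
    by (rule A.additive_minus[OF A]) (use that closed add in auto)
  have az: "\<alpha> m \<zero>\<^bsub>A\<^esub> = \<zero>\<^bsub>A\<^esub>" if "m \<in> carrier M" for m
    by (rule A.additive_zero[OF A]) (use that closed add in auto)
  have radd: "?k (x \<oplus>\<^bsub>A\<^esub> y) r = ?k x r \<oplus>\<^bsub>A\<^esub> ?k y r"
    if xy: "x \<in> carrier A" "y \<in> carrier A" and r: "Poly_Mapping.keys r \<subseteq> carrier M" for x y r
    using r
  proof (induction r rule: frag_support_induct)
    case (diff a b)
    then show ?case using xy by (simp add: fl' A.minus_add_minus)
  qed (use xy in \<open>simp_all add: fl' add\<close>)
  have as1: "?k x (frag_of m \<otimes>\<^bsub>ZM\<^esub> s) = \<alpha> m (?k x s)"
    if x: "x \<in> carrier A" and m: "m \<in> carrier M" and s: "Poly_Mapping.keys s \<subseteq> carrier M" for x m s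
    using s
  proof (induction s rule: frag_support_induct)
    case (diff a b)
    have "Poly_Mapping.keys (frag_of m \<otimes>\<^bsub>ZM\<^esub> a) \<subseteq> carrier M" "Poly_Mapping.keys (frag_of m \<otimes>\<^bsub>ZM\<^esub> b) \<subseteq> carrier M"
      using ZM_mult_closed[of "frag_of m" a] ZM_mult_closed[of "frag_of m" b] m diff by auto
    then show ?case using diff x m by (simp add: ZM_mult_diff_right fl' am)
  qed (use x m in \<open>simp_all add: ZM_mult_zero_right fl' az mult\<close>)
  have as: "?k x (r \<otimes>\<^bsub>ZM\<^esub> s) = ?k (?k x s) r"
    if x: "x \<in> carrier A" and r: "Poly_Mapping.keys r \<subseteq> carrier M" and s: "Poly_Mapping.keys s \<subseteq> carrier M" for x r s
    using r
  proof (induction r rule: frag_support_induct)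
    case (diff a b)
    have "Poly_Mapping.keys (a \<otimes>\<^bsub>ZM\<^esub> s) \<subseteq> carrier M" "Poly_Mapping.keys (b \<otimes>\<^bsub>ZM\<^esub> s) \<subseteq> carrier M"
      using ZM_mult_closed[of a s] ZM_mult_closed[of b s] s diff by auto
    then show ?case using diff x s by (simp add: ZM_mult_diff_left fl')
  qed (use x s in \<open>simp_all add: ZM_mult_zero_left fl' as1\<close>)
  show "left_module ZM (act_module A \<alpha>)"
    by (rule left_moduleI)
      (auto simp: ring_ZM act_module_def fl' radd as one A.a_ac)
  show "\<lbrakk>m \<in> carrier M; x \<in> carrier A\<rbrakk> \<Longrightarrow> frag_of m \<odot>\<^bsub>act_module A \<alpha>\<^esub> x = \<alpha> m x"
    by (simp add: act_module_def fl')
qed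

end

text \<open>The group \<open>free_Abelian_group S\<close>, written additively in a ring record so
  that it can serve as a coefficient group.\<close>

definition free_ab :: "'s set \<Rightarrow> ('s \<Rightarrow>\<^sub>0 int) ring" where
  "free_ab S = \<lparr>carrier = {c. Poly_Mapping.keys c \<subseteq> S}, monoid.mult = undefined, one = undefined,
     ring.zero = 0, ring.add = (+)\<rparr>"

lemma free_ab_simps [simp]:
  "carrier (free_ab S) = {c. Poly_Mapping.keys c \<subseteq> S}" "\<zero>\<^bsub>free_ab S\<^esub> = 0" "x \<oplus>\<^bsub>free_ab S\<^esub> y = x + y"
  by (auto simp: free_ab_def)

lemma abelian_group_sub:
  assumes "abelian_group A" "H \<subseteq> carrier A" "\<zero>\<^bsub>A\<^esub> \<in> H"
    and diff: "\<And>x y. \<lbrakk>x \<in> H; y \<in> H\<rbrakk> \<Longrightarrow> x \<ominus>\<^bsub>A\<^esub> y \<in> H"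
  shows "abelian_group (A\<lparr>carrier := H\<rparr>)"
proof -
  interpret A: abelian_group A by fact
  have neg: "\<ominus>\<^bsub>A\<^esub> y \<in> H" if "y \<in> H" for y
    using diff[OF assms(3) that] that assms(2) by (simp add: a_minus_def subset_iff)
  have add: "x \<oplus>\<^bsub>A\<^esub> y \<in> H" if "x \<in> H" "y \<in> H" for x y
    using diff[OF that(1) neg[OF that(2)]] that assms(2) by (simp add: a_minus_def subset_iff)
  show ?thesis
  proof (rule abelian_groupI)
    fix x assume "x \<in> carrier (A\<lparr>carrier := H\<rparr>)"
    then show "\<exists>y \<in> carrier (A\<lparr>carrier := H\<rparr>). y \<oplus>\<^bsub>A\<lparr>carrier := H\<rparr>\<^esub> x = \<zero>\<^bsub>A\<lparr>carrier := H\<rparr>\<^esub>"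
      using neg[of x] assms(2) by (auto intro!: bexI[of _ "\<ominus>\<^bsub>A\<^esub> x"] simp: A.l_neg subset_iff)
  qed (use add assms(2,3) in \<open>auto simp: subset_iff A.a_ac\<close>)
qed

lemma abelian_group_free_ab: "abelian_group (free_ab S)"
proof (rule abelian_groupI)
  fix x assume "x \<in> carrier (free_ab S)"
  then show "\<exists>y \<in> carrier (free_ab S). y \<oplus>\<^bsub>free_ab S\<^esub> x = \<zero>\<^bsub>free_ab S\<^esub>" by (intro bexI[of _ "- x"]) auto
qed (auto dest!: keys_add[THEN subsetD] simp: add.assoc add.commute)

lemma free_ab_minus:
  assumes "x \<in> carrier (free_ab S)" "y \<in> carrier (free_ab S)"
  shows "x \<ominus>\<^bsub>free_ab S\<^esub> y = x - y"
proof -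
  interpret abelian_group "free_ab S" by (rule abelian_group_free_ab)
  have "\<ominus>\<^bsub>free_ab S\<^esub> y = - y" by (rule minus_equality) (use assms in auto)
  then show ?thesis by (simp add: a_minus_def)
qed

section \<open>Subgroups of free abelian groups\<close>

lemma subgroup_add_cmul:
  fixes H :: "('s \<Rightarrow>\<^sub>0 int) set"
  assumes "0 \<in> H" and diff: "\<And>x y. \<lbrakk>x \<in> H; y \<in> H\<rbrakk> \<Longrightarrow> x - y \<in> H"
  shows "\<lbrakk>x \<in> H; y \<in> H\<rbrakk> \<Longrightarrow> x + y \<in> H" and "x \<in> H \<Longrightarrow> frag_cmul q x \<in> H"
proof -
  have neg: "- y \<in> H" if "y \<in> H" for y using diff[OF assms(1) that] by simp
  have add: "x + y \<in> H" if "x \<in> H" "y \<in> H" for x y using diff[OF that(1) neg[OF that(2)]] by simp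
  then show "\<lbrakk>x \<in> H; y \<in> H\<rbrakk> \<Longrightarrow> x + y \<in> H" .
  assume x: "x \<in> H"
  have nat: "frag_cmul (int n) x \<in> H" for n
    by (induction n) (use assms(1) x add in \<open>auto simp: frag_cmul_distrib\<close>)
  show "frag_cmul q x \<in> H"
  proof (cases "q \<ge> 0")
    case True
    then show ?thesis using nat[of "nat q"] by simp
  next
    case False
    then show ?thesis using neg[OF nat[of "nat (- q)"]] by simp
  qed
qed

text \<open>Dedekind's theorem.  For a well-order of the basis, choose for every basis element \<open>s\<close>
  an element of the subgroup with leading term at \<open>s\<close> and leading coefficient of minimal absolute value.\<close>

lemma subgroup_free_abelian_basis:
  fixes H :: "('s \<Rightarrow>\<^sub>0 int) set"
  assumes zero: "0 \<in> H" and diff: "\<And>x y. \<lbrakk>x \<in> H; y \<in> H\<rbrakk> \<Longrightarrow> x - y \<in> H"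
  obtains B where "B \<subseteq> H" "bij_betw (frag_extend (\<lambda>b. b)) {x. Poly_Mapping.keys x \<subseteq> B} H"
    "\<And>S. \<lbrakk>finite S; \<And>x. x \<in> H \<Longrightarrow> Poly_Mapping.keys x \<subseteq> S\<rbrakk> \<Longrightarrow> finite B"
proof -
  note add = subgroup_add_cmul(1)[of H, OF zero diff] and cmul = subgroup_add_cmul(2)[of H, OF zero diff]
  obtain r :: "'s rel" where r: "well_order_on UNIV r" using well_order_on by blast
  define lt where "lt s t \<longleftrightarrow> (s, t) \<in> r - Id" for s t
  have "{(s, t). lt s t} = r - Id" by (auto simp: lt_def)
  then have wf: "wfP lt" using r by (simp add: wfp_def well_order_on_def)
  have tr: "trans (r - Id)"
    using r by (intro trans_diff_Id) (auto simp: well_order_on_def linear_order_on_def partial_order_on_def preorder_on_def)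
  have trans: "lt s u" if "lt s t" "lt t u" for s t u using tr that by (auto simp: lt_def elim: transE)
  have irr: "\<not> lt s s" for s by (simp add: lt_def)
  have tot: "lt s t \<or> s = t \<or> lt t s" for s t
    using r by (auto simp: lt_def well_order_on_def linear_order_on_def total_on_def)
  have max: "\<exists>m \<in> K. \<forall>t \<in> K. \<not> lt m t" if "finite K" "K \<noteq> {}" for K
    using that
  proof (induction K rule: finite_ne_induct)
    case (insert x F)
    then obtain m where m: "m \<in> F" "\<forall>t \<in> F. \<not> lt m t" by blast
    show ?case
    proof (cases "lt m x")
      case True
      have "\<not> lt x t" if "t \<in> insert x F" for t using that m(2) True trans irr by blast
      then show ?thesis by blast
    next
      case False
      then show ?thesis using m by blast
    qed
  qed (use irr in auto)
  \<comment> \<open>The elements of the subgroup with no key above \<open>s\<close>. Their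
    coefficients at \<open>s\<close> form an ideal of the integers, and \<open>S'\<close> collects
    the positions where this ideal is nonzero.\<close>
  define D :: "'s \<Rightarrow> ('s \<Rightarrow>\<^sub>0 int) set" where "D s = {f \<in> H. \<forall>t \<in> Poly_Mapping.keys f. \<not> lt s t}" for s
  define S' where "S' = {s. \<exists>f \<in> D s. Poly_Mapping.lookup f s \<noteq> 0}"
  \<comment> \<open>Minimal absolute value is how a generator of that ideal is found.\<close>
  have "\<exists>b. b \<in> D s \<and> Poly_Mapping.lookup b s \<noteq> 0 \<and> (\<forall>f \<in> D s. Poly_Mapping.lookup f s \<noteq> 0 \<longrightarrow> nat \<bar>Poly_Mapping.lookup b s\<bar> \<le> nat \<bar>Poly_Mapping.lookup f s\<bar>)"
    if s: "s \<in> S'" for s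
  proof -
    let ?Q = "\<lambda>f. f \<in> D s \<and> Poly_Mapping.lookup f s \<noteq> 0"
    obtain f where "?Q f" using s by (auto simp: S'_def)
    from arg_min_nat_lemma[of ?Q, OF this, of "\<lambda>f. nat \<bar>Poly_Mapping.lookup f s\<bar>"] show ?thesis by blast
  qed
  then obtain b where b: "\<And>s. s \<in> S' \<Longrightarrow> b s \<in> D s" "\<And>s. s \<in> S' \<Longrightarrow> Poly_Mapping.lookup (b s) s \<noteq> 0"
    and bmin: "\<And>s f. \<lbrakk>s \<in> S'; f \<in> D s; Poly_Mapping.lookup f s \<noteq> 0\<rbrakk> \<Longrightarrow> nat \<bar>Poly_Mapping.lookup (b s) s\<bar> \<le> nat \<bar>Poly_Mapping.lookup f s\<bar>"
    by metis
  define B where "B = b ` S'"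
  let ?E = "frag_extend (\<lambda>b :: 's \<Rightarrow>\<^sub>0 int. b)"
  have BH: "B \<subseteq> H" using b(1) by (auto simp: B_def D_def)
  have Dsub: "f - frag_cmul q g \<in> D s" if "f \<in> D s" "g \<in> D s" for f g q s
  proof -
    have "Poly_Mapping.keys (f - frag_cmul q g) \<subseteq> Poly_Mapping.keys f \<union> Poly_Mapping.keys g"
      using keys_diff[of f "frag_cmul q g"] keys_cmul[of q g] by blast
    then show ?thesis using that diff cmul by (auto simp: D_def)
  qed
  have EH: "?E x \<in> H" if "Poly_Mapping.keys x \<subseteq> B" for x
    using that by (induction x rule: frag_induction) (use zero diff BH in \<open>auto simp: frag_extend_diff\<close>)
  let ?X = "?E ` {x. Poly_Mapping.keys x \<subseteq> B}"
  have X0: "0 \<in> ?X" by (rule image_eqI[of _ _ 0]) auto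
  have Xd: "x - y \<in> ?X" if xy: "x \<in> ?X" "y \<in> ?X" for x y
  proof -
    obtain x' y' where "x = ?E x'" "y = ?E y'" "Poly_Mapping.keys x' \<subseteq> B" "Poly_Mapping.keys y' \<subseteq> B"
      using xy by auto
    then show ?thesis using keys_diff[of x' y'] by (intro image_eqI[of _ _ "x' - y'"]) (auto simp: frag_extend_diff)
  qed
  have Xb: "b s \<in> ?X" if "s \<in> S'" for s
    by (rule image_eqI[of _ _ "frag_of (b s)"]) (use that in \<open>auto simp: B_def\<close>)
  have key: "f \<in> D m \<and> Poly_Mapping.lookup f m \<noteq> 0 \<and> m \<in> S'" if "f \<in> H" "m \<in> Poly_Mapping.keys f" "\<forall>t \<in> Poly_Mapping.keys f. \<not> lt m t" for f m
    using that by (auto simp: D_def S'_def in_keys_iff)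
  have surjD: "f \<in> ?X" if "f \<in> D s" for f s
    using that
  proof (induction s arbitrary: f rule: wfp_induct_rule[OF wf])
    case (1 s)
    \<comment> \<open>Without a term at \<open>s\<close> the leading position lies strictly below
      \<open>s\<close>, where the induction hypothesis applies.\<close>
    have fin: "g \<in> ?X" if g: "g \<in> D s" "Poly_Mapping.lookup g s = 0" for g
    proof (cases "g = 0")
      case False
      then obtain m where m: "m \<in> Poly_Mapping.keys g" "\<forall>t \<in> Poly_Mapping.keys g. \<not> lt m t"
        using max[of "Poly_Mapping.keys g"] by auto
      have "lt m s" using tot[of m s] m(1) g by (auto simp: D_def in_keys_iff)
      moreover have "g \<in> D m" using key[OF _ m] g(1) by (auto simp: D_def)
      ultimately show ?thesis using 1 by blast
    qed (use X0 in simp)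
    show ?case
    proof (cases "s \<in> S'")
      case True
      \<comment> \<open>Division with remainder: subtracting \<open>q\<close> times
        \<open>b s\<close> leaves a coefficient smaller than that of \<open>b s\<close>, which by
        minimality is zero.\<close>
      define q where "q = Poly_Mapping.lookup f s div Poly_Mapping.lookup (b s) s"
      let ?g = "f - frag_cmul q (b s)"
      have gD: "?g \<in> D s" by (rule Dsub[OF 1(2) b(1)[OF True]])
      have gs: "Poly_Mapping.lookup ?g s = Poly_Mapping.lookup f s mod Poly_Mapping.lookup (b s) s"
        by (simp add: lookup_minus q_def minus_div_mult_eq_mod)
      have "Poly_Mapping.lookup ?g s = 0"
      proof (rule ccontr)
        assume "Poly_Mapping.lookup ?g s \<noteq> 0"
        from bmin[OF True gD this] show False
          using b(2)[OF True] abs_mod_less[of "Poly_Mapping.lookup (b s) s" "Poly_Mapping.lookup f s"] by (simp add: gs)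
      qed
      from Xd[OF fin[OF gD this] subgroup_add_cmul(2)[of ?X, OF X0 Xd Xb[OF True], of "- q"]]
      show ?thesis by (metis diff_add_cancel diff_minus_eq_add minus_frag_cmul)
    next
      case False
      then show ?thesis using fin[OF 1(2)] 1(2) by (auto simp: S'_def)
    qed
  qed
  have surj: "f \<in> ?X" if "f \<in> H" for f
  proof (cases "f = 0")
    case False
    then show ?thesis using max[of "Poly_Mapping.keys f"] key[OF that] surjD by auto
  qed (use X0 in simp)
  \<comment> \<open>In a relation among the chosen elements look at the greatest leading position
    \<open>m\<close> involved: only \<open>b m\<close> has a term there, so it cannot
    cancel.\<close>
  have ker: "x = 0" if x: "Poly_Mapping.keys x \<subseteq> B" "?E x = 0" for x
  proof (rule ccontr)
    assume "x \<noteq> 0"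
    let ?K = "{s \<in> S'. b s \<in> Poly_Mapping.keys x}"
    \<comment> \<open>The position \<open>s\<close> is the greatest key of \<open>b s\<close>, so
      distinct positions have distinct elements and only finitely many positions are
      involved.\<close>
    have binj: "s = t" if "s \<in> S'" "t \<in> S'" "b s = b t" for s t
      using b(1)[OF that(1)] b(2)[OF that(1)] b(1)[OF that(2)] b(2)[OF that(2)] that(3) tot[of s t]
      by (auto simp: D_def in_keys_iff)
    have "finite ?K"
      using finite_imageD[of b ?K] finite_subset[of "b ` ?K" "Poly_Mapping.keys x"] binj
      by (auto simp: inj_on_def)
    moreover have "?K \<noteq> {}"
    proof -
      have "Poly_Mapping.keys x \<noteq> {}" using \<open>x \<noteq> 0\<close> by simp
      then obtain c where c: "c \<in> Poly_Mapping.keys x" by blast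
      then have "c \<in> b ` S'" using x(1) by (auto simp: B_def)
      then show ?thesis using c by blast
    qed
    ultimately obtain m where m: "m \<in> S'" "b m \<in> Poly_Mapping.keys x" "\<forall>t \<in> ?K. \<not> lt m t"
      using max[of ?K] by auto
    have "Poly_Mapping.lookup (?E x) m = (\<Sum>c \<in> Poly_Mapping.keys x. Poly_Mapping.lookup x c * Poly_Mapping.lookup c m)"
      by (simp add: frag_extend_def lookup_sum)
    also have "\<dots> = (\<Sum>c \<in> Poly_Mapping.keys x. if c = b m then Poly_Mapping.lookup x c * Poly_Mapping.lookup c m else 0)"
    proof (rule sum.cong[OF refl])
      fix c assume c: "c \<in> Poly_Mapping.keys x"
      then obtain t where t: "t \<in> S'" "c = b t" using x(1) by (auto simp: B_def)
      have "Poly_Mapping.lookup c m = 0" if "c \<noteq> b m"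
      proof -
        have "lt t m" using tot[of t m] m(3) t c that by auto
        then show ?thesis using b(1)[OF t(1)] t(2) by (auto simp: D_def in_keys_iff)
      qed
      then show "Poly_Mapping.lookup x c * Poly_Mapping.lookup c m = (if c = b m then Poly_Mapping.lookup x c * Poly_Mapping.lookup c m else 0)" by auto
    qed
    also have "\<dots> = Poly_Mapping.lookup x (b m) * Poly_Mapping.lookup (b m) m" using m(2) by simp
    also have "\<dots> \<noteq> 0" using m(2) b(2)[OF m(1)] by (simp add: in_keys_iff)
    finally show False using x(2) by simp
  qed
  show thesis
  proof (rule that[OF BH])
    have "inj_on ?E {x. Poly_Mapping.keys x \<subseteq> B}"
    proof (rule inj_onI)
      fix x y assume xy: "x \<in> {x. Poly_Mapping.keys x \<subseteq> B}" "y \<in> {x. Poly_Mapping.keys x \<subseteq> B}" "?E x = ?E y"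
      then have "x - y = 0" using ker[of "x - y"] keys_diff[of x y] by (auto simp: frag_extend_diff)
      then show "x = y" by simp
    qed
    moreover have "?X = H" using surj EH by auto
    ultimately show "bij_betw ?E {x. Poly_Mapping.keys x \<subseteq> B} H" by (simp add: bij_betw_def)
  next
    fix S assume S: "finite S" "\<And>x. x \<in> H \<Longrightarrow> Poly_Mapping.keys x \<subseteq> S"
    \<comment> \<open>Every leading position is a key of some element of the subgroup.\<close>
    have "S' \<subseteq> S" using S(2) b by (force simp: D_def in_keys_iff)
    then show "finite B" using S(1) finite_subset by (auto simp: B_def)
  qed
qed

text \<open>The analogue of \<open>proj\<close> for abelian groups: evaluating formal sums of
  elements of \<open>A\<close> has an additive section. Over the integers this characterises the
  free groups, without naming a basis.\<close>

definition zproj :: "('a, 'z) ring_scheme \<Rightarrow> bool" where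
  "zproj A \<longleftrightarrow> abelian_group A \<and> (\<exists>c. (\<forall>a \<in> carrier A. Poly_Mapping.keys (c a) \<subseteq> carrier A \<and>
      flift (carrier A) A (\<lambda>x. x) (c a) = a) \<and>
    (\<forall>a \<in> carrier A. \<forall>b \<in> carrier A. c (a \<oplus>\<^bsub>A\<^esub> b) = c a + c b))"

lemma free_liftI: "\<lbrakk>abelian_group N; \<And>s. s \<in> S \<Longrightarrow> u s \<in> carrier N\<rbrakk> \<Longrightarrow> free_lift N S u"
  by (simp add: free_lift_def free_lift_axioms_def)

text \<open>As for \<open>proj_lift\<close>: choose preimages elementwise, extend them to formal
  sums, and precompose with the section. The map \<open>p\<close> has to reach the values of
  \<open>q\<close> only.\<close>

lemma zproj_lift:
  assumes A: "zproj A" and N: "abelian_group N" and L: "abelian_group L"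
    and p: "\<And>x. x \<in> carrier N \<Longrightarrow> p x \<in> carrier L"
      "\<And>x y. \<lbrakk>x \<in> carrier N; y \<in> carrier N\<rbrakk> \<Longrightarrow> p (x \<oplus>\<^bsub>N\<^esub> y) = p x \<oplus>\<^bsub>L\<^esub> p y"
    and q: "\<And>x. x \<in> carrier A \<Longrightarrow> q x \<in> carrier L"
      "\<And>x y. \<lbrakk>x \<in> carrier A; y \<in> carrier A\<rbrakk> \<Longrightarrow> q (x \<oplus>\<^bsub>A\<^esub> y) = q x \<oplus>\<^bsub>L\<^esub> q y"
    and ex: "\<And>a. a \<in> carrier A \<Longrightarrow> \<exists>n \<in> carrier N. p n = q a"
  obtains u where "\<And>a. a \<in> carrier A \<Longrightarrow> u a \<in> carrier N"
    "\<And>a b. \<lbrakk>a \<in> carrier A; b \<in> carrier A\<rbrakk> \<Longrightarrow> u (a \<oplus>\<^bsub>A\<^esub> b) = u a \<oplus>\<^bsub>N\<^esub> u b"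
    "\<And>a. a \<in> carrier A \<Longrightarrow> p (u a) = q a"
proof -
  interpret N: abelian_group N by fact
  interpret L: abelian_group L by fact
  have aA: "abelian_group A" using A by (simp add: zproj_def)
  interpret A: abelian_group A by fact
  obtain c where "\<forall>a \<in> carrier A. Poly_Mapping.keys (c a) \<subseteq> carrier A \<and> flift (carrier A) A (\<lambda>x. x) (c a) = a"
    "\<forall>a \<in> carrier A. \<forall>b \<in> carrier A. c (a \<oplus>\<^bsub>A\<^esub> b) = c a + c b"
    using A unfolding zproj_def by blast
  then have c: "\<And>a. a \<in> carrier A \<Longrightarrow> Poly_Mapping.keys (c a) \<subseteq> carrier A"
    "\<And>a. a \<in> carrier A \<Longrightarrow> flift (carrier A) A (\<lambda>x. x) (c a) = a"
    "\<And>a b. \<lbrakk>a \<in> carrier A; b \<in> carrier A\<rbrakk> \<Longrightarrow> c (a \<oplus>\<^bsub>A\<^esub> b) = c a + c b"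
    by blast+
  obtain v where v: "\<And>a. a \<in> carrier A \<Longrightarrow> v a \<in> carrier N" "\<And>a. a \<in> carrier A \<Longrightarrow> p (v a) = q a"
    using ex by metis
  interpret V: free_lift N "carrier A" v by (rule free_liftI) (use v N in auto)
  interpret I: free_lift A "carrier A" "\<lambda>x. x" by (rule free_liftI) (use aA in auto)
  have eq: "p (flift (carrier A) N v x) = q (flift (carrier A) A (\<lambda>x. x) x)" if "Poly_Mapping.keys x \<subseteq> carrier A" for x
    using that
  proof (induction x rule: frag_support_induct)
    case zero
    then show ?case
      using N.additive_zero[OF L p] A.additive_zero[OF L q] by (simp add: V.zero I.zero)
  next
    case (diff a b)
    then show ?case
      using N.additive_minus[OF L p, of "flift (carrier A) N v a" "flift (carrier A) N v b"]
        A.additive_minus[OF L q, of "flift (carrier A) A (\<lambda>x. x) a" "flift (carrier A) A (\<lambda>x. x) b"]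
      by (simp add: V.diff I.diff V.closed I.closed)
  next
    case (of a)
    then show ?case by (simp add: V.of I.of v)
  qed
  show thesis
  proof (rule that[of "\<lambda>a. flift (carrier A) N v (c a)"])
    fix a assume a: "a \<in> carrier A"
    show "flift (carrier A) N v (c a) \<in> carrier N" by (rule V.closed[OF c(1)[OF a]])
    show "p (flift (carrier A) N v (c a)) = q a" using eq[OF c(1)[OF a]] c(2)[OF a] by simp
    fix b assume b: "b \<in> carrier A"
    show "flift (carrier A) N v (c (a \<oplus>\<^bsub>A\<^esub> b)) = flift (carrier A) N v (c a) \<oplus>\<^bsub>N\<^esub> flift (carrier A) N v (c b)"
      using c(3)[OF a b] V.add[OF c(1)[OF a] c(1)[OF b]] by simp
  qed
qed

lemma zproj_subgroup_free:
  assumes H: "H \<subseteq> carrier (free_ab S)" "0 \<in> H" and diff: "\<And>x y. \<lbrakk>x \<in> H; y \<in> H\<rbrakk> \<Longrightarrow> x - y \<in> H"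
  shows "zproj (free_ab S\<lparr>carrier := H\<rparr>)"
proof -
  let ?A = "free_ab S\<lparr>carrier := H\<rparr>"
  let ?E = "frag_extend (\<lambda>b :: 'a \<Rightarrow>\<^sub>0 int. b)"
  have minus: "x \<ominus>\<^bsub>free_ab S\<^esub> y = x - y" if "x \<in> H" "y \<in> H" for x y
    using free_ab_minus[of x S y] H(1) that by blast
  have ab: "abelian_group ?A"
    by (rule abelian_group_sub[OF abelian_group_free_ab]) (use H diff minus in auto)
  interpret A: abelian_group ?A by fact
  obtain B where B: "B \<subseteq> H" "bij_betw ?E {x. Poly_Mapping.keys x \<subseteq> B} H"
    using subgroup_free_abelian_basis[of H] H(2) diff by metis
  \<comment> \<open>The coordinates of an element in the basis \<open>B\<close>, read as a formal
    sum of elements of the subgroup.\<close>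
  define c where "c = inv_into {x. Poly_Mapping.keys x \<subseteq> B} ?E"
  have c: "Poly_Mapping.keys (c a) \<subseteq> B" "?E (c a) = a" if "a \<in> H" for a
    using that B(2) inv_into_into[of a ?E "{x. Poly_Mapping.keys x \<subseteq> B}"] f_inv_into_f[of a ?E "{x. Poly_Mapping.keys x \<subseteq> B}"]
    by (auto simp: c_def bij_betw_def)
  have cu: "c a = x" if "Poly_Mapping.keys x \<subseteq> B" "?E x = a" for a x
    using that B(2) by (auto simp: c_def bij_betw_def)
  interpret I: free_lift ?A H "\<lambda>x. x" by (rule free_liftI[OF ab]) simp
  \<comment> \<open>The lift taken inside the subgroup agrees with \<open>frag_extend\<close>, so
    the inverse of the basis bijection is a section of the evaluation.\<close>
  have fl: "flift H ?A (\<lambda>x. x) x = ?E x" if "Poly_Mapping.keys x \<subseteq> H" for x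
    using that
  proof (induction x rule: frag_support_induct)
    case (diff x y)
    have k: "Poly_Mapping.keys (x - y) \<subseteq> H" using keys_diff[of x y] diff by blast
    have "?E x \<in> H" "?E y \<in> H" using I.closed[OF diff(1)] I.closed[OF diff(2)] diff by auto
    moreover have "flift H ?A (\<lambda>x. x) (x - y) \<oplus>\<^bsub>?A\<^esub> flift H ?A (\<lambda>x. x) y = flift H ?A (\<lambda>x. x) x"
      using I.add[of "x - y" y] diff k by simp
    ultimately show ?case using diff by (simp add: frag_extend_diff algebra_simps)
  qed (use I.zero I.of in auto)
  have "\<forall>a \<in> carrier ?A. Poly_Mapping.keys (c a) \<subseteq> carrier ?A \<and> flift (carrier ?A) ?A (\<lambda>x. x) (c a) = a"
  proof
    fix a assume "a \<in> carrier ?A"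
    then have a: "a \<in> H" by simp
    have "Poly_Mapping.keys (c a) \<subseteq> H" using c(1)[OF a] B(1) by blast
    then show "Poly_Mapping.keys (c a) \<subseteq> carrier ?A \<and> flift (carrier ?A) ?A (\<lambda>x. x) (c a) = a"
      using fl c(2)[OF a] by simp
  qed
  moreover have "\<forall>a \<in> carrier ?A. \<forall>b \<in> carrier ?A. c (a \<oplus>\<^bsub>?A\<^esub> b) = c a + c b"
  proof (intro ballI)
    fix a b assume "a \<in> carrier ?A" "b \<in> carrier ?A"
    then have ab: "a \<in> H" "b \<in> H" by auto
    have "Poly_Mapping.keys (c a + c b) \<subseteq> B"
      using c(1)[OF ab(1)] c(1)[OF ab(2)] keys_add[of "c a" "c b"] by blast
    then show "c (a \<oplus>\<^bsub>?A\<^esub> b) = c a + c b"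
      using c(2)[OF ab(1)] c(2)[OF ab(2)] by (intro cu) (simp_all add: frag_extend_add)
  qed
  ultimately show ?thesis unfolding zproj_def using ab by blast
qed

lemma zproj_free_ab: "zproj (free_ab S)"
proof -
  have "free_ab S\<lparr>carrier := carrier (free_ab S)\<rparr> = free_ab S" by (simp add: free_ab_def)
  then show ?thesis
    using zproj_subgroup_free[of "carrier (free_ab S)" S] keys_diff by (fastforce simp del: free_ab_simps(1) simp: free_ab_def)
qed

text \<open>Finite generation of the additive group rather than of the module. It passes to all
  subgroups, in particular to kernels of module maps, and it implies finite generation over the
  ring.\<close>

definition zfg :: "('a, 'z) ring_scheme \<Rightarrow> bool" where
  "zfg A \<longleftrightarrow> (\<exists>S. finite S \<and> S \<subseteq> carrier A \<and>
     carrier A \<subseteq> flift S A (\<lambda>x. x) ` {x. Poly_Mapping.keys x \<subseteq> S})"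

lemma zfgI:
  fixes k :: "('s \<Rightarrow>\<^sub>0 int) \<Rightarrow> 'a"
  assumes A: "abelian_group A" and T: "finite T"
    and closed: "\<And>x. Poly_Mapping.keys x \<subseteq> T \<Longrightarrow> k x \<in> carrier A"
    and add: "\<And>x y. \<lbrakk>Poly_Mapping.keys x \<subseteq> T; Poly_Mapping.keys y \<subseteq> T\<rbrakk> \<Longrightarrow> k (x + y) = k x \<oplus>\<^bsub>A\<^esub> k y"
    and surj: "\<And>a. a \<in> carrier A \<Longrightarrow> \<exists>x. Poly_Mapping.keys x \<subseteq> T \<and> k x = a"
  shows "zfg A"
proof -
  interpret A: abelian_group A by fact
  interpret F: abelian_group "free_ab T" by (rule abelian_group_free_ab)
  let ?S = "(\<lambda>t. k (frag_of t)) ` T"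
  let ?m = "frag_extend (\<lambda>t. frag_of (k (frag_of t)))"
  have S: "?S \<subseteq> carrier A" by (auto intro!: closed)
  interpret I: free_lift A ?S "\<lambda>x. x" by (rule free_liftI[OF A]) (use S in auto)
  have k0: "k 0 = \<zero>\<^bsub>A\<^esub>" using F.additive_zero[OF A, of k] closed add by simp
  have kd: "k (x - y) = k x \<ominus>\<^bsub>A\<^esub> k y" if "Poly_Mapping.keys x \<subseteq> T" "Poly_Mapping.keys y \<subseteq> T" for x y
    using F.additive_minus[OF A, of k x y] closed add that free_ab_minus[of x T y] by simp
  have *: "Poly_Mapping.keys (?m x) \<subseteq> ?S \<and> flift ?S A (\<lambda>x. x) (?m x) = k x" if "Poly_Mapping.keys x \<subseteq> T" for x
    using that
  proof (induction x rule: frag_support_induct)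
    case (diff x y)
    then show ?case using keys_diff[of "?m x" "?m y"] by (auto simp: frag_extend_diff I.diff kd)
  qed (auto simp: k0 I.zero I.of)
  have "carrier A \<subseteq> flift ?S A (\<lambda>x. x) ` {x. Poly_Mapping.keys x \<subseteq> ?S}"
  proof
    fix a assume "a \<in> carrier A"
    then obtain x where "Poly_Mapping.keys x \<subseteq> T" "k x = a" using surj by blast
    then show "a \<in> flift ?S A (\<lambda>x. x) ` {x. Poly_Mapping.keys x \<subseteq> ?S}"
      using *[of x] by (intro image_eqI[of _ _ "?m x"]) auto
  qed
  then show ?thesis unfolding zfg_def using T S by blast
qed

lemma zfg_image:
  assumes A: "abelian_group A" and L: "abelian_group L" and z: "zfg A"
    and p: "\<And>x. x \<in> carrier A \<Longrightarrow> p x \<in> carrier L"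
      "\<And>x y. \<lbrakk>x \<in> carrier A; y \<in> carrier A\<rbrakk> \<Longrightarrow> p (x \<oplus>\<^bsub>A\<^esub> y) = p x \<oplus>\<^bsub>L\<^esub> p y" "p ` carrier A = carrier L"
  shows "zfg L"
proof -
  obtain S where S: "finite S" "S \<subseteq> carrier A" "carrier A \<subseteq> flift S A (\<lambda>x. x) ` {x. Poly_Mapping.keys x \<subseteq> S}"
    using z by (auto simp: zfg_def)
  interpret I: free_lift A S "\<lambda>x. x" by (rule free_liftI[OF A]) (use S in auto)
  show ?thesis
  proof (rule zfgI[OF L S(1), of "\<lambda>x. p (flift S A (\<lambda>x. x) x)"])
    fix a assume "a \<in> carrier L"
    then obtain b where "b \<in> carrier A" "a = p b" using p(3) by auto
    then show "\<exists>x. Poly_Mapping.keys x \<subseteq> S \<and> p (flift S A (\<lambda>x. x) x) = a" using S(3) by auto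
  qed (use I.closed I.add p in auto)
qed

text \<open>Pull \<open>H\<close> back to the free group on the finitely many generators. There it
  has a basis, which is finite because its elements have their supports in a finite set.\<close>

lemma zfg_sub:
  assumes A: "abelian_group A" and z: "zfg A" and H: "H \<subseteq> carrier A" "\<zero>\<^bsub>A\<^esub> \<in> H"
    and diff: "\<And>x y. \<lbrakk>x \<in> H; y \<in> H\<rbrakk> \<Longrightarrow> x \<ominus>\<^bsub>A\<^esub> y \<in> H"
  shows "zfg (A\<lparr>carrier := H\<rparr>)"
proof -
  obtain S where S: "finite S" "S \<subseteq> carrier A" "carrier A \<subseteq> flift S A (\<lambda>x. x) ` {x. Poly_Mapping.keys x \<subseteq> S}"
    using z by (auto simp: zfg_def)
  interpret I: free_lift A S "\<lambda>x. x" by (rule free_liftI[OF A]) (use S in auto)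
  let ?f = "flift S A (\<lambda>x. x)"
  let ?H = "{x. Poly_Mapping.keys x \<subseteq> S \<and> ?f x \<in> H}"
  let ?E = "frag_extend (\<lambda>b :: 'a \<Rightarrow>\<^sub>0 int. b)"
  have "0 \<in> ?H" using H by (simp add: I.zero)
  moreover have "x - y \<in> ?H" if "x \<in> ?H" "y \<in> ?H" for x y
    using that keys_diff[of x y] diff by (auto simp: I.diff)
  ultimately obtain B where B: "bij_betw ?E {x. Poly_Mapping.keys x \<subseteq> B} ?H"
    and fin: "\<And>S. \<lbrakk>finite S; \<And>x. x \<in> ?H \<Longrightarrow> Poly_Mapping.keys x \<subseteq> S\<rbrakk> \<Longrightarrow> finite B"
    using subgroup_free_abelian_basis[of ?H thesis] by blast
  have finB: "finite B" by (rule fin[OF S(1)]) simp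
  have E: "?E x \<in> ?H" if "Poly_Mapping.keys x \<subseteq> B" for x using B that by (auto simp: bij_betw_def)
  show ?thesis
  proof (rule zfgI[OF abelian_group_sub[OF A H diff] finB, of "\<lambda>x. ?f (?E x)"])
    fix x y :: "('a \<Rightarrow>\<^sub>0 int) \<Rightarrow>\<^sub>0 int" assume "Poly_Mapping.keys x \<subseteq> B" "Poly_Mapping.keys y \<subseteq> B"
    then show "?f (?E (x + y)) = ?f (?E x) \<oplus>\<^bsub>A\<lparr>carrier := H\<rparr>\<^esub> ?f (?E y)"
      using E[of x] E[of y] by (simp add: frag_extend_add I.add)
  next
    fix a assume "a \<in> carrier (A\<lparr>carrier := H\<rparr>)"
    then have a: "a \<in> H" by simp
    then obtain x where "Poly_Mapping.keys x \<subseteq> S" "?f x = a" using S(3) H(1) by auto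
    then have "x \<in> ?H" using a by auto
    then have "x \<in> ?E ` {x. Poly_Mapping.keys x \<subseteq> B}" using B by (simp add: bij_betw_def)
    then show "\<exists>x. Poly_Mapping.keys x \<subseteq> B \<and> ?f (?E x) = a" using \<open>?f x = a\<close> by auto
  qed (use E in auto)
qed

section \<open>Modules of functions on subsets of the monoid\<close>

lemma (in abelian_monoid) finsum_swap:
  assumes "finite I" "finite J" "\<And>i j. \<lbrakk>i \<in> I; j \<in> J\<rbrakk> \<Longrightarrow> f i j \<in> carrier G"
  shows "(\<Oplus>i\<in>I. \<Oplus>j\<in>J. f i j) = (\<Oplus>j\<in>J. \<Oplus>i\<in>I. f i j)"
  using assms(1,3)
proof (induction I rule: finite_induct)
  case (insert i I)
  have "(\<Oplus>j\<in>J. f i j \<oplus> (\<Oplus>i\<in>I. f i j)) = (\<Oplus>j\<in>J. f i j) \<oplus> (\<Oplus>j\<in>J. \<Oplus>i\<in>I. f i j)"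
    using insert by (intro finsum_addf) (auto intro!: finsum_closed)
  moreover have "(\<Oplus>j\<in>J. \<Oplus>i\<in>insert i I. f i j) = (\<Oplus>j\<in>J. f i j \<oplus> (\<Oplus>i\<in>I. f i j))"
    using insert by (intro finsum_cong') (auto intro!: finsum_insert finsum_closed)
  moreover have "(\<Oplus>i\<in>insert i I. \<Oplus>j\<in>J. f i j) = (\<Oplus>j\<in>J. f i j) \<oplus> (\<Oplus>i\<in>I. \<Oplus>j\<in>J. f i j)"
    using insert by (intro finsum_insert) (auto intro!: finsum_closed)
  ultimately show ?case using insert by simp
qed simp

lemma (in abelian_monoid) finsum_single:
  assumes "finite I" "i \<in> I \<Longrightarrow> a \<in> carrier G"
  shows "(\<Oplus>j\<in>I. if j = i then a else \<zero>) = (if i \<in> I then a else \<zero>)"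
proof (cases "i \<in> I")
  case True
  have "(\<Oplus>j\<in>I. if j = i then a else \<zero>) = (\<Oplus>j\<in>I. if i = j then a else \<zero>)"
    using True assms by (intro finsum_cong') auto
  then show ?thesis using add.finprod_singleton[of i I "\<lambda>_. a"] True assms by simp
next
  case False
  then have "(\<Oplus>j\<in>I. if j = i then a else \<zero>) = (\<Oplus>j\<in>I. \<zero>)" by (intro finsum_cong') auto
  then show ?thesis using False by simp
qed

lemma (in abelian_monoid) finsum_if:
  "(\<Oplus>j\<in>I. if P then f j else \<zero>) = (if P then (\<Oplus>j\<in>I. f j) else \<zero>)"
  by simp

locale fin_monoid_ring = monoid_ring M for M :: "'m monoid" (structure) +
  assumes fin: "finite (carrier M)"
begin

text \<open>Vanishing off \<open>Z\<close> makes equality of elements plain equality of functions;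
  finiteness of the monoid takes care of the supports.\<close>

definition funs :: "('a, 'z) ring_scheme \<Rightarrow> 'm set \<Rightarrow> ('m \<Rightarrow> 'a) ring" where
  "funs A Z = \<lparr>carrier = {f. (\<forall>x \<in> Z. f x \<in> carrier A) \<and> (\<forall>x. x \<notin> Z \<longrightarrow> f x = \<zero>\<^bsub>A\<^esub>)},
     monoid.mult = undefined, one = undefined, ring.zero = (\<lambda>_. \<zero>\<^bsub>A\<^esub>), ring.add = (\<lambda>f g x. f x \<oplus>\<^bsub>A\<^esub> g x)\<rparr>"

lemma funs_simps [simp]:
  "carrier (funs A Z) = {f. (\<forall>x \<in> Z. f x \<in> carrier A) \<and> (\<forall>x. x \<notin> Z \<longrightarrow> f x = \<zero>\<^bsub>A\<^esub>)}"
  "\<zero>\<^bsub>funs A Z\<^esub> = (\<lambda>_. \<zero>\<^bsub>A\<^esub>)" "f \<oplus>\<^bsub>funs A Z\<^esub> g = (\<lambda>x. f x \<oplus>\<^bsub>A\<^esub> g x)"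
  by (auto simp: funs_def)

lemma abelian_group_funs:
  assumes "abelian_group A"
  shows "abelian_group (funs A Z)"
proof -
  interpret A: abelian_group A by fact
  have cl: "f x \<in> carrier A" if "f \<in> carrier (funs A Z)" for f x using that by (cases "x \<in> Z") auto
  show ?thesis
  proof (rule abelian_groupI)
    fix f assume f: "f \<in> carrier (funs A Z)"
    show "\<exists>g \<in> carrier (funs A Z). g \<oplus>\<^bsub>funs A Z\<^esub> f = \<zero>\<^bsub>funs A Z\<^esub>"
    proof (rule bexI)
      show "(\<lambda>x. \<ominus>\<^bsub>A\<^esub> f x) \<oplus>\<^bsub>funs A Z\<^esub> f = \<zero>\<^bsub>funs A Z\<^esub>" using cl[OF f] by (simp add: A.l_neg)
      show "(\<lambda>x. \<ominus>\<^bsub>A\<^esub> f x) \<in> carrier (funs A Z)" using f by auto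
    qed
  next
    fix f g h assume *: "f \<in> carrier (funs A Z)" "g \<in> carrier (funs A Z)" "h \<in> carrier (funs A Z)"
    show "f \<oplus>\<^bsub>funs A Z\<^esub> g \<oplus>\<^bsub>funs A Z\<^esub> h = f \<oplus>\<^bsub>funs A Z\<^esub> (g \<oplus>\<^bsub>funs A Z\<^esub> h)"
      using cl[OF *(1)] cl[OF *(2)] cl[OF *(3)] by (simp add: A.a_assoc)
  next
    fix f g assume *: "f \<in> carrier (funs A Z)" "g \<in> carrier (funs A Z)"
    show "f \<oplus>\<^bsub>funs A Z\<^esub> g = g \<oplus>\<^bsub>funs A Z\<^esub> f"
      using cl[OF *(1)] cl[OF *(2)] by (simp add: A.a_comm)
  next
    fix f assume *: "f \<in> carrier (funs A Z)"
    show "\<zero>\<^bsub>funs A Z\<^esub> \<oplus>\<^bsub>funs A Z\<^esub> f = f"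
      using cl[OF *] by simp
  qed auto
qed

text \<open>The partial action of \<open>M\<close> on a subset \<open>Z\<close> that is convex in the \<open>\<L>\<close>-order; products
  leaving \<open>Z\<close> count as zero.\<close>

definition shift :: "('a, 'z) ring_scheme \<Rightarrow> 'm set \<Rightarrow> 'm \<Rightarrow> ('m \<Rightarrow> 'a) \<Rightarrow> 'm \<Rightarrow> 'a" where
  "shift A Z m f = (\<lambda>x. if x \<in> Z then (\<Oplus>\<^bsub>A\<^esub>y\<in>Z. if m \<otimes> y = x then f y else \<zero>\<^bsub>A\<^esub>) else \<zero>\<^bsub>A\<^esub>)"

text \<open>A product that has left \<open>Z\<close> cannot come back. Without this, treating it as
  zero would break associativity of the action.\<close>

definition convex_set :: "'m set \<Rightarrow> bool" where
  "convex_set Z \<longleftrightarrow> Z \<subseteq> carrier M \<and>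
     (\<forall>m \<in> carrier M. \<forall>n \<in> carrier M. \<forall>y \<in> Z. m \<otimes> (n \<otimes> y) \<in> Z \<longrightarrow> n \<otimes> y \<in> Z)"

text \<open>This is \<open>A[Z]\<close>. For an L-class it is the left Schuetzenberger
  representation with coefficients in \<open>A\<close>.\<close>

definition fm :: "('a, 'z) ring_scheme \<Rightarrow> 'm set \<Rightarrow> ('m \<Rightarrow>\<^sub>0 int, 'm \<Rightarrow> 'a) module" where
  "fm A Z = act_module (funs A Z) (shift A Z)"

lemma fm_simps [simp]:
  "carrier (fm A Z) = carrier (funs A Z)" "\<zero>\<^bsub>fm A Z\<^esub> = (\<lambda>_. \<zero>\<^bsub>A\<^esub>)" "f \<oplus>\<^bsub>fm A Z\<^esub> g = (\<lambda>x. f x \<oplus>\<^bsub>A\<^esub> g x)"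
  by (simp_all add: fm_def)

lemma
  assumes A: "abelian_group A" and Z: "convex_set Z"
  shows left_module_fm: "left_module ZM (fm A Z)"
    and fm_of: "\<lbrakk>m \<in> carrier M; f \<in> carrier (funs A Z)\<rbrakk> \<Longrightarrow> frag_of m \<odot>\<^bsub>fm A Z\<^esub> f = shift A Z m f"
proof -
  interpret A: abelian_group A by fact
  have ZM: "Z \<subseteq> carrier M" using Z by (simp add: convex_set_def)
  have finZ: "finite Z" using ZM fin by (rule finite_subset)
  have closed: "shift A Z m f \<in> carrier (funs A Z)" if "f \<in> carrier (funs A Z)" for m f
    using that by (auto simp: shift_def intro!: A.finsum_closed)
  have add: "shift A Z m (f \<oplus>\<^bsub>funs A Z\<^esub> g) = shift A Z m f \<oplus>\<^bsub>funs A Z\<^esub> shift A Z m g"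
    if f: "f \<in> carrier (funs A Z)" and g: "g \<in> carrier (funs A Z)" for m f g
  proof
    fix x
    have "(\<Oplus>\<^bsub>A\<^esub>y\<in>Z. if m \<otimes> y = x then f y \<oplus>\<^bsub>A\<^esub> g y else \<zero>\<^bsub>A\<^esub>) =
        (\<Oplus>\<^bsub>A\<^esub>y\<in>Z. (if m \<otimes> y = x then f y else \<zero>\<^bsub>A\<^esub>) \<oplus>\<^bsub>A\<^esub> (if m \<otimes> y = x then g y else \<zero>\<^bsub>A\<^esub>))"
      using f g by (intro A.finsum_cong') auto
    also have "\<dots> = (\<Oplus>\<^bsub>A\<^esub>y\<in>Z. if m \<otimes> y = x then f y else \<zero>\<^bsub>A\<^esub>) \<oplus>\<^bsub>A\<^esub> (\<Oplus>\<^bsub>A\<^esub>y\<in>Z. if m \<otimes> y = x then g y else \<zero>\<^bsub>A\<^esub>)"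
      using f g by (intro A.finsum_addf) auto
    finally show "shift A Z m (f \<oplus>\<^bsub>funs A Z\<^esub> g) x = (shift A Z m f \<oplus>\<^bsub>funs A Z\<^esub> shift A Z m g) x"
      by (simp add: shift_def)
  qed
  have mult: "shift A Z (m \<otimes> n) f = shift A Z m (shift A Z n f)"
    if m: "m \<in> carrier M" and n: "n \<in> carrier M" and f: "f \<in> carrier (funs A Z)" for m n f
  proof
    fix x
    show "shift A Z (m \<otimes> n) f x = shift A Z m (shift A Z n f) x"
    proof (cases "x \<in> Z")
      case True
      have fc: "f y \<in> carrier A" if "y \<in> Z" for y using f that by auto
      have "shift A Z m (shift A Z n f) x =
          (\<Oplus>\<^bsub>A\<^esub>z\<in>Z. if m \<otimes> z = x then (\<Oplus>\<^bsub>A\<^esub>y\<in>Z. if n \<otimes> y = z then f y else \<zero>\<^bsub>A\<^esub>) else \<zero>\<^bsub>A\<^esub>)"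
        using True closed[OF f, of n] fc
        unfolding shift_def by (simp, intro A.finsum_cong') (auto intro!: A.finsum_closed)
      also have "\<dots> = (\<Oplus>\<^bsub>A\<^esub>z\<in>Z. \<Oplus>\<^bsub>A\<^esub>y\<in>Z. if m \<otimes> z = x then (if n \<otimes> y = z then f y else \<zero>\<^bsub>A\<^esub>) else \<zero>\<^bsub>A\<^esub>)"
        using fc by (intro A.finsum_cong') (auto intro!: A.finsum_closed simp: A.finsum_if)
      also have "\<dots> = (\<Oplus>\<^bsub>A\<^esub>y\<in>Z. \<Oplus>\<^bsub>A\<^esub>z\<in>Z. if m \<otimes> z = x then (if n \<otimes> y = z then f y else \<zero>\<^bsub>A\<^esub>) else \<zero>\<^bsub>A\<^esub>)"
        using fc finZ by (intro A.finsum_swap) auto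
      also have "\<dots> = (\<Oplus>\<^bsub>A\<^esub>y\<in>Z. if (m \<otimes> n) \<otimes> y = x then f y else \<zero>\<^bsub>A\<^esub>)"
      proof (rule A.finsum_cong')
        fix y assume y: "y \<in> Z"
        have eq: "(\<Oplus>\<^bsub>A\<^esub>z\<in>Z. if m \<otimes> z = x then (if n \<otimes> y = z then f y else \<zero>\<^bsub>A\<^esub>) else \<zero>\<^bsub>A\<^esub>) =
            (\<Oplus>\<^bsub>A\<^esub>z\<in>Z. if z = n \<otimes> y then (if m \<otimes> (n \<otimes> y) = x then f y else \<zero>\<^bsub>A\<^esub>) else \<zero>\<^bsub>A\<^esub>)"
          using fc[OF y] by (intro A.finsum_cong') auto
        \<comment> \<open>Convexity: a path that ends in \<open>Z\<close> passes through
          \<open>Z\<close>, so the intermediate product is among the summation indices.\<close>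
        have "m \<otimes> (n \<otimes> y) = x \<longrightarrow> n \<otimes> y \<in> Z"
          using Z m n y True by (auto simp: convex_set_def)
        then show "(\<Oplus>\<^bsub>A\<^esub>z\<in>Z. if m \<otimes> z = x then (if n \<otimes> y = z then f y else \<zero>\<^bsub>A\<^esub>) else \<zero>\<^bsub>A\<^esub>) =
            (if (m \<otimes> n) \<otimes> y = x then f y else \<zero>\<^bsub>A\<^esub>)"
          unfolding eq using fc[OF y] finZ m n y ZM by (subst A.finsum_single) (auto simp: m_assoc subset_iff)
      qed (use fc in auto)
      finally show ?thesis using True by (simp add: shift_def)
    qed (simp add: shift_def)
  qed
  have one: "shift A Z \<one> f = f" if f: "f \<in> carrier (funs A Z)" for f
  proof
    fix x
    have "(\<Oplus>\<^bsub>A\<^esub>y\<in>Z. if \<one> \<otimes> y = x then f y else \<zero>\<^bsub>A\<^esub>) = (\<Oplus>\<^bsub>A\<^esub>y\<in>Z. if y = x then f x else \<zero>\<^bsub>A\<^esub>)"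
      using f ZM by (intro A.finsum_cong') auto
    then show "shift A Z \<one> f x = f x"
      using f finZ A.finsum_single[of Z x "f x"] by (auto simp: shift_def)
  qed
  show "left_module ZM (fm A Z)" unfolding fm_def
    by (rule left_module_act_module[OF abelian_group_funs[OF A]]) (use closed add mult one in auto)
  show "\<lbrakk>m \<in> carrier M; f \<in> carrier (funs A Z)\<rbrakk> \<Longrightarrow> frag_of m \<odot>\<^bsub>fm A Z\<^esub> f = shift A Z m f" unfolding fm_def
    by (rule act_module_of[OF abelian_group_funs[OF A]]) (use closed add mult one in auto)
qed

text \<open>The empty set is included; it ends the removal of L-classes one after another.\<close>

definition left_ideal :: "'m set \<Rightarrow> bool" where
  "left_ideal T \<longleftrightarrow> T \<subseteq> carrier M \<and> (\<forall>m \<in> carrier M. \<forall>t \<in> T. m \<otimes> t \<in> T)"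

lemma left_ideal_subset: "left_ideal T \<Longrightarrow> T \<subseteq> carrier M"
  by (simp add: left_ideal_def)

lemma left_ideal_mult: "\<lbrakk>left_ideal T; m \<in> carrier M; t \<in> T\<rbrakk> \<Longrightarrow> m \<otimes> t \<in> T"
  by (simp add: left_ideal_def)

lemma convex_set_diff:
  assumes "left_ideal T" "left_ideal T'"
  shows "convex_set (T - T')"
  using assms unfolding convex_set_def left_ideal_def by blast

lemma convex_set_left_ideal: "left_ideal T \<Longrightarrow> convex_set T"
  unfolding convex_set_def left_ideal_def by blast

text \<open>Functions supported on the smaller left ideal form a submodule since products stay in
  it. Restricting to the difference is equivariant since a product that falls into \<open>T'\<close>
  counts as zero there.\<close>

lemma ses_fm:
  assumes A: "abelian_group A" and T: "left_ideal T" "left_ideal T'" "T' \<subseteq> T"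
  shows "ses ZM (fm A T') (\<lambda>f. f) (fm A T) (\<lambda>f x. if x \<in> T - T' then f x else \<zero>\<^bsub>A\<^esub>) (fm A (T - T'))"
proof -
  interpret A: abelian_group A by fact
  let ?r = "\<lambda>f x. if x \<in> T - T' then f x else \<zero>\<^bsub>A\<^esub>"
  have finT: "finite T" using left_ideal_subset[OF T(1)] fin by (rule finite_subset)
  note c = convex_set_left_ideal[OF T(1)] convex_set_left_ideal[OF T(2)] convex_set_diff[OF T(1,2)]
  note l = left_module_fm[OF A c(1)] left_module_fm[OF A c(2)] left_module_fm[OF A c(3)]
  have sub: "f \<in> carrier (funs A T)" if "f \<in> carrier (funs A T')" for f
    using that T(3) by (fastforce)
  have rc: "?r f \<in> carrier (funs A (T - T'))" if "f \<in> carrier (funs A T)" for f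
    using that by auto
  have 1: "shift A T m f = shift A T' m f" if m: "m \<in> carrier M" and f: "f \<in> carrier (funs A T')" for m f
  proof
    fix x
    have s: "(\<Oplus>\<^bsub>A\<^esub>y\<in>T'. if m \<otimes> y = x then f y else \<zero>\<^bsub>A\<^esub>) = (\<Oplus>\<^bsub>A\<^esub>y\<in>T. if m \<otimes> y = x then f y else \<zero>\<^bsub>A\<^esub>)"
      using f T(3) finT sub[OF f] by (intro A.add.finprod_mono_neutral_cong_left) auto
    have "(\<Oplus>\<^bsub>A\<^esub>y\<in>T'. if m \<otimes> y = x then f y else \<zero>\<^bsub>A\<^esub>) = \<zero>\<^bsub>A\<^esub>" if "x \<notin> T'"
    proof -
      have "(\<Oplus>\<^bsub>A\<^esub>y\<in>T'. if m \<otimes> y = x then f y else \<zero>\<^bsub>A\<^esub>) = (\<Oplus>\<^bsub>A\<^esub>y\<in>T'. \<zero>\<^bsub>A\<^esub>)"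
        using that left_ideal_mult[OF T(2) m] by (intro A.finsum_cong') auto
      then show ?thesis by simp
    qed
    then show "shift A T m f x = shift A T' m f x" using s T(3) by (auto simp: shift_def)
  qed
  have 2: "?r (shift A T m f) = shift A (T - T') m (?r f)" if m: "m \<in> carrier M" and f: "f \<in> carrier (funs A T)" for m f
  proof
    fix x
    have "(\<Oplus>\<^bsub>A\<^esub>y\<in>T - T'. if m \<otimes> y = x then ?r f y else \<zero>\<^bsub>A\<^esub>) = (\<Oplus>\<^bsub>A\<^esub>y\<in>T. if m \<otimes> y = x then f y else \<zero>\<^bsub>A\<^esub>)"
      if "x \<in> T - T'"
      using f T(3) finT that left_ideal_mult[OF T(2) m]
      by (intro A.add.finprod_mono_neutral_cong_left) auto
    note eq = this
    show "?r (shift A T m f) x = shift A (T - T') m (?r f) x"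
    proof (cases "x \<in> T - T'")
      case True
      then have "x \<in> T" by simp
      then show ?thesis unfolding shift_def using eq[OF True] by (simp only: True if_True)
    qed (simp only: shift_def if_False)
  qed
  show ?thesis
    unfolding ses_def
  proof (intro conjI l)
    show "(\<lambda>f. f) \<in> lmod_hom ZM (fm A T') (fm A T)"
      by (rule lmod_homI_act[OF l(2) l(1)])
        (simp_all only: fm_simps sub 1 fm_of[OF A c(1)] fm_of[OF A c(2)])
    show "?r \<in> lmod_hom ZM (fm A T) (fm A (T - T'))"
    proof (rule lmod_homI_act[OF l(1) l(3)])
      fix m f assume "m \<in> carrier M" "f \<in> carrier (fm A T)"
      then show "?r (frag_of m \<odot>\<^bsub>fm A T\<^esub> f) = frag_of m \<odot>\<^bsub>fm A (T - T')\<^esub> ?r f"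
        using 2 rc fm_of[OF A c(1)] fm_of[OF A c(3)] by (simp only: fm_simps)
    qed (use rc in auto)
    show "(\<lambda>f. f) ` carrier (fm A T') = {f \<in> carrier (fm A T). ?r f = \<zero>\<^bsub>fm A (T - T')\<^esub>}"
    proof (intro equalityI subsetI)
      fix f assume "f \<in> (\<lambda>f. f) ` carrier (fm A T')"
      then have f: "f \<in> carrier (funs A T')" by simp
      then have "?r f = (\<lambda>_. \<zero>\<^bsub>A\<^esub>)" by (auto simp: fun_eq_iff)
      then show "f \<in> {f \<in> carrier (fm A T). ?r f = \<zero>\<^bsub>fm A (T - T')\<^esub>}" using sub[OF f] by simp
    next
      fix f assume "f \<in> {f \<in> carrier (fm A T). ?r f = \<zero>\<^bsub>fm A (T - T')\<^esub>}"
      then have f: "f \<in> carrier (funs A T)" and r0: "?r f = (\<lambda>_. \<zero>\<^bsub>A\<^esub>)" by auto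
      have "f x = \<zero>\<^bsub>A\<^esub>" if "x \<notin> T'" for x
        using f fun_cong[OF r0, of x] that by (cases "x \<in> T") simp_all
      moreover have "f x \<in> carrier A" if "x \<in> T'" for x using f T(3) that by auto
      ultimately show "f \<in> (\<lambda>f. f) ` carrier (fm A T')" by simp
    qed
    show "?r ` carrier (fm A T) = carrier (fm A (T - T'))"
    proof (intro equalityI subsetI)
      fix f assume f: "f \<in> carrier (fm A (T - T'))"
      have "f x \<in> carrier A" for x using f by (cases "x \<in> T - T'") auto
      then have "f \<in> carrier (fm A T)" using f by simp
      moreover have "f = ?r f" using f by (auto simp: fun_eq_iff)
      ultimately show "f \<in> ?r ` carrier (fm A T)" by (intro image_eqI[where x=f and f="?r"])
    qed (use rc in auto)
  qed simp
qed

text \<open>Both exactness and the action can be checked pointwise in the coefficients, so a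
  presentation of a coefficient group presents the module.\<close>

lemma ses_fm_coeff:
  fixes A :: "('a, 'z) ring_scheme" and L :: "('b, 'y) ring_scheme"
  assumes A: "abelian_group A" and L: "abelian_group L" and Z: "convex_set Z"
    and h: "\<And>x. x \<in> carrier A \<Longrightarrow> h x \<in> carrier L"
      "\<And>x y. \<lbrakk>x \<in> carrier A; y \<in> carrier A\<rbrakk> \<Longrightarrow> h (x \<oplus>\<^bsub>A\<^esub> y) = h x \<oplus>\<^bsub>L\<^esub> h y" "h ` carrier A = carrier L"
    and K: "abelian_group (A\<lparr>carrier := {x \<in> carrier A. h x = \<zero>\<^bsub>L\<^esub>}\<rparr>)"
  shows "ses ZM (fm (A\<lparr>carrier := {x \<in> carrier A. h x = \<zero>\<^bsub>L\<^esub>}\<rparr>) Z) (\<lambda>f. f) (fm A Z) (\<lambda>f x. h (f x)) (fm L Z)"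
proof -
  interpret A: abelian_group A by fact
  interpret L: abelian_group L by fact
  let ?K = "A\<lparr>carrier := {x \<in> carrier A. h x = \<zero>\<^bsub>L\<^esub>}\<rparr>"
  interpret K: abelian_group ?K by fact
  have h0: "h \<zero>\<^bsub>A\<^esub> = \<zero>\<^bsub>L\<^esub>" by (rule A.additive_zero[OF L h(1,2)])
  note l = left_module_fm[OF A Z] left_module_fm[OF L Z] left_module_fm[OF K Z]
  have sub: "f \<in> carrier (funs A Z)" if "f \<in> carrier (funs ?K Z)" for f using that by auto
  have hc: "(\<lambda>x. h (f x)) \<in> carrier (funs L Z)" if "f \<in> carrier (funs A Z)" for f using that h h0 by auto
  have 1: "shift A Z m f = shift ?K Z m f" if f: "f \<in> carrier (funs ?K Z)" for m f
  proof
    fix x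
    have z: "\<zero>\<^bsub>?K\<^esub> = \<zero>\<^bsub>A\<^esub>" by simp
    have "finsum ?K (\<lambda>y. if m \<otimes> y = x then f y else \<zero>\<^bsub>A\<^esub>) Z = finsum A (\<lambda>y. if m \<otimes> y = x then f y else \<zero>\<^bsub>A\<^esub>) Z"
      by (rule additive_finsum[OF K A, where h="\<lambda>x. x"]) (use f h0 in auto)
    then show "shift A Z m f x = shift ?K Z m f x" unfolding shift_def z by (simp only:)
  qed
  have 2: "(\<lambda>x. h (shift A Z m f x)) = shift L Z m (\<lambda>x. h (f x))" if f: "f \<in> carrier (funs A Z)" for m f
  proof
    fix x
    have "h (\<Oplus>\<^bsub>A\<^esub>y\<in>Z. if m \<otimes> y = x then f y else \<zero>\<^bsub>A\<^esub>) = (\<Oplus>\<^bsub>L\<^esub>y\<in>Z. h (if m \<otimes> y = x then f y else \<zero>\<^bsub>A\<^esub>))"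
      by (rule additive_finsum[OF A L h(1,2)]) (use f in auto)
    also have "\<dots> = (\<Oplus>\<^bsub>L\<^esub>y\<in>Z. if m \<otimes> y = x then h (f y) else \<zero>\<^bsub>L\<^esub>)"
      using f h(1) h0 by (intro L.finsum_cong') auto
    finally show "h (shift A Z m f x) = shift L Z m (\<lambda>x. h (f x)) x" by (simp add: shift_def h0)
  qed
  show ?thesis
    unfolding ses_def
  proof (intro conjI l)
    show "(\<lambda>f. f) \<in> lmod_hom ZM (fm ?K Z) (fm A Z)"
    proof (rule lmod_homI_act[OF l(3) l(1)])
      fix m f assume "m \<in> carrier M" "f \<in> carrier (fm ?K Z)"
      then show "frag_of m \<odot>\<^bsub>fm ?K Z\<^esub> f = frag_of m \<odot>\<^bsub>fm A Z\<^esub> f"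
        using sub[of f] 1[of f m] fm_of[OF A Z] fm_of[OF K Z] by (simp only: fm_simps)
    qed auto
    show "(\<lambda>f x. h (f x)) \<in> lmod_hom ZM (fm A Z) (fm L Z)"
    proof (rule lmod_homI_act[OF l(1) l(2)])
      fix m f assume "m \<in> carrier M" "f \<in> carrier (fm A Z)"
      then show "(\<lambda>x. h ((frag_of m \<odot>\<^bsub>fm A Z\<^esub> f) x)) = frag_of m \<odot>\<^bsub>fm L Z\<^esub> (\<lambda>x. h (f x))"
        using hc[of f] 2[of f m] fm_of[OF A Z] fm_of[OF L Z] by (simp only: fm_simps)
    next
      fix f g assume f: "f \<in> carrier (fm A Z)" and g: "g \<in> carrier (fm A Z)"
      have "f x \<in> carrier A" "g x \<in> carrier A" for x using f g by (cases "x \<in> Z"; auto)+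
      then show "(\<lambda>x. h ((f \<oplus>\<^bsub>fm A Z\<^esub> g) x)) = (\<lambda>x. h (f x)) \<oplus>\<^bsub>fm L Z\<^esub> (\<lambda>x. h (g x))"
        using h(2) by simp
    qed (use hc in auto)
    show "(\<lambda>f. f) ` carrier (fm ?K Z) = {f \<in> carrier (fm A Z). (\<lambda>x. h (f x)) = \<zero>\<^bsub>fm L Z\<^esub>}"
    proof (intro equalityI subsetI)
      fix f assume f: "f \<in> (\<lambda>f. f) ` carrier (fm ?K Z)"
      have "h (f x) = \<zero>\<^bsub>L\<^esub>" for x using f h0 by (cases "x \<in> Z") auto
      then show "f \<in> {f \<in> carrier (fm A Z). (\<lambda>x. h (f x)) = \<zero>\<^bsub>fm L Z\<^esub>}" using f by auto
    next
      fix f assume "f \<in> {f \<in> carrier (fm A Z). (\<lambda>x. h (f x)) = \<zero>\<^bsub>fm L Z\<^esub>}"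
      then have f: "f \<in> carrier (funs A Z)" "(\<lambda>x. h (f x)) = (\<lambda>_. \<zero>\<^bsub>L\<^esub>)" by auto
      have "h (f x) = \<zero>\<^bsub>L\<^esub>" for x using fun_cong[OF f(2), of x] by simp
      then show "f \<in> (\<lambda>f. f) ` carrier (fm ?K Z)" using f(1) by auto
    qed
    show "(\<lambda>f x. h (f x)) ` carrier (fm A Z) = carrier (fm L Z)"
    proof (intro equalityI subsetI)
      fix f assume f: "f \<in> carrier (fm L Z)"
      define g where "g x = (if x \<in> Z then inv_into (carrier A) h (f x) else \<zero>\<^bsub>A\<^esub>)" for x
      have "g x \<in> carrier A" "h (g x) = f x" if "x \<in> Z" for x
        using f that h(3) inv_into_into[of "f x" h "carrier A"] f_inv_into_f[of "f x" h "carrier A"] by (auto simp: g_def)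
      then have "g \<in> carrier (fm A Z)" "f = (\<lambda>x. h (g x))" using f h0 by (auto simp: g_def fun_eq_iff)
      then show "f \<in> (\<lambda>f x. h (f x)) ` carrier (fm A Z)"
        by (intro image_eqI[where x=g and f="\<lambda>f x. h (f x)"])
    qed (use hc h0 in auto)
  qed simp
qed

text \<open>The value of \<open>f\<close> at \<open>x\<close> is pushed forward by \<open>u\<close>
  and moved by \<open>x\<close>. A product that leaves \<open>Z\<close> disappears on the side of
  functions, so it has to annihilate the values of \<open>u\<close> on the other side.\<close>

lemma fm_hom:
  assumes A: "abelian_group A" and Z: "convex_set Z" and N: "left_module ZM N"
    and u: "\<And>x. x \<in> carrier A \<Longrightarrow> u x \<in> carrier N"
      "\<And>x y. \<lbrakk>x \<in> carrier A; y \<in> carrier A\<rbrakk> \<Longrightarrow> u (x \<oplus>\<^bsub>A\<^esub> y) = u x \<oplus>\<^bsub>N\<^esub> u y"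
    and vanish: "\<And>m y a. \<lbrakk>m \<in> carrier M; y \<in> Z; m \<otimes> y \<notin> Z; a \<in> carrier A\<rbrakk> \<Longrightarrow> frag_of (m \<otimes> y) \<odot>\<^bsub>N\<^esub> u a = \<zero>\<^bsub>N\<^esub>"
  shows "(\<lambda>f. \<Oplus>\<^bsub>N\<^esub>x\<in>Z. frag_of x \<odot>\<^bsub>N\<^esub> u (f x)) \<in> lmod_hom ZM (fm A Z) N"
proof -
  interpret A: abelian_group A by fact
  interpret N: ZM_module M N by (rule ZM_moduleI[OF monoid_axioms N])
  have ZM: "Z \<subseteq> carrier M" using Z by (simp add: convex_set_def)
  have finZ: "finite Z" using ZM fin by (rule finite_subset)
  have u0: "u \<zero>\<^bsub>A\<^esub> = \<zero>\<^bsub>N\<^esub>" by (rule A.additive_zero[OF N.N.abelian_group_axioms u])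
  have uc: "N.act x (u (f y)) \<in> carrier N" if "x \<in> Z" "y \<in> Z" "f \<in> carrier (funs A Z)" for x y f
    using that ZM u(1) by (intro N.act_closed) auto
  show ?thesis
    unfolding N.act_def[symmetric]
  proof (rule lmod_homI_act[OF left_module_fm[OF A Z] N])
    fix f assume f: "f \<in> carrier (fm A Z)"
    then show "(\<Oplus>\<^bsub>N\<^esub>x\<in>Z. N.act x (u (f x))) \<in> carrier N" by (intro N.N.finsum_closed) (auto intro!: uc)
  next
    fix f g assume f: "f \<in> carrier (fm A Z)" and g: "g \<in> carrier (fm A Z)"
    have "(\<Oplus>\<^bsub>N\<^esub>x\<in>Z. N.act x (u ((f \<oplus>\<^bsub>fm A Z\<^esub> g) x))) = (\<Oplus>\<^bsub>N\<^esub>x\<in>Z. N.act x (u (f x)) \<oplus>\<^bsub>N\<^esub> N.act x (u (g x)))"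
      using f g ZM by (intro N.N.finsum_cong') (auto simp: u N.act_add subset_iff intro!: uc N.act_closed)
    also have "\<dots> = (\<Oplus>\<^bsub>N\<^esub>x\<in>Z. N.act x (u (f x))) \<oplus>\<^bsub>N\<^esub> (\<Oplus>\<^bsub>N\<^esub>x\<in>Z. N.act x (u (g x)))"
      using f g by (intro N.N.finsum_addf) (auto intro!: uc)
    finally show "(\<Oplus>\<^bsub>N\<^esub>x\<in>Z. N.act x (u ((f \<oplus>\<^bsub>fm A Z\<^esub> g) x))) = (\<Oplus>\<^bsub>N\<^esub>x\<in>Z. N.act x (u (f x))) \<oplus>\<^bsub>N\<^esub> (\<Oplus>\<^bsub>N\<^esub>x\<in>Z. N.act x (u (g x)))" .
  next
    fix m f assume m: "m \<in> carrier M" and f: "f \<in> carrier (fm A Z)"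
    then have f': "f \<in> carrier (funs A Z)" by simp
    have fc: "f y \<in> carrier A" if "y \<in> Z" for y using f that by auto
    have "(\<Oplus>\<^bsub>N\<^esub>x\<in>Z. N.act x (u ((frag_of m \<odot>\<^bsub>fm A Z\<^esub> f) x))) =
        (\<Oplus>\<^bsub>N\<^esub>x\<in>Z. N.act x (u (\<Oplus>\<^bsub>A\<^esub>y\<in>Z. if m \<otimes> y = x then f y else \<zero>\<^bsub>A\<^esub>)))"
      using ZM fc unfolding fm_of[OF A Z m f']
      by (intro N.N.finsum_cong') (auto simp: shift_def intro!: N.act_closed u A.finsum_closed)
    also have "\<dots> = (\<Oplus>\<^bsub>N\<^esub>x\<in>Z. \<Oplus>\<^bsub>N\<^esub>y\<in>Z. if m \<otimes> y = x then N.act x (u (f y)) else \<zero>\<^bsub>N\<^esub>)"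
    proof (rule N.N.finsum_cong')
      fix x assume x: "x \<in> Z"
      then have xM: "x \<in> carrier M" using ZM by auto
      have "N.act x (u (\<Oplus>\<^bsub>A\<^esub>y\<in>Z. if m \<otimes> y = x then f y else \<zero>\<^bsub>A\<^esub>)) =
          (\<Oplus>\<^bsub>N\<^esub>y\<in>Z. N.act x (u (if m \<otimes> y = x then f y else \<zero>\<^bsub>A\<^esub>)))"
        by (rule additive_finsum[where h="\<lambda>a. N.act x (u a)", OF A N.N.abelian_group_axioms])
          (use fc xM u in \<open>auto intro!: N.act_closed N.act_add\<close>)
      also have "\<dots> = (\<Oplus>\<^bsub>N\<^esub>y\<in>Z. if m \<otimes> y = x then N.act x (u (f y)) else \<zero>\<^bsub>N\<^esub>)"
        using x f' by (intro N.N.finsum_cong') (auto simp: u0 N.act_zero[OF xM] intro!: uc)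
      finally show "N.act x (u (\<Oplus>\<^bsub>A\<^esub>y\<in>Z. if m \<otimes> y = x then f y else \<zero>\<^bsub>A\<^esub>)) =
        (\<Oplus>\<^bsub>N\<^esub>y\<in>Z. if m \<otimes> y = x then N.act x (u (f y)) else \<zero>\<^bsub>N\<^esub>)" .
    qed (use f' in \<open>auto intro!: N.N.finsum_closed uc\<close>)
    \<comment> \<open>After exchanging the sums, each \<open>y\<close> contributes through the
      single index \<open>x = m \<otimes> y\<close>.\<close>
    also have "\<dots> = (\<Oplus>\<^bsub>N\<^esub>y\<in>Z. \<Oplus>\<^bsub>N\<^esub>x\<in>Z. if m \<otimes> y = x then N.act x (u (f y)) else \<zero>\<^bsub>N\<^esub>)"
      using f' finZ by (intro N.N.finsum_swap) (auto intro!: uc)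
    also have "\<dots> = (\<Oplus>\<^bsub>N\<^esub>y\<in>Z. N.act m (N.act y (u (f y))))"
    proof (rule N.N.finsum_cong')
      fix y assume y: "y \<in> Z"
      then have yM: "y \<in> carrier M" using ZM by auto
      have "(\<Oplus>\<^bsub>N\<^esub>x\<in>Z. if m \<otimes> y = x then N.act x (u (f y)) else \<zero>\<^bsub>N\<^esub>) =
          (\<Oplus>\<^bsub>N\<^esub>x\<in>Z. if x = m \<otimes> y then N.act (m \<otimes> y) (u (f y)) else \<zero>\<^bsub>N\<^esub>)"
        using y f' by (intro N.N.finsum_cong') (auto intro!: uc)
      also have "\<dots> = (if m \<otimes> y \<in> Z then N.act (m \<otimes> y) (u (f y)) else \<zero>\<^bsub>N\<^esub>)"
        using y f' by (intro N.N.finsum_single[OF finZ]) (auto intro!: uc)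
      \<comment> \<open>If the product has left \<open>Z\<close>, both sides are zero, the right one
        by \<open>vanish\<close>.\<close>
      also have "\<dots> = N.act (m \<otimes> y) (u (f y))"
        using vanish[OF m y _ fc[OF y]] by (simp add: N.act_def)
      also have "\<dots> = N.act m (N.act y (u (f y)))"
        using N.act_mult[OF m yM] u fc[OF y] by simp
      finally show "(\<Oplus>\<^bsub>N\<^esub>x\<in>Z. if m \<otimes> y = x then N.act x (u (f y)) else \<zero>\<^bsub>N\<^esub>) = N.act m (N.act y (u (f y)))" .
    qed (use f' m in \<open>auto intro!: uc N.act_closed[OF m]\<close>)
    also have "\<dots> = N.act m (\<Oplus>\<^bsub>N\<^esub>y\<in>Z. N.act y (u (f y)))"
      by (rule additive_finsum[symmetric, OF N.N.abelian_group_axioms N.N.abelian_group_axioms])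
        (use m f' ZM u(1) in \<open>auto intro!: N.act_closed N.act_add uc\<close>)
    finally show "(\<Oplus>\<^bsub>N\<^esub>x\<in>Z. N.act x (u ((frag_of m \<odot>\<^bsub>fm A Z\<^esub> f) x))) =
      frag_of m \<odot>\<^bsub>N\<^esub> (\<Oplus>\<^bsub>N\<^esub>y\<in>Z. N.act y (u (f y)))" unfolding N.act_def .
  qed
qed

definition single :: "('a, 'z) ring_scheme \<Rightarrow> 'm \<Rightarrow> 'a \<Rightarrow> 'm \<Rightarrow> 'a" where
  "single A x a = (\<lambda>y. if y = x then a else \<zero>\<^bsub>A\<^esub>)"

lemma single_closed: "\<lbrakk>abelian_group A; x \<in> Z; a \<in> carrier A\<rbrakk> \<Longrightarrow> single A x a \<in> carrier (funs A Z)"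
  by (auto simp: single_def abelian_group_def abelian_monoid.zero_closed)

lemma single_add:
  "\<lbrakk>abelian_group A; a \<in> carrier A; b \<in> carrier A\<rbrakk> \<Longrightarrow> single A x (a \<oplus>\<^bsub>A\<^esub> b) = (\<lambda>y. single A x a y \<oplus>\<^bsub>A\<^esub> single A x b y)"
  by (auto simp: single_def fun_eq_iff abelian_group_def abelian_monoid.l_zero abelian_monoid.zero_closed)

lemma shift_single:
  assumes A: "abelian_group A" and Z: "convex_set Z" and x: "x \<in> Z" "m \<in> carrier M" "m \<otimes> x \<in> Z" and a: "a \<in> carrier A"
  shows "shift A Z m (single A x a) = single A (m \<otimes> x) a"
proof
  fix z
  interpret A: abelian_group A by fact
  have finZ: "finite Z" using Z fin by (auto simp: convex_set_def intro: finite_subset)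
  have "(\<Oplus>\<^bsub>A\<^esub>y\<in>Z. if m \<otimes> y = z then single A x a y else \<zero>\<^bsub>A\<^esub>) =
      (\<Oplus>\<^bsub>A\<^esub>y\<in>Z. if y = x then (if m \<otimes> x = z then a else \<zero>\<^bsub>A\<^esub>) else \<zero>\<^bsub>A\<^esub>)"
    using a by (intro A.finsum_cong') (auto simp: single_def)
  also have "\<dots> = (if m \<otimes> x = z then a else \<zero>\<^bsub>A\<^esub>)"
    using A.finsum_single[OF finZ, of x] x a by simp
  finally show "shift A Z m (single A x a) z = single A (m \<otimes> x) a z"
    unfolding shift_def using x by (auto simp: single_def[of A "m \<otimes> x" a])
qed

lemma sum_single:
  assumes A: "abelian_group A" and Z: "convex_set Z" and f: "f \<in> carrier (funs A Z)"
  shows "(\<Oplus>\<^bsub>fm A Z\<^esub>x\<in>Z. single A x (f x)) = f"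
proof
  fix z
  interpret A: abelian_group A by fact
  interpret F: left_module ZM "fm A Z" by (rule left_module_fm[OF A Z])
  have finZ: "finite Z" using Z fin by (auto simp: convex_set_def intro: finite_subset)
  have "(\<Oplus>\<^bsub>fm A Z\<^esub>x\<in>Z. single A x (f x)) z = (\<Oplus>\<^bsub>A\<^esub>x\<in>Z. single A x (f x) z)"
  proof (rule additive_finsum[where h="\<lambda>f. f z"])
    fix g assume "g \<in> carrier (fm A Z)"
    then show "g z \<in> carrier A" by (cases "z \<in> Z") auto
  next
    show "(\<lambda>x. single A x (f x)) \<in> Z \<rightarrow> carrier (fm A Z)"
      using f unfolding fm_simps by (intro Pi_I single_closed[OF A]) auto
  qed (simp_all add: F.N.abelian_group_axioms A)
  also have "\<dots> = (\<Oplus>\<^bsub>A\<^esub>x\<in>Z. if x = z then f z else \<zero>\<^bsub>A\<^esub>)"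
    using f by (intro A.finsum_cong') (auto simp: single_def)
  also have "\<dots> = f z" using A.finsum_single[OF finZ, of z "f z"] f by auto
  finally show "(\<Oplus>\<^bsub>fm A Z\<^esub>x\<in>Z. single A x (f x)) z = f z" .
qed

text \<open>The conditions force \<open>T\<close> to be \<open>Me\<close>. The functions
  concentrated at \<open>e\<close> generate the module, and a lift of them to a cover, additive in
  the coefficient, extends by translation to a section.\<close>

lemma proj_fm:
  assumes A: "zproj A" and e: "e \<in> carrier M" "e \<otimes> e = e" and T: "left_ideal T" "e \<in> T" "\<And>x. x \<in> T \<Longrightarrow> x \<otimes> e = x"
  shows "proj ZM (fm A T)"
proof -
  have aA: "abelian_group A" using A by (simp add: zproj_def)
  note Z = convex_set_left_ideal[OF T(1)]
  let ?P = "fm A T"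
  let ?F = "free_left_module ZM (carrier ?P)"
  let ?q = "lin ZM ?P (\<lambda>x. x)"
  note lP = left_module_fm[OF aA Z]
  note lF = left_module_free[OF ring_ZM, of "carrier ?P"]
  interpret P: ZM_module M ?P by (rule ZM_moduleI[OF monoid_axioms lP])
  interpret F: ZM_module M ?F by (rule ZM_moduleI[OF monoid_axioms lF])
  have q: "?q \<in> lmod_hom ZM ?F ?P" by (rule lin_hom[OF lP]) auto
  have sc: "single A e a \<in> carrier ?P" if "a \<in> carrier A" for a
    unfolding fm_simps by (rule single_closed[OF aA T(2) that])
  \<comment> \<open>Freeness of the coefficients is spent here, to make the lift additive; nothing
    has to be linear over the ring yet.\<close>
  obtain u where u: "\<And>a. a \<in> carrier A \<Longrightarrow> u a \<in> carrier ?F"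
    "\<And>a b. \<lbrakk>a \<in> carrier A; b \<in> carrier A\<rbrakk> \<Longrightarrow> u (a \<oplus>\<^bsub>A\<^esub> b) = u a \<oplus>\<^bsub>?F\<^esub> u b"
    "\<And>a. a \<in> carrier A \<Longrightarrow> ?q (u a) = single A e a"
  proof (rule zproj_lift[OF A F.N.abelian_group_axioms P.N.abelian_group_axioms, of ?q "single A e"])
    fix a assume "a \<in> carrier A"
    then have "single A e a \<in> ?q ` carrier ?F" using lin_id_surj[OF lP] sc by blast
    then show "\<exists>n \<in> carrier ?F. ?q n = single A e a" by (elim imageE) (rule bexI, rule sym)
  next
    fix a b assume "a \<in> carrier A" "b \<in> carrier A"
    then show "single A e (a \<oplus>\<^bsub>A\<^esub> b) = single A e a \<oplus>\<^bsub>?P\<^esub> single A e b"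
      using single_add[OF aA] by simp
  next
    fix thesis u
    assume "\<And>u. \<lbrakk>\<And>a. a \<in> carrier A \<Longrightarrow> u a \<in> carrier ?F;
        \<And>a b. \<lbrakk>a \<in> carrier A; b \<in> carrier A\<rbrakk> \<Longrightarrow> u (a \<oplus>\<^bsub>A\<^esub> b) = u a \<oplus>\<^bsub>?F\<^esub> u b;
        \<And>a. a \<in> carrier A \<Longrightarrow> ?q (u a) = single A e a\<rbrakk> \<Longrightarrow> thesis"
      "\<And>a. a \<in> carrier A \<Longrightarrow> u a \<in> carrier ?F"
      "\<And>a b. \<lbrakk>a \<in> carrier A; b \<in> carrier A\<rbrakk> \<Longrightarrow> u (a \<oplus>\<^bsub>A\<^esub> b) = u a \<oplus>\<^bsub>?F\<^esub> u b"
      "\<And>a. a \<in> carrier A \<Longrightarrow> ?q (u a) = single A e a"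
    then show thesis by blast
  qed (rule lmod_hom_closed[OF q] lmod_hom_add[OF q] sc; assumption)+
  let ?s = "\<lambda>f. \<Oplus>\<^bsub>?F\<^esub>x\<in>T. frag_of x \<odot>\<^bsub>?F\<^esub> u (f x)"
  \<comment> \<open>For a left ideal no product leaves \<open>T\<close>, so the vanishing condition
    of \<open>fm_hom\<close> is vacuous.\<close>
  have s: "?s \<in> lmod_hom ZM ?P ?F"
    by (rule fm_hom[OF aA Z lF u(1,2)]) (use left_ideal_mult[OF T(1)] in auto)
  have "?q (?s f) = f" if f: "f \<in> carrier ?P" for f
  proof -
    have f': "f \<in> carrier (funs A T)" using f by simp
    have fc: "f x \<in> carrier A" if "x \<in> T" for x using f that by auto
    have xM: "x \<in> carrier M" if "x \<in> T" for x using left_ideal_subset[OF T(1)] that by auto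
    have uc: "frag_of x \<odot>\<^bsub>?F\<^esub> u (f x) \<in> carrier ?F" if "x \<in> T" for x
      by (rule F.smult_closed[OF ZM_of_closed[OF xM[OF that]] u(1)[OF fc[OF that]]])
    have "?q (?s f) = (\<Oplus>\<^bsub>?P\<^esub>x\<in>T. ?q (frag_of x \<odot>\<^bsub>?F\<^esub> u (f x)))"
      by (rule lmod_hom_finsum[OF lF lP q]) (use uc in blast)
    also have "\<dots> = (\<Oplus>\<^bsub>?P\<^esub>x\<in>T. single A x (f x))"
    proof (rule P.N.finsum_cong')
      fix x assume x: "x \<in> T"
      have "?q (frag_of x \<odot>\<^bsub>?F\<^esub> u (f x)) = frag_of x \<odot>\<^bsub>?P\<^esub> ?q (u (f x))"
        by (rule lmod_hom_smult[OF q ZM_of_closed[OF xM[OF x]] u(1)[OF fc[OF x]]])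
      also have "\<dots> = frag_of x \<odot>\<^bsub>?P\<^esub> single A e (f x)" by (simp only: u(3)[OF fc[OF x]])
      also have "\<dots> = shift A T x (single A e (f x))"
        by (rule fm_of[OF aA Z xM[OF x] single_closed[OF aA T(2) fc[OF x]]])
      \<comment> \<open>Translating from \<open>e\<close> by \<open>x\<close> arrives at
        \<open>x \<otimes> e\<close>, which is \<open>x\<close> on \<open>T\<close>.\<close>
      also have "\<dots> = single A x (f x)"
        using shift_single[OF aA Z T(2) xM[OF x] _ fc[OF x]] T(3)[OF x] x by simp
      finally show "?q (frag_of x \<odot>\<^bsub>?F\<^esub> u (f x)) = single A x (f x)" .
    next
      show "(\<lambda>x. single A x (f x)) \<in> T \<rightarrow> carrier ?P"
        unfolding fm_simps by (intro Pi_I single_closed[OF aA] fc)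
    qed simp
    also have "\<dots> = f" by (rule sum_single[OF aA Z f'])
    finally show ?thesis .
  qed
  then show ?thesis unfolding proj_def by (intro conjI lP bexI[OF _ s]) blast
qed

end

lemma proj_zero:
  assumes N: "left_module R N" and z: "carrier N = {\<zero>\<^bsub>N\<^esub>}"
  shows "proj R N"
proof -
  interpret N: left_module R N by fact
  interpret F: left_module R "free_left_module R ({} :: nat set)" by (rule left_module_free[OF N.R.ring_axioms])
  have s: "(\<lambda>_ _. \<zero>\<^bsub>R\<^esub>) \<in> lmod_hom R N (free_left_module R ({} :: nat set))" by (rule lmod_homI) auto
  show ?thesis
    by (rule projI_frame[OF N _ s, of "\<lambda>_. \<zero>\<^bsub>N\<^esub>"]) (use z in \<open>auto simp: lin_def\<close>)
qed

lemma lepoll_free_ab: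
  fixes S :: "'s set"
  assumes U: "infinite (UNIV :: 'u set)" and S: "S \<lesssim> (UNIV :: 'u set)"
  shows "carrier (free_ab S) \<lesssim> (UNIV :: 'u set)"
proof -
  have int: "(UNIV :: int set) \<lesssim> (UNIV :: 'u set)"
  proof (rule lepoll_trans)
    show "(UNIV :: int set) \<lesssim> (UNIV :: nat set)"
      unfolding lepoll_def by (intro exI[of _ to_nat]) simp
    show "(UNIV :: nat set) \<lesssim> (UNIV :: 'u set)" using U by (simp add: infinite_le_lepoll)
  qed
  have "Poly_Mapping.lookup ` carrier (free_ab S) \<lesssim> (UNIV :: 'u set)"
    by (rule lepoll_finite_support[OF U S int, of _ 0]) (auto simp: in_keys_iff)
  moreover have "carrier (free_ab S) \<lesssim> Poly_Mapping.lookup ` carrier (free_ab S)"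
    unfolding lepoll_def by (intro exI[of _ Poly_Mapping.lookup]) (auto intro!: inj_onI simp: lookup_inject)
  ultimately show ?thesis by (rule lepoll_trans[rotated])
qed

context fin_monoid_ring begin

section \<open>Green's relations\<close>

abbreviation J_ideal :: "'m \<Rightarrow> 'm set" where "J_ideal \<equiv> principal_two_sided_ideal M"

lemma J_idealI: "\<lbrakk>a \<in> carrier M; b \<in> carrier M\<rbrakk> \<Longrightarrow> a \<otimes> x \<otimes> b \<in> J_ideal x"
  unfolding principal_two_sided_ideal_def by blast

lemma J_ideal_self: "x \<in> carrier M \<Longrightarrow> x \<in> J_ideal x"
  using J_idealI[of \<one> \<one> x] by simp

lemma J_ideal_left: "\<lbrakk>a \<in> carrier M; x \<in> carrier M\<rbrakk> \<Longrightarrow> a \<otimes> x \<in> J_ideal x"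
  using J_idealI[of a \<one> x] by simp

lemma J_ideal_closed: "x \<in> carrier M \<Longrightarrow> J_ideal x \<subseteq> carrier M"
  unfolding principal_two_sided_ideal_def by auto

lemma J_ideal_mono:
  assumes "x \<in> carrier M" "y \<in> J_ideal x"
  shows "J_ideal y \<subseteq> J_ideal x"
proof
  fix z assume "z \<in> J_ideal y"
  then obtain a b c d where *: "a \<in> carrier M" "b \<in> carrier M" "c \<in> carrier M" "d \<in> carrier M"
    "z = c \<otimes> (a \<otimes> x \<otimes> b) \<otimes> d"
    using assms(2) unfolding principal_two_sided_ideal_def by auto
  then have "z = (c \<otimes> a) \<otimes> x \<otimes> (b \<otimes> d)" using assms(1) by (simp add: m_assoc)
  then show "z \<in> J_ideal x" using * J_idealI[of "c \<otimes> a" "b \<otimes> d" x] by simp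
qed

text \<open>The number of J-classes below or equal to that of \<open>x\<close>, so at least 1 on the
  monoid. Inductions use this number in place of the order of J-classes.\<close>

definition height :: "'m \<Rightarrow> nat" where "height x = card (J_ideal ` J_ideal x)"

lemma finite_J_ideal: "x \<in> carrier M \<Longrightarrow> finite (J_ideal x)"
  using J_ideal_closed fin finite_subset by metis

lemma height_mono:
  assumes "x \<in> carrier M" "y \<in> J_ideal x"
  shows "height y \<le> height x"
  unfolding height_def
  by (intro card_mono finite_imageI finite_J_ideal image_mono J_ideal_mono assms)

text \<open>Equal heights mean that the same principal ideals occur below both elements; so the
  ideal of \<open>x\<close> occurs below \<open>y\<close>.\<close>

lemma height_eq:
  assumes x: "x \<in> carrier M" and y: "y \<in> J_ideal x" and h: "height x \<le> height y"
  shows "J_ideal y = J_ideal x"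
proof -
  have yM: "y \<in> carrier M" using J_ideal_closed x y by auto
  have "J_ideal ` J_ideal y = J_ideal ` J_ideal x"
    using h unfolding height_def
    by (intro card_seteq finite_imageI finite_J_ideal image_mono J_ideal_mono x y)
  then have "J_ideal x \<in> J_ideal ` J_ideal y" using J_ideal_self[OF x] by auto
  then obtain z where z: "z \<in> J_ideal y" "J_ideal x = J_ideal z" by auto
  then show ?thesis using J_ideal_mono[OF yM z(1)] J_ideal_mono[OF x y] by auto
qed

lemma height_pos: "x \<in> carrier M \<Longrightarrow> height x > 0"
  unfolding height_def using J_ideal_self finite_J_ideal by (auto simp: card_gt_0_iff)

lemma height_cong: "J_ideal x = J_ideal y \<Longrightarrow> height x = height y"
  by (simp add: height_def)

text \<open>A J-class is determined by the principal ideal that its elements generate, and the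
  ideals are easier to count.\<close>

lemma card_J_classes: "card (J_classes M) = card (J_ideal ` carrier M)"
proof -
  have "J_classes M = (\<lambda>v. {x \<in> carrier M. J_ideal x = v}) ` (J_ideal ` carrier M)"
    unfolding J_classes_def quotient_def J_rel_def by (auto simp: image_iff)
  moreover have "inj_on (\<lambda>v. {x \<in> carrier M. J_ideal x = v}) (J_ideal ` carrier M)"
    by (auto simp: inj_on_def)
  ultimately show ?thesis by (simp add: card_image)
qed

lemma height_le: "x \<in> carrier M \<Longrightarrow> height x \<le> card (J_ideal ` carrier M)"
  unfolding height_def using fin J_ideal_closed by (intro card_mono) auto

text \<open>Stability of finite monoids: iterating \<open>y = u m y v\<close> gives \<open>y = (u m)\<^sup>k y v\<^sup>k\<close>, and two of
  the powers of \<open>u m\<close> coincide.\<close>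

lemma stable:
  assumes m: "m \<in> carrier M" and y: "y \<in> carrier M" and J: "J_ideal (m \<otimes> y) = J_ideal y"
  obtains n where "n \<in> carrier M" "n \<otimes> (m \<otimes> y) = y"
proof -
  have "y \<in> J_ideal (m \<otimes> y)" using J J_ideal_self[OF y] by simp
  then obtain u v where u: "u \<in> carrier M" and v: "v \<in> carrier M" and uv: "y = u \<otimes> (m \<otimes> y) \<otimes> v"
    unfolding principal_two_sided_ideal_def by auto
  define a where "a = u \<otimes> m"
  have a: "a \<in> carrier M" using u m by (simp add: a_def)
  have ay: "y = a \<otimes> y \<otimes> v" using uv u m y v by (simp add: a_def m_assoc)
  have pow: "y = a [^] k \<otimes> y \<otimes> v [^] k" for k :: nat
  proof (induction k)
    case (Suc k)
    have "y = a [^] k \<otimes> (a \<otimes> y \<otimes> v) \<otimes> v [^] k" using Suc ay by simp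
    also have "\<dots> = (a [^] k \<otimes> a) \<otimes> y \<otimes> (v \<otimes> v [^] k)" using a v y by (simp add: m_assoc)
    also have "\<dots> = a [^] Suc k \<otimes> y \<otimes> v [^] Suc k"
      using nat_pow_Suc2[OF v, of k] by simp
    finally show ?case .
  qed (use y in simp)
  have "\<not> inj (\<lambda>k :: nat. a [^] k)"
    using a fin finite_subset[of "range (\<lambda>k :: nat. a [^] k)" "carrier M"] finite_imageD[of "\<lambda>k :: nat. a [^] k" UNIV]
    by auto
  then obtain i j :: nat where ij: "i < j" "a [^] i = a [^] j"
    unfolding inj_def by (metis linorder_neqE_nat)
  have "a [^] (j - i) \<otimes> y = a [^] (j - i) \<otimes> (a [^] i \<otimes> y \<otimes> v [^] i)" using pow[of i] by simp
  also have "\<dots> = (a [^] (j - i) \<otimes> a [^] i) \<otimes> y \<otimes> v [^] i" using a v y by (simp add: m_assoc)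
  also have "a [^] (j - i) \<otimes> a [^] i = a [^] i"
    using nat_pow_mult[OF a, of "j - i" i] ij by (metis le_add_diff_inverse2 less_imp_le)
  finally have "a [^] (j - i) \<otimes> y = y" using pow[of i] by simp
  \<comment> \<open>The exponent is positive, so one factor \<open>u \<otimes> m\<close> can be
    split off; what stands before \<open>m\<close> is the left inverse.\<close>
  moreover obtain k where k: "j - i = Suc k" using ij by (cases "j - i") auto
  ultimately have "a [^] k \<otimes> (u \<otimes> m) \<otimes> y = y" by (simp add: a_def)
  then have "(a [^] k \<otimes> u) \<otimes> (m \<otimes> y) = y" using a u m y by (simp add: m_assoc)
  then show thesis using that a u by (metis m_closed nat_pow_closed)
qed

definition L_class :: "'m \<Rightarrow> 'm set" where
  "L_class x = {y \<in> carrier M. (\<exists>m \<in> carrier M. y = m \<otimes> x) \<and> (\<exists>n \<in> carrier M. x = n \<otimes> y)}"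

lemma L_class_self: "x \<in> carrier M \<Longrightarrow> x \<in> L_class x"
  unfolding L_class_def by (auto intro!: bexI[of _ \<one>])

lemma L_class_subset: "L_class x \<subseteq> carrier M"
  by (auto simp: L_class_def)

lemma L_class_trans:
  assumes "x \<in> carrier M" "y \<in> L_class x" "z \<in> L_class y"
  shows "z \<in> L_class x"
proof -
  obtain m n where m: "m \<in> carrier M" "n \<in> carrier M" "y = m \<otimes> x" "x = n \<otimes> y" and y: "y \<in> carrier M"
    using assms(2) unfolding L_class_def by blast
  obtain m' n' where m': "m' \<in> carrier M" "n' \<in> carrier M" "z = m' \<otimes> y" "y = n' \<otimes> z" and z: "z \<in> carrier M"
    using assms(3) unfolding L_class_def by blast
  have "z = (m' \<otimes> m) \<otimes> x" unfolding m'(3) m(3) by (rule m_assoc[symmetric, OF m'(1) m(1) assms(1)])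
  moreover have "x = (n \<otimes> n') \<otimes> z"
    unfolding m_assoc[OF m(2) m'(2) z] m'(4)[symmetric] by (rule m(4))
  ultimately show ?thesis
    unfolding L_class_def using z m_closed[OF m'(1) m(1)] m_closed[OF m(2) m'(2)] by blast
qed

lemma L_class_sym: "\<lbrakk>x \<in> carrier M; y \<in> L_class x\<rbrakk> \<Longrightarrow> x \<in> L_class y"
  by (auto simp: L_class_def)

lemma L_class_eq: "\<lbrakk>x \<in> carrier M; y \<in> L_class x\<rbrakk> \<Longrightarrow> L_class y = L_class x"
  using L_class_trans L_class_sym L_class_subset by blast

lemma L_class_J:
  assumes "x \<in> carrier M" "y \<in> L_class x"
  shows "J_ideal y = J_ideal x"
proof -
  obtain m n where m: "m \<in> carrier M" "n \<in> carrier M" "y = m \<otimes> x" "x = n \<otimes> y" and y: "y \<in> carrier M"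
    using assms(2) unfolding L_class_def by blast
  have "y \<in> J_ideal x" using J_ideal_left[OF m(1) assms(1)] m(3) by simp
  moreover have "x \<in> J_ideal y" using J_ideal_left[OF m(2) y] m(4) by simp
  ultimately show ?thesis using J_ideal_mono assms(1) y by auto
qed

text \<open>Stability in terms of heights: a left multiplication either stays in the L-class or
  lowers the height.\<close>

lemma L_classI:
  assumes m: "m \<in> carrier M" and y: "y \<in> carrier M" and h: "height y \<le> height (m \<otimes> y)"
  shows "m \<otimes> y \<in> L_class y"
proof -
  have "J_ideal (m \<otimes> y) = J_ideal y" by (rule height_eq[OF y J_ideal_left[OF m y] h])
  then obtain n where "n \<in> carrier M" "n \<otimes> (m \<otimes> y) = y" by (rule stable[OF m y])
  then show ?thesis unfolding L_class_def using m y
    by (intro CollectI conjI bexI[of _ m] bexI[of _ n]) auto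
qed

lemma L_class_height: "\<lbrakk>x \<in> carrier M; y \<in> L_class x\<rbrakk> \<Longrightarrow> height y = height x"
  using L_class_J height_cong by metis

text \<open>An element of \<open>T\<close> multiplied into the class of maximal height cannot have
  lost height, so by stability it was in that class already.\<close>

lemma left_ideal_remove_L_class:
  assumes T: "left_ideal T" and x: "x \<in> T" and max: "\<And>t. t \<in> T \<Longrightarrow> height t \<le> height x"
  shows "left_ideal (T - L_class x)" and "L_class x \<subseteq> T"
proof -
  have TM: "T \<subseteq> carrier M" by (rule left_ideal_subset[OF T])
  have xM: "x \<in> carrier M" using x TM by auto
  show "L_class x \<subseteq> T" using left_ideal_mult[OF T _ x] by (auto simp: L_class_def)
  show "left_ideal (T - L_class x)"
    unfolding left_ideal_def
  proof (intro conjI ballI)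
    fix m t assume m: "m \<in> carrier M" and t: "t \<in> T - L_class x"
    have tM: "t \<in> carrier M" using t TM by auto
    have "m \<otimes> t \<notin> L_class x"
    proof
      assume mt: "m \<otimes> t \<in> L_class x"
      then have "height t \<le> height (m \<otimes> t)" using L_class_height[OF xM] max t by auto
      then have "m \<otimes> t \<in> L_class t" by (rule L_classI[OF m tM])
      then have "t \<in> L_class (m \<otimes> t)" by (rule L_class_sym[OF tM])
      then show False using L_class_trans[OF xM mt] t by auto
    qed
    then show "m \<otimes> t \<in> T - L_class x" using left_ideal_mult[OF T m] t by auto
  qed (use TM in auto)
qed

text \<open>The height of the intermediate product is squeezed between two equal heights.\<close>

lemma convex_L_class:
  assumes x: "x \<in> carrier M"
  shows "convex_set (L_class x)"
  unfolding convex_set_def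
proof (intro conjI ballI impI)
  fix m n y assume m: "m \<in> carrier M" and n: "n \<in> carrier M" and y: "y \<in> L_class x" and l: "m \<otimes> (n \<otimes> y) \<in> L_class x"
  have yM: "y \<in> carrier M" using y L_class_subset by auto
  have "height y = height (m \<otimes> (n \<otimes> y))" using L_class_height[OF x] y l by simp
  also have "\<dots> \<le> height (n \<otimes> y)" by (rule height_mono) (use m n yM J_ideal_left in auto)
  finally have "n \<otimes> y \<in> L_class y" by (rule L_classI[OF n yM])
  then show "n \<otimes> y \<in> L_class x" by (rule L_class_trans[OF x y])
qed (rule L_class_subset)

text \<open>From \<open>x \<otimes> t \<otimes> x = x\<close> the product
  \<open>t \<otimes> x\<close> is idempotent and generates the same left ideal as
  \<open>x\<close>.\<close>

lemma L_class_idempotent: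
  assumes "regular_monoid M" and x: "x \<in> carrier M"
  obtains e where "e \<in> carrier M" "e \<otimes> e = e" "e \<in> L_class x"
proof -
  obtain t where t: "t \<in> carrier M" "x \<otimes> t \<otimes> x = x" using assms by (auto simp: regular_monoid_def)
  have "(t \<otimes> x) \<otimes> (t \<otimes> x) = t \<otimes> (x \<otimes> t \<otimes> x)" using t x by (simp add: m_assoc)
  then have "(t \<otimes> x) \<otimes> (t \<otimes> x) = t \<otimes> x" using t by simp
  moreover have "t \<otimes> x \<in> L_class x"
    unfolding L_class_def
  proof (intro CollectI conjI)
    show "\<exists>m \<in> carrier M. t \<otimes> x = m \<otimes> x" using t by blast
    show "\<exists>n \<in> carrier M. x = n \<otimes> (t \<otimes> x)" using t x by (intro bexI[of _ x]) (simp_all add: m_assoc)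
  qed (use t x in simp)
  ultimately show thesis using that t x by blast
qed

lemma L_class_mult_idempotent:
  assumes "e \<in> carrier M" "e \<otimes> e = e" "x \<in> L_class e"
  shows "x \<otimes> e = x"
  using assms by (auto simp: L_class_def m_assoc)

text \<open>For an idempotent this set is \<open>Me\<close>.\<close>

lemma left_ideal_idempotent:
  assumes e: "e \<in> carrier M" "e \<otimes> e = e"
  shows "left_ideal {x \<in> carrier M. x \<otimes> e = x}"
  unfolding left_ideal_def using e by (auto simp: m_assoc)

section \<open>Modules supported on left ideals and on \<open>\<L>\<close>-classes\<close>

lemma small_fm:
  fixes A :: "('a, 'z) ring_scheme"
  assumes "infinite (UNIV :: 'u set)" "Z \<subseteq> carrier M" "carrier A \<lesssim> (UNIV :: 'u set)"
  shows "carrier (fm A Z) \<lesssim> (UNIV :: 'u set)"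
proof (rule lepoll_finite_support[OF assms(1) _ assms(3)])
  have finZ: "finite Z" using assms(2) fin by (rule finite_subset)
  then show "Z \<lesssim> (UNIV :: 'u set)" by (rule finite_lepoll_infinite[OF assms(1)])
  fix f assume f: "f \<in> carrier (fm A Z)"
  have "{x. f x \<noteq> \<zero>\<^bsub>A\<^esub>} \<subseteq> Z" using f by auto
  then show "(\<forall>x \<in> Z. f x \<in> carrier A) \<and> (\<forall>x. x \<notin> Z \<longrightarrow> f x = \<zero>\<^bsub>A\<^esub>) \<and> finite {x. f x \<noteq> \<zero>\<^bsub>A\<^esub>}"
    using f finZ finite_subset by auto
qed

text \<open>The left ideal of an idempotent \<open>e\<close> in the class gives a projective module
  with quotient \<open>A[L]\<close> and with kernel supported on smaller heights. The bound for that
  kernel is a hypothesis, as the lemma is used both inside the induction on left ideals and after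
  it. Heights start at 1, which explains \<open>Suc k\<close> against \<open>k\<close>.\<close>

lemma pdim_fm_L_class_aux:
  fixes A :: "('a, 'z) ring_scheme"
  assumes big: "big_type TYPE('u) ZM" and reg: "regular_monoid M" and A: "zproj A" "carrier A \<lesssim> (UNIV :: 'u set)"
    and IH: "\<And>T' k'. \<lbrakk>k = Suc k'; left_ideal T'; \<And>t. t \<in> T' \<Longrightarrow> height t \<le> Suc k'\<rbrakk> \<Longrightarrow> pdim_le TYPE('u) ZM k' (fm A T')"
    and x: "x \<in> carrier M" and h: "height x \<le> Suc k"
  shows "pdim_le TYPE('u) ZM k (fm A (L_class x))"
proof -
  interpret B: big_type ZM "TYPE('u)" by fact
  have aA: "abelian_group A" using A by (simp add: zproj_def)
  obtain e where e: "e \<in> carrier M" "e \<otimes> e = e" "e \<in> L_class x" by (rule L_class_idempotent[OF reg x])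
  have Le: "L_class x = L_class e" using L_class_eq[OF x e(3)] by simp
  have he: "height e \<le> Suc k" using L_class_height[OF x e(3)] h by simp
  let ?T = "{x \<in> carrier M. x \<otimes> e = x}"
  have T: "left_ideal ?T" by (rule left_ideal_idempotent[OF e(1,2)])
  have eT: "e \<in> ?T" using e by simp
  have hT: "height t \<le> height e" if "t \<in> ?T" for t
    using height_mono[OF e(1) J_ideal_left[of t e]] that e by auto
  note rem = left_ideal_remove_L_class[OF T eT hT]
  have diff: "?T - (?T - L_class e) = L_class e" using rem(2) by auto
  have small: "carrier (fm A ?T) \<lesssim> (UNIV :: 'u set)"
    by (rule small_fm[OF B.infinite_U _ A(2)]) auto
  have proj: "proj ZM (fm A ?T)" by (rule proj_fm[OF A(1) e(1,2) T eT]) auto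
  \<comment> \<open>An element of \<open>Me\<close> as high as \<open>e\<close> would be in the
    class of \<open>e\<close> by stability.\<close>
  have lt: "height t < height e" if t: "t \<in> ?T - L_class e" for t
  proof (rule ccontr)
    assume "\<not> height t < height e"
    then have "t \<otimes> e \<in> L_class e" using t e by (intro L_classI) auto
    then show False using t by simp
  qed
  have s: "ses ZM (fm A (?T - L_class e)) (\<lambda>f. f) (fm A ?T)
      (\<lambda>f x. if x \<in> ?T - (?T - L_class e) then f x else \<zero>\<^bsub>A\<^esub>) (fm A (L_class e))"
    using ses_fm[OF aA T rem(1)] unfolding diff by blast
  show ?thesis
  proof (cases k)
    case 0
    \<comment> \<open>At height 1 there is nothing below, so the class is all of \<open>Me\<close>
      and its module is projective.\<close>
    have "?T - L_class e = {}" using lt he 0 height_pos by fastforce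
    then have "L_class e = ?T" using rem(2) by auto
    then show ?thesis using B.pdim_le_proj[OF proj small] Le by simp
  next
    case (Suc k')
    have "pdim_le TYPE('u) ZM k' (fm A (?T - L_class e))"
    proof (rule IH[OF Suc rem(1)])
      fix t assume "t \<in> ?T - L_class e"
      from lt[OF this] show "height t \<le> Suc k'" using he Suc by simp
    qed
    from B.pdim_le_cokernel[OF s this B.pdim_le_proj[OF proj small]]
    show ?thesis using Suc Le by simp
  qed
qed

text \<open>The outer induction lowers the height and serves the L-classes. The inner one, on the
  size of \<open>T\<close>, removes an L-class of maximal height and treats the module as an
  extension.\<close>

lemma pdim_fm_left_ideal:
  fixes A :: "('a, 'z) ring_scheme"
  assumes big: "big_type TYPE('u) ZM" and reg: "regular_monoid M" and A: "zproj A" "carrier A \<lesssim> (UNIV :: 'u set)"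
  shows "\<lbrakk>left_ideal T; \<And>t. t \<in> T \<Longrightarrow> height t \<le> Suc k\<rbrakk> \<Longrightarrow> pdim_le TYPE('u) ZM k (fm A T)"
proof (induction k arbitrary: T rule: less_induct)
  case (less k)
  note IH = less.IH
  interpret B: big_type ZM "TYPE('u)" by fact
  have aA: "abelian_group A" using A by (simp add: zproj_def)
  have small: "carrier (fm A Z) \<lesssim> (UNIV :: 'u set)" if "Z \<subseteq> carrier M" for Z
    by (rule small_fm[OF B.infinite_U that A(2)])
  have "finite T" using left_ideal_subset[OF less.prems(1)] fin by (rule finite_subset)
  then show ?case using less.prems
  proof (induction "card T" arbitrary: T rule: less_induct)
    case (less T)
    note T = less.prems(2)
    show ?case
    proof (cases "T = {}")
      case True
      have "proj ZM (fm A T)"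
        by (rule proj_zero[OF left_module_fm[OF aA convex_set_left_ideal[OF T]]]) (auto simp: True)
      then show ?thesis by (rule B.pdim_le_proj[OF _ small[OF left_ideal_subset[OF T]]])
    next
      case False
      \<comment> \<open>Maximal height is what leaves a left ideal when the class is
        removed.\<close>
      have "Max (height ` T) \<in> height ` T" using False less.prems(1) by (intro Max_in) auto
      then obtain x where x: "x \<in> T" "height x = Max (height ` T)" by auto
      have max: "height t \<le> height x" if "t \<in> T" for t using x(2) that less.prems(1) by simp
      have xM: "x \<in> carrier M" using left_ideal_subset[OF T] x by auto
      note rem = left_ideal_remove_L_class[OF T x(1) max]
      have diff: "T - (T - L_class x) = L_class x" using rem(2) by auto
      have "card (T - L_class x) < card T"
        using less.prems(1) x(1) L_class_self[OF xM] by (intro psubset_card_mono) auto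
      then have 1: "pdim_le TYPE('u) ZM k (fm A (T - L_class x))"
        by (rule less.hyps) (use less.prems rem(1) in auto)
      have 2: "pdim_le TYPE('u) ZM k (fm A (L_class x))"
        by (rule pdim_fm_L_class_aux[OF big reg A _ xM less.prems(3)[OF x(1)]]) (rule IH, auto)
      have s: "ses ZM (fm A (T - L_class x)) (\<lambda>f. f) (fm A T)
          (\<lambda>f y. if y \<in> T - (T - L_class x) then f y else \<zero>\<^bsub>A\<^esub>) (fm A (L_class x))"
        using ses_fm[OF aA T rem(1)] unfolding diff by blast
      show ?thesis by (rule B.pdim_le_ext[OF s 1 2 small[OF left_ideal_subset[OF T]]])
    qed
  qed
qed

text \<open>Present \<open>A\<close> by the free abelian group on its own elements. The kernel is
  free again, so \<open>A[L]\<close> is a cokernel of two modules already bounded by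
  \<open>k\<close>.\<close>

lemma pdim_fm_L_class:
  fixes A :: "('a, 'z) ring_scheme"
  assumes big: "big_type TYPE('u) ZM" and reg: "regular_monoid M"
    and A: "abelian_group A" "carrier A \<lesssim> (UNIV :: 'u set)"
    and x: "x \<in> carrier M" and h: "height x \<le> Suc k"
  shows "pdim_le TYPE('u) ZM (Suc k) (fm A (L_class x))"
proof -
  interpret B: big_type ZM "TYPE('u)" by fact
  have zp: "pdim_le TYPE('u) ZM k (fm A' (L_class x))"
    if "zproj A'" "carrier A' \<lesssim> (UNIV :: 'u set)" for A' :: "('a \<Rightarrow>\<^sub>0 int) ring"
    by (rule pdim_fm_L_class_aux[OF big reg that _ x h]) (rule pdim_fm_left_ideal[OF big reg that])
  let ?F = "free_ab (carrier A)"
  let ?h = "flift (carrier A) A (\<lambda>x. x)"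
  interpret h: free_lift A "carrier A" "\<lambda>x. x" by (rule free_liftI) (use A in auto)
  have small: "carrier ?F \<lesssim> (UNIV :: 'u set)" by (rule lepoll_free_ab[OF B.infinite_U A(2)])
  let ?K = "?F\<lparr>carrier := {x \<in> carrier ?F. ?h x = \<zero>\<^bsub>A\<^esub>}\<rparr>"
  have zK: "zproj ?K"
  proof (rule zproj_subgroup_free)
    fix x y assume "x \<in> {x \<in> carrier ?F. ?h x = \<zero>\<^bsub>A\<^esub>}" "y \<in> {x \<in> carrier ?F. ?h x = \<zero>\<^bsub>A\<^esub>}"
    then show "x - y \<in> {x \<in> carrier ?F. ?h x = \<zero>\<^bsub>A\<^esub>}"
      using keys_diff[of x y] by (auto simp: h.diff a_minus_def h.r_neg)
  qed (auto simp: h.zero)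
  have sK: "carrier ?K \<lesssim> (UNIV :: 'u set)"
    by (rule lepoll_trans[OF subset_imp_lepoll small]) auto
  have s: "ses ZM (fm ?K (L_class x)) (\<lambda>f. f) (fm ?F (L_class x)) (\<lambda>f x. ?h (f x)) (fm A (L_class x))"
  proof (rule ses_fm_coeff[OF abelian_group_free_ab A(1) convex_L_class[OF x]])
    show "abelian_group ?K" using zK by (simp add: zproj_def)
    show "?h ` carrier ?F = carrier A"
    proof (intro equalityI subsetI)
      fix a assume "a \<in> carrier A"
      then show "a \<in> ?h ` carrier ?F" by (intro image_eqI[of _ _ "frag_of a"]) (auto simp: h.of)
    qed (auto intro!: h.closed)
  qed (auto intro!: h.closed h.add)
  show ?thesis
    by (rule B.pdim_le_cokernel[OF s zp[OF zK sK] B.pdim_le_mono[OF zp[OF zproj_free_ab small]]]) simp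
qed

end

section \<open>Modules annihilated by an ideal of the monoid\<close>

context fin_monoid_ring begin

text \<open>A union of J-classes closed downwards. It may be empty, and the empty one starts the
  induction.\<close>

definition two_sided :: "'m set \<Rightarrow> bool" where
  "two_sided I \<longleftrightarrow> I \<subseteq> carrier M \<and> (\<forall>x \<in> I. J_ideal x \<subseteq> I)"

lemma two_sided_mult: "\<lbrakk>two_sided I; x \<in> I; a \<in> carrier M\<rbrakk> \<Longrightarrow> a \<otimes> x \<in> I"
  using J_ideal_left unfolding two_sided_def by blast

text \<open>For a two-sided \<open>I\<close> these are the modules over the monoid ring modulo the
  span of \<open>I\<close>; this encoding avoids forming the quotient ring.\<close>

definition killed :: "'m set \<Rightarrow> ('m \<Rightarrow>\<^sub>0 int, 'a) module \<Rightarrow> bool" where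
  "killed I N \<longleftrightarrow> (\<forall>m \<in> I. \<forall>x \<in> carrier N. frag_of m \<odot>\<^bsub>N\<^esub> x = \<zero>\<^bsub>N\<^esub>)"

text \<open>Vanishing is demanded after applying \<open>h\<close>, so both copies of a killed module
  and quotients by a submodule containing all products are covered.\<close>

lemma killed_image:
  assumes N: "left_module ZM N" and L: "left_module ZM L" and h: "h \<in> lmod_hom ZM N L" "h ` carrier N = carrier L"
    and I: "I \<subseteq> carrier M" and k: "\<And>m x. \<lbrakk>m \<in> I; x \<in> carrier N\<rbrakk> \<Longrightarrow> h (frag_of m \<odot>\<^bsub>N\<^esub> x) = \<zero>\<^bsub>L\<^esub>"
  shows "killed I L"
  unfolding killed_def
proof (intro ballI)
  fix m y assume m: "m \<in> I" and "y \<in> carrier L"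
  then obtain x where x: "x \<in> carrier N" "y = h x" using h(2) by auto
  have "frag_of m \<odot>\<^bsub>L\<^esub> h x = h (frag_of m \<odot>\<^bsub>N\<^esub> x)"
    by (rule lmod_hom_smult[OF h(1) _ x(1), symmetric]) (use m I in auto)
  then show "frag_of m \<odot>\<^bsub>L\<^esub> y = \<zero>\<^bsub>L\<^esub>" using k[OF m x(1)] x(2) by simp
qed

text \<open>In the finite monoid \<open>eMe\<close> a left invertible element is a unit:
  multiplication by it is injective, hence surjective. The group of units is trivial by
  aperiodicity.\<close>

lemma aperiodic_left_inverse:
  assumes ap: "aperiodic_monoid M" and e: "e \<in> carrier M" "e \<otimes> e = e"
    and z: "z \<in> carrier M" "e \<otimes> z = z" "z \<otimes> e = z" and w: "w \<in> carrier M" "w \<otimes> z = e"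
  shows "z = e"
proof -
  let ?C = "{e \<otimes> m \<otimes> e | m. m \<in> carrier M}"
  have C: "x \<in> carrier M \<and> e \<otimes> x = x \<and> x \<otimes> e = x" if x: "x \<in> ?C" for x
  proof -
    obtain m where "m \<in> carrier M" "x = e \<otimes> m \<otimes> e" using x by auto
    then show ?thesis using e by (simp add: m_assoc) (metis m_assoc m_closed e)
  qed
  have inC: "x \<in> ?C" if "x \<in> carrier M" "e \<otimes> x = x" "x \<otimes> e = x" for x
    using that by (intro CollectI exI[of _ x]) simp
  have finC: "finite ?C" by (rule finite_subset[OF _ fin]) (use C in blast)
  \<comment> \<open>The given left inverse is cut down to \<open>eMe\<close>.\<close>
  let ?w = "e \<otimes> w \<otimes> e"
  have wz: "?w \<otimes> z = e" using e z w by (simp add: m_assoc)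
  have wC: "?w \<in> ?C" using w by blast
  have zC: "z \<in> ?C" by (rule inC[OF z])
  have "inj_on (\<lambda>a. z \<otimes> a) ?C"
  proof (rule inj_onI)
    fix a b assume ab: "a \<in> ?C" "b \<in> ?C" "z \<otimes> a = z \<otimes> b"
    have "?w \<otimes> z \<otimes> a = ?w \<otimes> z \<otimes> b"
      using ab C[OF ab(1)] C[OF ab(2)] C[OF wC] z(1) by (simp add: m_assoc)
    then show "a = b" unfolding wz using C[OF ab(1)] C[OF ab(2)] by simp
  qed
  moreover have "(\<lambda>a. z \<otimes> a) ` ?C \<subseteq> ?C"
  proof safe
    fix m assume "m \<in> carrier M"
    then show "\<exists>m'. z \<otimes> (e \<otimes> m \<otimes> e) = e \<otimes> m' \<otimes> e \<and> m' \<in> carrier M"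
      using e z by (intro exI[of _ "z \<otimes> m"]) (simp add: m_assoc[symmetric])
  qed
  ultimately have "(\<lambda>a. z \<otimes> a) ` ?C = ?C" by (rule endo_inj_surj[OF finC, rotated])
  moreover have "e \<in> ?C" by (rule inC) (use e in auto)
  ultimately have "e \<in> (\<lambda>a. z \<otimes> a) ` ?C" by simp
  \<comment> \<open>Surjectivity yields a right inverse, which must coincide with the left
    one.\<close>
  then obtain v where v: "v \<in> ?C" "e = z \<otimes> v" by (rule imageE)
  have "v = ?w \<otimes> z \<otimes> v" unfolding wz using C[OF v(1)] by simp
  also have "\<dots> = ?w \<otimes> e" using C[OF v(1)] C[OF wC] z(1) v(2) by (simp add: m_assoc)
  finally have "v = ?w" using C[OF wC] by simp
  then have "z \<in> Units (corner_monoid M e)"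
    using zC wC wz v(2) by (auto simp: Units_def corner_monoid_def)
  then have "z \<in> carrier (maximal_subgroup M e)" by (simp add: maximal_subgroup_def units_of_carrier)
  moreover have "e \<in> carrier (maximal_subgroup M e)"
    using \<open>e \<in> ?C\<close> e(2) by (auto simp: maximal_subgroup_def units_of_carrier Units_def corner_monoid_def)
  moreover have "\<exists>a. carrier (maximal_subgroup M e) = {a}"
    using ap e unfolding aperiodic_monoid_def trivial_group_def by blast
  ultimately show ?thesis by auto
qed

text \<open>If \<open>e \<otimes> y\<close> is still in the class, it lies in \<open>eMe\<close> and
  some element carries it back to \<open>e\<close>, so it equals \<open>e\<close>. Aperiodicity
  enters the proof here.\<close>

lemma shift_idempotent:
  assumes ap: "aperiodic_monoid M" and A: "abelian_group A" and e: "e \<in> carrier M" "e \<otimes> e = e"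
    and f: "f \<in> carrier (funs A (L_class e))"
  obtains a where "a \<in> carrier A" "shift A (L_class e) e f = single A e a"
proof -
  interpret A: abelian_group A by fact
  let ?Z = "L_class e"
  have ey: "e \<otimes> y = e" if y: "y \<in> ?Z" and "e \<otimes> y \<in> ?Z" for y
  proof (rule aperiodic_left_inverse[OF ap e])
    have yM: "y \<in> carrier M" using y L_class_subset by auto
    show "e \<otimes> y \<in> carrier M" using e yM by simp
    show "e \<otimes> (e \<otimes> y) = e \<otimes> y" using e yM by (simp flip: m_assoc)
    show "e \<otimes> y \<otimes> e = e \<otimes> y" using L_class_mult_idempotent[OF e y] e yM by (simp add: m_assoc)
    obtain n where n: "n \<in> carrier M" "e = n \<otimes> (e \<otimes> y)" using \<open>e \<otimes> y \<in> ?Z\<close> unfolding L_class_def by blast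
    from n(1) n(2)[symmetric]
    show "(SOME n. n \<in> carrier M \<and> n \<otimes> (e \<otimes> y) = e) \<in> carrier M"
      "(SOME n. n \<in> carrier M \<and> n \<otimes> (e \<otimes> y) = e) \<otimes> (e \<otimes> y) = e"
      using someI[of "\<lambda>n. n \<in> carrier M \<and> n \<otimes> (e \<otimes> y) = e" n] by blast+
  qed
  have c: "shift A ?Z e f x \<in> carrier A" for x
    using f by (auto simp: shift_def intro!: A.finsum_closed)
  have "shift A ?Z e f x = \<zero>\<^bsub>A\<^esub>" if "x \<noteq> e" for x
  proof (cases "x \<in> ?Z")
    case True
    have "(\<Oplus>\<^bsub>A\<^esub>y\<in>?Z. if e \<otimes> y = x then f y else \<zero>\<^bsub>A\<^esub>) = (\<Oplus>\<^bsub>A\<^esub>y\<in>?Z. \<zero>\<^bsub>A\<^esub>)"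
      using ey True that by (intro A.finsum_cong') auto
    then show ?thesis by (simp add: shift_def)
  qed (simp add: shift_def)
  then have "shift A ?Z e f = single A e (shift A ?Z e f e)" by (auto simp: single_def fun_eq_iff)
  then show thesis using that c by blast
qed

text \<open>Here \<open>p\<close> bounds the number of J-classes outside \<open>I\<close>. Splitting
  off one of them bounds kernel and cokernel of the multiplication map by the induction hypothesis;
  passing from the kernel to the image raises the bound by one.\<close>

lemma pd_killed:
  fixes N :: "('m \<Rightarrow>\<^sub>0 int, 'u) module"
  assumes big: "big_type TYPE('u) ZM" and reg: "regular_monoid M" and ap: "aperiodic_monoid M"
  shows "\<lbrakk>two_sided I; left_module ZM N; killed I N; card (J_ideal ` (carrier M - I)) \<le> p\<rbrakk> \<Longrightarrow>
    pd ZM (card (J_ideal ` carrier M) - 1 + p) N"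
proof (induction p arbitrary: I N)
  \<comment> \<open>If \<open>I\<close> is everything, the identity acts as zero and the module
    vanishes.\<close>
  have zero: "pd ZM k N" if "carrier M - I = {}" "left_module ZM N" "killed I N"
    for k I and N :: "('m \<Rightarrow>\<^sub>0 int, 'u) module"
  proof -
    interpret B: big_type ZM "TYPE('u)" by (rule big)
    interpret N: ZM_module M N by (rule ZM_moduleI[OF monoid_axioms that(2)])
    have "x = \<zero>\<^bsub>N\<^esub>" if "x \<in> carrier N" for x
    proof -
      have "\<one> \<in> I" using \<open>carrier M - I = {}\<close> by auto
      then have "N.act \<one> x = \<zero>\<^bsub>N\<^esub>" using \<open>killed I N\<close> that by (simp add: killed_def N.act_def)
      then show ?thesis using N.act_one[OF that] by simp
    qed
    then have "proj ZM N" using N.N.zero_closed by (intro proj_zero[OF that(2)]) auto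
    then show ?thesis using B.pd_mono[of 0 N k] by simp
  qed
  {
    case 0
    have "carrier M - I = {}" using 0(4) fin by simp
    then show ?case using zero 0 by blast
  next
    case (Suc p)
    note I = Suc.prems(1) and lN = Suc.prems(2) and kN = Suc.prems(3)
    let ?n = "card (J_ideal ` carrier M)"
    interpret B: big_type ZM "TYPE('u)" by (rule big)
    interpret N: ZM_module M N by (rule ZM_moduleI[OF monoid_axioms lN])
    show ?case
    proof (cases "carrier M - I = {}")
      case True
      then show ?thesis using zero lN kN by blast
    next
      case False
      have "Min (height ` (carrier M - I)) \<in> height ` (carrier M - I)" using False fin by (intro Min_in) auto
      then obtain x where x: "x \<in> carrier M" "x \<notin> I" "height x = Min (height ` (carrier M - I))" by auto
      obtain e where e: "e \<in> carrier M" "e \<otimes> e = e" "e \<in> L_class x" by (rule L_class_idempotent[OF reg x(1)])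
      have eI: "e \<notin> I"
      proof
        assume "e \<in> I"
        moreover obtain k where "k \<in> carrier M" "x = k \<otimes> e" using e(3) by (auto simp: L_class_def)
        ultimately show False using two_sided_mult[OF I] x(2) by auto
      qed
      have min: "height e \<le> height m" if "m \<in> carrier M" "m \<notin> I" for m
        using that fin x(3) L_class_height[OF x(1) e(3)] by simp
      \<comment> \<open>By minimality of the height, whatever lies strictly below \<open>e\<close>
        is already in \<open>I\<close>.\<close>
      have ideal: "J_ideal m = J_ideal e" if "m \<in> J_ideal e" "m \<notin> I" for m
        using height_eq[OF e(1) that(1) min] that J_ideal_closed[OF e(1)] by auto
      define I' where "I' = I \<union> {y \<in> carrier M. J_ideal y = J_ideal e}"
      have I': "two_sided I'"
        unfolding two_sided_def
      proof (intro conjI ballI subsetI)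
        fix y z assume y: "y \<in> I'" and z: "z \<in> J_ideal y"
        show "z \<in> I'"
        proof (cases "y \<in> I")
          case True
          then show ?thesis using I z by (auto simp: two_sided_def I'_def)
        next
          case False
          then have "z \<in> J_ideal e" using y z by (auto simp: I'_def)
          then show ?thesis using ideal[of z] J_ideal_closed[OF e(1)] by (auto simp: I'_def)
        qed
      qed (use I in \<open>auto simp: two_sided_def I'_def\<close>)
      have I'M: "I' \<subseteq> carrier M" using I' by (simp add: two_sided_def)
      have card: "card (J_ideal ` (carrier M - I')) \<le> p"
      proof -
        have "J_ideal ` (carrier M - I') \<subset> J_ideal ` (carrier M - I)"
          using e(1) eI by (auto simp: I'_def)
        then have "card (J_ideal ` (carrier M - I')) < card (J_ideal ` (carrier M - I))"
          by (rule psubset_card_mono[rotated]) (use fin in simp)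
        then show ?thesis using Suc.prems(4) by simp
      qed
      \<comment> \<open>The set \<open>eN\<close> is an additive subgroup on which \<open>e\<close>
        acts as the identity; it is not a submodule in general, and only its group structure is
        used.\<close>
      define H where "H = N.act e ` carrier N"
      let ?A = "N\<lparr>carrier := H\<rparr>" and ?Z = "L_class e"
      have H: "H \<subseteq> carrier N" using N.act_closed[OF e(1)] by (auto simp: H_def)
      have aH: "N.act e a = a" if "a \<in> H" for a
        using that e N.act_mult[OF e(1) e(1)] by (auto simp: H_def)
      have aA: "abelian_group ?A"
      proof (rule abelian_group_sub[OF N.N.abelian_group_axioms H])
        show "\<zero>\<^bsub>N\<^esub> \<in> H" unfolding H_def using N.act_zero[OF e(1)] N.N.zero_closed by (intro image_eqI[of _ _ "\<zero>\<^bsub>N\<^esub>"]) auto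
        fix a b assume ab: "a \<in> H" "b \<in> H"
        then have "a \<ominus>\<^bsub>N\<^esub> b = N.act e (a \<ominus>\<^bsub>N\<^esub> b)"
          using H aH by (simp add: N.act_minus[OF e(1)] subset_iff)
        then show "a \<ominus>\<^bsub>N\<^esub> b \<in> H" unfolding H_def using ab H by (intro image_eqI[of _ _ "a \<ominus>\<^bsub>N\<^esub> b"]) auto
      qed
      interpret A: abelian_group ?A by (rule aA)
      have cZ: "convex_set ?Z" by (rule convex_L_class[OF e(1)])
      have ZM: "?Z \<subseteq> carrier M" by (rule L_class_subset)
      have eZ: "e \<in> ?Z" by (rule L_class_self[OF e(1)])
      have ZI: "y \<notin> I" if y: "y \<in> ?Z" for y
      proof
        assume "y \<in> I"
        moreover obtain k where "k \<in> carrier M" "e = k \<otimes> y" using y by (auto simp: L_class_def)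
        ultimately show False using two_sided_mult[OF I] eI by auto
      qed
      let ?F = "fm ?A ?Z"
      let ?\<phi> = "\<lambda>f. \<Oplus>\<^bsub>N\<^esub>x\<in>?Z. frag_of x \<odot>\<^bsub>N\<^esub> f x"
      note lF = left_module_fm[OF aA cZ]
      interpret F: ZM_module M ?F by (rule ZM_moduleI[OF monoid_axioms lF])
      have Fact: "F.act m f = shift ?A ?Z m f" if "m \<in> carrier M" "f \<in> carrier ?F" for m f
        unfolding F.act_def using fm_of[OF aA cZ that(1)] that(2) by simp
      \<comment> \<open>A product leaving the class has lost height, so it is in \<open>I\<close>
        and annihilates \<open>N\<close>.\<close>
      have \<phi>: "?\<phi> \<in> lmod_hom ZM ?F N"
      proof (rule fm_hom[OF aA cZ lN, of "\<lambda>x. x"])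
        fix m y a assume m: "m \<in> carrier M" and y: "y \<in> ?Z" and my: "m \<otimes> y \<notin> ?Z" and a: "a \<in> carrier ?A"
        have yM: "y \<in> carrier M" using y ZM by auto
        have "m \<otimes> y \<in> I"
        proof (rule ccontr)
          assume "m \<otimes> y \<notin> I"
          then have "height y \<le> height (m \<otimes> y)" using min[of "m \<otimes> y"] m yM L_class_height[OF e(1) y] by simp
          from L_class_trans[OF e(1) y L_classI[OF m yM this]] show False using my by simp
        qed
        then show "frag_of (m \<otimes> y) \<odot>\<^bsub>N\<^esub> a = \<zero>\<^bsub>N\<^esub>" using kN a H by (auto simp: killed_def)
      qed (use H in auto)
      have \<phi>s: "?\<phi> (single ?A e a) = a" if a: "a \<in> H" for a
      proof -
        have "?\<phi> (single ?A e a) = (\<Oplus>\<^bsub>N\<^esub>x\<in>?Z. if x = e then a else \<zero>\<^bsub>N\<^esub>)"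
        proof (rule N.N.finsum_cong')
          fix x assume x: "x \<in> ?Z"
          then have "x \<in> carrier M" using ZM by auto
          then show "frag_of x \<odot>\<^bsub>N\<^esub> single ?A e a x = (if x = e then a else \<zero>\<^bsub>N\<^esub>)"
            using aH[OF a] N.act_zero by (auto simp: single_def N.act_def)
        qed (use a H in auto)
        also have "\<dots> = a"
          using N.N.finsum_single[of ?Z e a] eZ a H finite_subset[OF ZM fin] by auto
        finally show ?thesis .
      qed
      have sH: "single ?A e a \<in> carrier ?F" if "a \<in> H" for a
        unfolding fm_simps by (rule single_closed[OF aA eZ]) (use that in simp)
      \<comment> \<open>Elements of the new J-class factor through \<open>e\<close>, so it suffices
        to control the action of \<open>e\<close>.\<close>
      have decomp: "\<exists>a \<in> carrier M. \<exists>b \<in> carrier M. m = a \<otimes> (e \<otimes> b)" if "m \<in> I'" "m \<notin> I" for m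
      proof -
        have mM: "m \<in> carrier M" "J_ideal m = J_ideal e" using that by (auto simp: I'_def)
        have "m \<in> J_ideal e" using J_ideal_self[OF mM(1)] mM(2) by simp
        then obtain a b where "a \<in> carrier M" "b \<in> carrier M" "m = a \<otimes> e \<otimes> b"
          unfolding principal_two_sided_ideal_def by auto
        then show ?thesis using e by (auto simp: m_assoc)
      qed
      let ?K = "lmod_kernel ?F N ?\<phi>"
      note lK = lmod_kernel[OF lF lN \<phi>]
      have Kact: "F.act m f \<in> carrier ?K" if "m \<in> carrier M" "f \<in> carrier ?K" for m f
        using left_module.smult_closed[OF lK ZM_of_closed[OF that(1)] that(2)] unfolding F.act_def by simp
      \<comment> \<open>A product with a factor in \<open>I\<close> remains in \<open>I\<close> and
        thus never reaches the class of \<open>e\<close>.\<close>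
      have killI: "F.act m f = \<zero>\<^bsub>?F\<^esub>" if m: "m \<in> I" and f: "f \<in> carrier ?F" for m f
      proof -
        have mM: "m \<in> carrier M" using m I by (auto simp: two_sided_def)
        have "shift ?A ?Z m f x = \<zero>\<^bsub>?A\<^esub>" for x
        proof (cases "x \<in> ?Z")
          case True
          have "m \<otimes> y \<noteq> x" if "y \<in> ?Z" for y
          proof -
            have "m \<otimes> \<one> \<otimes> y \<in> J_ideal m" using J_idealI[of \<one> y m] mM that ZM by auto
            then have "m \<otimes> y \<in> I" using I m mM by (auto simp: two_sided_def)
            then show ?thesis using ZI[OF True] by auto
          qed
          then have "(\<Oplus>\<^bsub>?A\<^esub>y\<in>?Z. if m \<otimes> y = x then f y else \<zero>\<^bsub>?A\<^esub>) = (\<Oplus>\<^bsub>?A\<^esub>y\<in>?Z. \<zero>\<^bsub>?A\<^esub>)"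
            using A.zero_closed by (intro A.finsum_cong') auto
          then show ?thesis unfolding shift_def using A.add.finprod_one[of ?Z] by (simp only: if_cancel A.finsum_zero)
        qed (simp add: shift_def)
        then show ?thesis using Fact[OF mM f] by (simp add: fun_eq_iff)
      qed
      have killK: "killed I' ?K"
        unfolding killed_def
      proof (intro ballI)
        fix m f assume m: "m \<in> I'" and f: "f \<in> carrier ?K"
        have fF: "f \<in> carrier ?F" using f by simp
        have "F.act m f = \<zero>\<^bsub>?F\<^esub>"
        proof (cases "m \<in> I")
          case True
          then show ?thesis using killI fF by blast
        next
          case False
          then obtain a b where ab: "a \<in> carrier M" "b \<in> carrier M" "m = a \<otimes> (e \<otimes> b)" using decomp m by blast
          \<comment> \<open>After acting by \<open>b\<close> the function is still in the kernel.
            Acting by \<open>e\<close> leaves one value \<open>c\<close>, at \<open>e\<close>, and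
            the multiplication map returns exactly \<open>c\<close>; hence \<open>c\<close> is
            zero.\<close>
          let ?g = "F.act b f"
          have g: "?g \<in> carrier ?K" by (rule Kact[OF ab(2) f])
          then have gF: "?g \<in> carrier ?F" by simp
          obtain c where c: "c \<in> H" "shift ?A ?Z e ?g = single ?A e c"
            using shift_idempotent[OF ap aA e(1,2), of ?g] gF by auto
          have eg: "F.act e ?g = single ?A e c" using Fact[OF e(1) gF] c(2) by simp
          have "?\<phi> (F.act e ?g) = \<zero>\<^bsub>N\<^esub>" using Kact[OF e(1) g] by simp
          then have "c = \<zero>\<^bsub>N\<^esub>" using \<phi>s[OF c(1)] unfolding eg by simp
          then have "F.act e ?g = \<zero>\<^bsub>?F\<^esub>" unfolding eg by (simp add: single_def fun_eq_iff)
          moreover have "F.act m f = F.act a (F.act e ?g)"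
            using ab e F.act_mult[of a "e \<otimes> b" f] F.act_mult[of e b f] fF by simp
          ultimately show ?thesis using F.act_zero[OF ab(1)] by simp
        qed
        then show "frag_of m \<odot>\<^bsub>?K\<^esub> f = \<zero>\<^bsub>?K\<^esub>" unfolding F.act_def by simp
      qed
      have smallF: "carrier ?F \<lesssim> (UNIV :: 'u set)" by (rule small_fm[OF B.infinite_U ZM B.lepoll_U])
      have pK: "pdim_le TYPE('u) ZM (?n - 1 + p) ?K"
      proof -
        have "carrier ?K \<lesssim> (UNIV :: 'u set)" by (rule lepoll_trans[OF subset_imp_lepoll smallF]) auto
        then obtain K' :: "('m \<Rightarrow>\<^sub>0 int, 'u) module" and h k where K': "left_module ZM K'"
          and h: "h \<in> lmod_iso ZM ?K K'" and k: "k \<in> lmod_iso ZM K' ?K"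
          by (rule small_copy[OF lK]) blast
        have h': "h \<in> lmod_hom ZM ?K K'" "h ` carrier ?K = carrier K'"
          using h unfolding lmod_iso_def bij_betw_def by blast+
        have "killed I' K'"
          by (rule killed_image[OF lK K' h' I'M])
            (use killK lmod_hom_zero[OF lK K' h'(1)] in \<open>simp add: killed_def\<close>)
        from Suc.IH[OF I' K' this card] show ?thesis by (rule B.pdim_le_of_copy[OF _ lK k])
      qed
      have npos: "?n > 0" using fin one_closed by (auto simp: card_gt_0_iff)
      \<comment> \<open>The height of \<open>e\<close> is at most \<open>?n\<close>, so the
        dimension is at most \<open>Suc (?n - 1)\<close>. This is the inequality that fixes the
        starting value \<open>?n - 1\<close>.\<close>
      have pF: "pdim_le TYPE('u) ZM (Suc (?n - 1 + p)) ?F"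
      proof (rule B.pdim_le_mono)
        show "pdim_le TYPE('u) ZM (Suc (?n - 1)) ?F"
          by (rule pdim_fm_L_class[OF big reg aA B.lepoll_U e(1)]) (use height_le[OF e(1)] npos in linarith)
      qed simp
      let ?Im = "N\<lparr>carrier := ?\<phi> ` carrier ?F\<rparr>"
      note lIm = lmod_image[OF lF lN \<phi>]
      have \<phi>Im: "?\<phi> \<in> lmod_hom ZM ?F ?Im" using \<phi> by (auto simp: lmod_hom_def)
      have "ses ZM (lmod_kernel ?F ?Im ?\<phi>) (\<lambda>f. f) ?F ?\<phi> ?Im"
        by (rule ses_kernel[OF lF lIm \<phi>Im]) simp
      then have "ses ZM ?K (\<lambda>f. f) ?F ?\<phi> ?Im" by simp
      from B.pdim_le_cokernel[OF this pK pF]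
      have pIm: "pdim_le TYPE('u) ZM (?n - 1 + Suc p) ?Im" by simp
      have subIm: "?\<phi> ` carrier ?F \<subseteq> carrier N" using lmod_hom_closed[OF \<phi>] by auto
      obtain Q :: "('m \<Rightarrow>\<^sub>0 int, 'u) module" and q where Q: "left_module ZM Q" and q: "q \<in> lmod_hom ZM N Q"
        "q ` carrier N = carrier Q" and kerq: "{x \<in> carrier N. q x = \<zero>\<^bsub>Q\<^esub>} = ?\<phi> ` carrier ?F"
        by (rule quotient_exists[OF lN lIm subIm])
      have killQ: "killed I' Q"
      proof (rule killed_image[OF lN Q q I'M])
        fix m z assume m: "m \<in> I'" and z: "z \<in> carrier N"
        have "N.act m z \<in> ?\<phi> ` carrier ?F"
        proof (cases "m \<in> I")
          case True
          then have "N.act m z = ?\<phi> \<zero>\<^bsub>?F\<^esub>"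
            using kN z lmod_hom_zero[OF lF lN \<phi>] by (simp add: killed_def N.act_def)
          then show ?thesis using F.N.zero_closed by (intro image_eqI)
        next
          case False
          then obtain a b where ab: "a \<in> carrier M" "b \<in> carrier M" "m = a \<otimes> (e \<otimes> b)" using decomp m by blast
          \<comment> \<open>A product through \<open>e\<close> is a translate of an element of
            \<open>eN\<close>, and each such element is the image of a function concentrated at
            \<open>e\<close>.\<close>
          let ?c = "N.act e (N.act b z)"
          have c: "?c \<in> H" using N.act_closed[OF ab(2) z] by (auto simp: H_def)
          have "N.act m z = N.act a ?c"
            using ab e z N.act_mult[of a "e \<otimes> b" z] N.act_mult[of e b z] by simp
          also have "\<dots> = N.act a (?\<phi> (single ?A e ?c))" by (simp only: \<phi>s[OF c])
          also have "\<dots> = ?\<phi> (F.act a (single ?A e ?c))"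
            unfolding N.act_def F.act_def
            by (rule lmod_hom_smult[OF \<phi> ZM_of_closed[OF ab(1)] sH[OF c, unfolded N.act_def], symmetric])
          finally have "N.act m z = ?\<phi> (F.act a (single ?A e ?c))" .
          then show ?thesis using F.act_closed[OF ab(1) sH[OF c]] by (rule image_eqI)
        qed
        then show "q (frag_of m \<odot>\<^bsub>N\<^esub> z) = \<zero>\<^bsub>Q\<^esub>" using kerq by (auto simp: N.act_def)
      qed
      have "pd ZM (?n - 1 + p) Q" by (rule Suc.IH[OF I' Q killQ card])
      then have pQ: "pdim_le TYPE('u) ZM (?n - 1 + Suc p) Q"
        using B.pdim_le_of_copy[OF B.pd_mono Q, of "?n - 1 + p" Q "?n - 1 + Suc p" "\<lambda>x. x"]
        by (simp add: lmod_iso_def lmod_hom_id bij_betw_def inj_on_def)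
      \<comment> \<open>The module is an extension of the cokernel by the image, and both have the
        required dimension.\<close>
      have "ses ZM ?Im (\<lambda>x. x) N q Q"
        using ses_kernel[OF lN Q q] by (simp add: kerq)
      from B.pdim_le_ext[OF this pIm pQ B.lepoll_U]
      show ?thesis
        using B.pdim_le_copy[OF _ lN, of "?n - 1 + Suc p" N "\<lambda>x. x"]
        by (simp add: lmod_iso_def lmod_hom_id bij_betw_def inj_on_def)
    qed
  }
qed

end

section \<open>Finitely generated resolutions and the trivial module\<close>

lemma (in free_lift) flift_in:
  assumes "Poly_Mapping.keys x \<subseteq> S" "\<zero> \<in> H" "\<And>s. s \<in> S \<Longrightarrow> u s \<in> H"
    "\<And>a b. \<lbrakk>a \<in> H; b \<in> H\<rbrakk> \<Longrightarrow> a \<ominus> b \<in> H"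
  shows "flift S N u x \<in> H"
  using assms(1)
proof (induction x rule: frag_support_induct)
  case zero
  then show ?case using assms(2) by (simp add: free_lift.zero[OF free_lift_axioms])
next
  case (diff x y)
  then show ?case using assms(4) by (simp add: free_lift.diff[OF free_lift_axioms])
next
  case (of s)
  then show ?case using assms(3) by (simp add: free_lift.of[OF free_lift_axioms])
qed

lemma zfg_imp_fg_module:
  assumes P: "left_module R P" and z: "zfg P"
  shows "fg_module R P"
proof -
  interpret P: left_module R P by fact
  obtain S where S: "finite S" "S \<subseteq> carrier P" "carrier P \<subseteq> flift S P (\<lambda>x. x) ` {x. Poly_Mapping.keys x \<subseteq> S}"
    using z by (auto simp: zfg_def)
  interpret I: free_lift P S "\<lambda>x. x" by (rule free_liftI[OF P.N.abelian_group_axioms]) (use S in auto)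
  have "H = carrier P" if H: "submodule H R P" "S \<subseteq> H" for H
  proof (intro equalityI subsetI)
    have sg: "subgroup H (add_monoid P)" using H(1) by (simp add: submodule_def)
    show "x \<in> carrier P" if "x \<in> H" for x using subgroup.mem_carrier[OF sg that] by simp
    have diff: "a \<ominus>\<^bsub>P\<^esub> b \<in> H" if "a \<in> H" "b \<in> H" for a b
      using subgroup.m_closed[OF sg that(1) subgroup.m_inv_closed[OF sg that(2)]]
      by (simp add: a_minus_def a_inv_def)
    fix x assume "x \<in> carrier P"
    then obtain y where "Poly_Mapping.keys y \<subseteq> S" "x = flift S P (\<lambda>x. x) y" using S(3) by auto
    then show "x \<in> H"
      using I.flift_in[of y H] subgroup.one_closed[OF sg] H(2) diff by auto
  qed
  then show ?thesis using P S unfolding fg_module_def by blast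
qed

context fin_monoid_ring begin

text \<open>Additively the free module is generated by the pairs of a basis element and a monoid
  element; the function \<open>?g s\<close> extracts the coordinate at \<open>s\<close>.\<close>

lemma zfg_free_left_module:
  assumes S: "finite S"
  shows "zfg (free_left_module ZM S)"
proof -
  let ?F = "free_left_module ZM S"
  let ?g = "\<lambda>s. frag_extend (\<lambda>(s', m). if s' = s then frag_of m else 0 :: 'm \<Rightarrow>\<^sub>0 int)"
  interpret F: left_module ZM ?F by (rule left_module_free[OF ring_ZM])
  show ?thesis
  proof (rule zfgI[OF F.N.abelian_group_axioms, of "S \<times> carrier M" "\<lambda>x s. ?g s x"])
    show "finite (S \<times> carrier M)" using S fin by simp
  next
    fix x :: "'a \<times> 'm \<Rightarrow>\<^sub>0 int" assume x: "Poly_Mapping.keys x \<subseteq> S \<times> carrier M"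
    have k: "Poly_Mapping.keys (?g s x) \<subseteq> carrier M" for s
      using x
    proof (induction x rule: frag_induction)
      case (diff a b)
      then show ?case using keys_diff[of "?g s a" "?g s b"] by (auto simp: frag_extend_diff)
    qed (auto split: if_splits)
    have z: "?g s x = 0" if "s \<notin> S" for s
      using x by (induction x rule: frag_induction) (use that in \<open>auto simp: frag_extend_diff\<close>)
    have "finite {s. ?g s x \<noteq> 0}" by (rule finite_subset[OF _ S]) (use z in auto)
    then show "(\<lambda>s. ?g s x) \<in> carrier ?F" using k z by simp
  next
    fix f assume f: "f \<in> carrier ?F"
    let ?x = "\<Sum>s\<in>S. frag_extend (\<lambda>m. frag_of (s, m)) (f s)"
    have fk: "Poly_Mapping.keys (f s) \<subseteq> carrier M" for s using f by simp
    have keys: "Poly_Mapping.keys (frag_extend (\<lambda>m. frag_of (s, m)) c) \<subseteq> S \<times> carrier M"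
      if "s \<in> S" "Poly_Mapping.keys c \<subseteq> carrier M" for s and c :: "'m \<Rightarrow>\<^sub>0 int"
      using that(2)
    proof (induction c rule: frag_induction)
      case (diff a b)
      then show ?case
        using keys_diff[of "frag_extend (\<lambda>m. frag_of (s, m)) a" "frag_extend (\<lambda>m. frag_of (s, m)) b"]
        by (auto simp: frag_extend_diff)
    qed (use that(1) in auto)
    have comp: "?g s (frag_extend (\<lambda>m. frag_of (s', m)) c) = (if s' = s then c else 0)" for s s' and c :: "'m \<Rightarrow>\<^sub>0 int"
    proof -
      have "Poly_Mapping.keys c \<subseteq> UNIV" by simp
      then show ?thesis by (induction c rule: frag_induction) (auto simp: frag_extend_diff)
    qed
    have "?x \<in> carrier (free_Abelian_group (S \<times> carrier M))"
      by (rule sum_closed_free_Abelian_group) (use keys fk in simp)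
    moreover have "?g s ?x = f s" for s
      using f S by (simp add: frag_extend_sum comp_def comp)
    ultimately show "\<exists>x. Poly_Mapping.keys x \<subseteq> S \<times> carrier M \<and> (\<lambda>s. ?g s x) = f" by auto
  qed (simp add: frag_extend_add)
qed

text \<open>Cover by the free module on finitely many additive generators. Its additive group is
  finitely generated, hence so is the kernel, and the step can be repeated.\<close>

lemma fg_cover:
  fixes N :: "('m \<Rightarrow>\<^sub>0 int, 'u) module"
  assumes big: "big_type TYPE('u) ZM" and N: "left_module ZM N" and z: "zfg N"
  shows "\<exists>(P :: ('m \<Rightarrow>\<^sub>0 int, 'u) module) f. proj ZM P \<and> f \<in> lmod_hom ZM P N \<and> f ` carrier P = carrier N \<and>
    fg_module ZM P \<and> zfg (lmod_kernel P N f)"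
proof -
  interpret B: big_type ZM "TYPE('u)" by (rule big)
  interpret N: left_module ZM N by (rule N)
  obtain S where S: "finite S" "S \<subseteq> carrier N" "carrier N \<subseteq> flift S N (\<lambda>x. x) ` {x. Poly_Mapping.keys x \<subseteq> S}"
    using z by (auto simp: zfg_def)
  interpret I: free_lift N S "\<lambda>x. x" by (rule free_liftI[OF N.N.abelian_group_axioms]) (use S in auto)
  let ?F = "free_left_module ZM S"
  note lF = left_module_free[OF ring_ZM, of S]
  interpret F: left_module ZM ?F by (rule lF)
  have \<pi>: "lin ZM N (\<lambda>x. x) \<in> lmod_hom ZM ?F N" by (rule lin_hom[OF N]) (use S in auto)
  interpret Im: left_module ZM "N\<lparr>carrier := lin ZM N (\<lambda>x. x) ` carrier ?F\<rparr>" by (rule lmod_image[OF lF N \<pi>])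
  have \<pi>s: "lin ZM N (\<lambda>x. x) ` carrier ?F = carrier N"
  proof (intro equalityI subsetI)
    fix x assume "x \<in> carrier N"
    then obtain y where y: "Poly_Mapping.keys y \<subseteq> S" "x = flift S N (\<lambda>x. x) y" using S(3) by auto
    show "x \<in> lin ZM N (\<lambda>x. x) ` carrier ?F"
      unfolding y(2)
    proof (rule I.flift_in[OF y(1)])
      show "\<zero>\<^bsub>N\<^esub> \<in> lin ZM N (\<lambda>x. x) ` carrier ?F" using Im.N.zero_closed by simp
      show "s \<in> lin ZM N (\<lambda>x. x) ` carrier ?F" if "s \<in> S" for s
      proof (rule image_eqI)
        have "(\<lambda>x. x) \<in> S \<rightarrow> carrier N" using S(2) by blast
        from lin_delta[OF N this that] show "s = lin ZM N (\<lambda>x. x) (delta ZM s)" by (rule sym)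
      qed (rule delta_closed[OF ring_ZM that])
      fix a b assume "a \<in> lin ZM N (\<lambda>x. x) ` carrier ?F" "b \<in> lin ZM N (\<lambda>x. x) ` carrier ?F"
      then obtain a' b' where ab: "a' \<in> carrier ?F" "b' \<in> carrier ?F" "a = lin ZM N (\<lambda>x. x) a'" "b = lin ZM N (\<lambda>x. x) b'"
        by blast
      have "a \<ominus>\<^bsub>N\<^esub> b = lin ZM N (\<lambda>x. x) (a' \<ominus>\<^bsub>?F\<^esub> b')"
        unfolding ab(3,4) by (rule lmod_hom_minus[OF lF N \<pi> ab(1,2), symmetric])
      then show "a \<ominus>\<^bsub>N\<^esub> b \<in> lin ZM N (\<lambda>x. x) ` carrier ?F"
        using F.N.minus_closed[OF ab(1,2)] by (simp only: image_eqI)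
    qed
  qed (use lmod_hom_closed[OF \<pi>] in blast)
  obtain P :: "('m \<Rightarrow>\<^sub>0 int, 'u) module" and h k where P: "left_module ZM P"
    and h: "h \<in> lmod_iso ZM ?F P" and k: "k \<in> lmod_iso ZM P ?F"
    by (rule small_copy[OF lF B.small_free[OF B.lepoll_U]]) blast
  interpret P: left_module ZM P by (rule P)
  have h': "h \<in> lmod_hom ZM ?F P" "h ` carrier ?F = carrier P" and k': "k \<in> lmod_hom ZM P ?F" "k ` carrier P = carrier ?F"
    using h k unfolding lmod_iso_def bij_betw_def by blast+
  let ?f = "\<lambda>x. lin ZM N (\<lambda>x. x) (k x)"
  have f: "?f \<in> lmod_hom ZM P N" by (rule lmod_hom_comp[OF k'(1) \<pi>])
  have fs: "?f ` carrier P = carrier N" using \<pi>s k'(2) by (metis image_image)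
  have zP: "zfg P"
    by (rule zfg_image[OF F.N.abelian_group_axioms P.N.abelian_group_axioms zfg_free_left_module[OF S(1)], of h])
      (use h'(2) in \<open>auto simp: lmod_hom_closed[OF h'(1)] lmod_hom_add[OF h'(1)] simp del: free_left_module_simps\<close>)
  have "zfg (lmod_kernel P N ?f)"
  proof (rule zfg_sub[OF P.N.abelian_group_axioms zP])
    fix x y assume "x \<in> {x \<in> carrier P. ?f x = \<zero>\<^bsub>N\<^esub>}" "y \<in> {x \<in> carrier P. ?f x = \<zero>\<^bsub>N\<^esub>}"
    then show "x \<ominus>\<^bsub>P\<^esub> y \<in> {x \<in> carrier P. ?f x = \<zero>\<^bsub>N\<^esub>}"
      using lmod_hom_minus[OF P N f, of x y] N.N.r_neg[OF N.N.zero_closed] by (simp add: a_minus_def)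
  qed (use lmod_hom_zero[OF P N f] in auto)
  moreover have "proj ZM P" by (rule proj_iso[OF proj_free[OF ring_ZM] P k])
  ultimately show ?thesis using f fs zfg_imp_fg_module[OF P zP] by blast
qed

text \<open>The last term of the resolution is a syzygy, not a chosen cover; additive finite
  generation has been carried along, so this term is finitely generated too.\<close>

lemma fg_resolution:
  fixes N :: "('m \<Rightarrow>\<^sub>0 int, 't) module"
  assumes big: "big_type TYPE('u) ZM" and pd: "pdim_le TYPE('u) ZM l N" and z: "zfg N"
  shows "\<exists>(P :: nat \<Rightarrow> ('m \<Rightarrow>\<^sub>0 int, 'u) module) d \<epsilon>. projective_resolution ZM N P d \<epsilon> \<and>
    length_at_most P l \<and> (\<forall>n. fg_module ZM (P n))"
proof -
  interpret B: big_type ZM "TYPE('u)" by (rule big)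
  note lN = pdim_le_left_module[OF pd]
  obtain L :: "('m \<Rightarrow>\<^sub>0 int, 'u) module" and k where L: "pd ZM l L" "k \<in> lmod_iso ZM L N"
    using pd by (auto simp: pdim_le_def)
  note lL = pd_left_module[OF L(1)]
  have g: "inv_into (carrier L) k \<in> lmod_hom ZM N L" "inv_into (carrier L) k ` carrier N = carrier L"
    using lmod_iso_inv[OF lL L(2)] unfolding lmod_iso_def bij_betw_def by blast+
  have "zfg L"
    by (rule zfg_image[OF left_module.axioms(2)[OF lN] left_module.axioms(2)[OF lL] z lmod_hom_closed[OF g(1)]
        lmod_hom_add[OF g(1)] g(2)])
  have "\<exists>(P :: nat \<Rightarrow> ('m \<Rightarrow>\<^sub>0 int, 'u) module) d \<epsilon>. projective_resolution ZM L P d \<epsilon> \<and>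
    length_at_most P l \<and> (\<forall>n. fg_module ZM (P n))"
  proof (rule B.pd_resolution[where \<Psi>=zfg, OF fg_cover[OF big]])
    fix N :: "('m \<Rightarrow>\<^sub>0 int, 'u) module" assume N: "proj ZM N" "zfg N"
    interpret N: left_module ZM N using N(1) by (rule proj_left_module)
    have "left_module ZM (N\<lparr>carrier := {\<zero>\<^bsub>N\<^esub>}\<rparr>)"
      by (rule N.left_module_sub) (auto simp: N.smult_r_zero)
    moreover have "zfg (N\<lparr>carrier := {\<zero>\<^bsub>N\<^esub>}\<rparr>)"
      by (rule zfg_sub[OF N.N.abelian_group_axioms N(2)]) (use N.N.r_neg[OF N.N.zero_closed] in \<open>auto simp: a_minus_def\<close>)
    ultimately show "fg_module ZM N \<and> fg_module ZM (N\<lparr>carrier := {\<zero>\<^bsub>N\<^esub>}\<rparr>)"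
      using N.left_module_axioms N(2) zfg_imp_fg_module by blast
  qed (use L \<open>zfg L\<close> in auto)
  then show ?thesis using B.projective_resolution_iso[OF _ lN L(2)] by blast
qed

lemma trivial_module_simps [simp]:
  "carrier (trivial_module M) = UNIV" "\<zero>\<^bsub>trivial_module M\<^esub> = 0" "x \<oplus>\<^bsub>trivial_module M\<^esub> y = x + y"
  by (auto simp: trivial_module_def)

lemma left_module_trivial: "left_module ZM (trivial_module M)"
proof -
  \<comment> \<open>The augmentation, summed over the whole monoid instead of the support, which
    makes additivity evident.\<close>
  define a where "a f = (\<Sum>m \<in> carrier M. Poly_Mapping.lookup f m)" for f :: "'m \<Rightarrow>\<^sub>0 int"
  have sm: "f \<odot>\<^bsub>trivial_module M\<^esub> k = a f * k" if "Poly_Mapping.keys f \<subseteq> carrier M" for f k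
  proof -
    have "(\<Sum>m \<in> Poly_Mapping.keys f. Poly_Mapping.lookup f m) = a f"
      unfolding a_def by (rule sum.mono_neutral_left[OF fin that]) (simp add: in_keys_iff)
    then show ?thesis by (simp add: trivial_module_def a_def)
  qed
  have diff: "a (f - g) = a f - a g" and add: "a (f + g) = a f + a g" for f g
    by (simp_all add: a_def lookup_minus lookup_add sum_subtractf sum.distrib)
  have one: "a (frag_of x) = 1" if "x \<in> carrier M" for x
    using that fin by (simp add: a_def lookup_single when_def)
  have zero: "a 0 = 0" by (simp add: a_def)
  have mult: "a (f \<otimes>\<^bsub>ZM\<^esub> g) = a f * a g" if f: "f \<in> carrier ZM" and g: "g \<in> carrier ZM" for f g
  proof -
    have 1: "a (frag_of x \<otimes>\<^bsub>ZM\<^esub> g) = a g" if "x \<in> carrier M" for x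
    proof -
      have "Poly_Mapping.keys g \<subseteq> carrier M" using g by simp
      then show ?thesis
        by (induction g rule: frag_induction) (use that in \<open>simp_all add: ZM_mult_zero_right ZM_mult_diff_right diff one zero\<close>)
    qed
    have "Poly_Mapping.keys f \<subseteq> carrier M" using f by simp
    then show ?thesis
      by (induction f rule: frag_induction)
        (simp_all add: ZM_mult_zero_left ZM_mult_diff_left diff one zero 1 left_diff_distrib)
  qed
  show ?thesis
  proof (rule left_moduleI[OF ring_ZM])
    fix f g and k :: int assume fg: "f \<in> carrier ZM" "g \<in> carrier ZM"
    have "Poly_Mapping.keys (f + g) \<subseteq> carrier M" using fg keys_add[of f g] by auto
    then show "(f \<oplus>\<^bsub>ZM\<^esub> g) \<odot>\<^bsub>trivial_module M\<^esub> k = f \<odot>\<^bsub>trivial_module M\<^esub> k \<oplus>\<^bsub>trivial_module M\<^esub> g \<odot>\<^bsub>trivial_module M\<^esub> k"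
      using fg by (simp add: sm add distrib_right)
    have "Poly_Mapping.keys (f \<otimes>\<^bsub>ZM\<^esub> g) \<subseteq> carrier M" using ZM_mult_closed[OF fg] by simp
    then show "(f \<otimes>\<^bsub>ZM\<^esub> g) \<odot>\<^bsub>trivial_module M\<^esub> k = f \<odot>\<^bsub>trivial_module M\<^esub> (g \<odot>\<^bsub>trivial_module M\<^esub> k)"
      using fg mult[OF fg] by (simp add: sm)
  qed (auto simp: sm one zero distrib_left)
qed

lemma zfg_trivial_module: "zfg (trivial_module M)"
proof (rule zfgI[OF left_module.axioms(2)[OF left_module_trivial], of "{()}" "\<lambda>x. Poly_Mapping.lookup x ()"])
  fix a :: int
  show "\<exists>x. Poly_Mapping.keys x \<subseteq> {()} \<and> Poly_Mapping.lookup x () = a"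
    by (intro exI[of _ "Poly_Mapping.single () a"]) auto
qed (auto simp: lookup_add)

lemma pdim_le_finite_regular_aperiodic:
  fixes N :: "('m \<Rightarrow>\<^sub>0 int, 'b) module"
  assumes reg: "regular_monoid M" and ap: "aperiodic_monoid M" and N: "left_module ZM N"
  shows "pdim_le TYPE(('m \<Rightarrow>\<^sub>0 int, 'b) res_carrier) ZM (2 * card (J_classes M) - 1) N"
proof -
  interpret B: big_type ZM "TYPE(('m \<Rightarrow>\<^sub>0 int, 'b) res_carrier)" by (rule big_type_ZM)
  have "inj (\<lambda>x :: 'b. [Inr x :: ('m \<Rightarrow>\<^sub>0 int) + 'b])" by (rule injI) simp
  then have "carrier N \<lesssim> (UNIV :: ('m \<Rightarrow>\<^sub>0 int, 'b) res_carrier set)"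
    unfolding lepoll_def by (meson inj_on_subset subset_UNIV)
  then obtain N' :: "('m \<Rightarrow>\<^sub>0 int, ('m \<Rightarrow>\<^sub>0 int, 'b) res_carrier) module" and h k where N': "left_module ZM N'"
    and k: "k \<in> lmod_iso ZM N' N"
    by (rule small_copy[OF N]) blast
  let ?n = "card (J_ideal ` carrier M)"
  \<comment> \<open>The empty ideal kills every module and leaves all \<open>?n\<close> J-classes
    outside.\<close>
  have "pd ZM (?n - 1 + ?n) N'"
    by (rule pd_killed[OF big_type_ZM reg ap _ N', of "{}"]) (auto simp: two_sided_def killed_def)
  moreover have "?n - 1 + ?n = 2 * card (J_classes M) - 1" unfolding card_J_classes by simp
  ultimately show ?thesis using B.pdim_le_of_copy[OF _ N k] by metis
qed

end

theorem corollary5p15: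
  fixes M :: "'m monoid"
  assumes "monoid M"
    and "finite (carrier M)"
    and "aperiodic_monoid M"
    and "regular_monoid M"
  shows "left_global_dim (int_monoid_ring M) TYPE('b) < \<infinity> \<and>
         left_global_dim (int_monoid_ring M) TYPE('b) \<le> enat (3 * card (J_classes M) - 2) \<and>
         (\<exists>q0. \<forall>q \<ge> q0. trivial_group (monoid_homology M q)) \<and>
         (\<exists>(P :: nat \<Rightarrow> ('m \<Rightarrow>\<^sub>0 int, ('m \<Rightarrow>\<^sub>0 int, int) res_carrier) module) d \<epsilon> l.
            projective_resolution (int_monoid_ring M) (trivial_module M) P d \<epsilon> \<and>
            length_at_most P l \<and>
            (\<forall>n. fg_module (int_monoid_ring M) (P n)))"
proof -
  interpret fin_monoid_ring M
    using assms by (simp add: fin_monoid_ring_def monoid_ring_def fin_monoid_ring_axioms_def)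
  let ?l = "2 * card (J_classes M) - 1"
  have "card (J_classes M) > 0"
    unfolding card_J_classes using fin one_closed by (auto simp: card_gt_0_iff)
  \<comment> \<open>There is at least one J-class, that of the identity, and for
    \<open>n \<ge> 1\<close> the bound \<open>2n - 1\<close> is at most
    \<open>3n - 2\<close>.\<close>
  then have le: "?l \<le> 3 * card (J_classes M) - 2" by simp
  have "left_global_dim ZM TYPE('b) \<le> enat ?l"
    by (rule left_global_dim_le[OF big_type_ZM pdim_le_finite_regular_aperiodic[OF assms(4,3)]])
  then have dim: "left_global_dim ZM TYPE('b) \<le> enat (3 * card (J_classes M) - 2)"
    using le by (meson enat_ord_simps(1) order_trans)
  note pd = pdim_le_finite_regular_aperiodic[OF assms(4,3) left_module_trivial]
  have "right_tensor ZM (trivial_module M)"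
    by (intro right_tensor.intro right_tensor_axioms.intro ring_ZM) auto
  then have "trivial_group (monoid_homology M q)" if "q \<ge> ?l + 2" for q
    unfolding monoid_homology_def by (rule Tor_trivial[OF big_type_ZM _ pd]) (use that in simp)
  moreover have "left_global_dim ZM TYPE('b) < \<infinity>"
    using dim by (rule le_less_trans) simp
  ultimately show ?thesis
    using dim fg_resolution[OF big_type_ZM pd zfg_trivial_module] by blast
qed

end
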